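(* Let $I\subsetneq S=K[x_1,\dots,x_m,y_1,\dots,y_n]$ be a proper monomial ideal. The following statements hold: (a) For each associated prime $\mathfrak p$ of $I$ (that is, $\mathfrak p\in\operatorname{Ass}(S/I)$, a prime generated by a subset of the variables), let $\mathfrak p^y$ be the ideal generated by the variables $y_j$ lying in $\mathfrak p$. If $d=\max\{\operatorname{height}\mathfrak p^y:\mathfrak p\in\operatorname{Ass}(S/I)\}$, then $\operatorname{mgrade}(Q,S/I)=n-d$. (b) If $S/I$ is Cohen--Macaulay, then $S/I$ has maximal depth with respect to $P$ and with respect to $Q$.
   Context: $K$ is a field and $S=K[x_1,\dots,x_m,y_1,\dots,y_n]$ is the standard bigraded polynomial ring: $\deg x_i=(1,0)$, $\deg y_j=(0,1)$. Set $P=(x_1,\dots,x_m)$ and $Q=(y_1,\dots,y_n)$. For $J\in\{P,Q\}$ and a nonzero finitely generated bigraded $S$-module $N$, $\operatorname{cd}(J,N)$ is the largest integer $i$ with $H^i_J(N)\neq 0$, $\operatorname{grade}(J,N)$ is the length of a maximal $N$-regular sequence in $J$ (equivalently the smallest $i$ with $H^i_J(N)\ne0$), and $\operatorname{mgrade}(J,N)=\min\{\operatorname{cd}(J,S/\mathfrak p):\mathfrak p\in\operatorname{Ass}(N)\}$. $N$ has maximal depth with respect to $J$ if $\operatorname{grade}(J,N)=\operatorname{mgrade}(J,N)$. *)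

theory Defs
  imports
    "HOL-Library.Extended_Nat"
    "HOL-Library.Poly_Mapping"
    "HOL-Algebra.Ring_Divisibility"
    "HOL-Algebra.Product_Groups"
begin

section \<open>Modules\<close>

definition ring_as_module ::
  "('b, 'c) ring_scheme \<Rightarrow> ('a \<Rightarrow> 'b \<Rightarrow> 'b) \<Rightarrow> ('a, 'b) module" where
  "ring_as_module A f = \<lparr>carrier = carrier A, monoid.mult = monoid.mult A, one = one A,
     zero = zero A, add = add A, smult = f\<rparr>"

abbreviation self_module :: "('a, 'c) ring_scheme \<Rightarrow> ('a, 'a) module" where
  "self_module A \<equiv> ring_as_module A (monoid.mult A)"

definition quotient_module :: "('a, 'c) ring_scheme \<Rightarrow> 'a set \<Rightarrow> ('a, 'a set) module" where
  "quotient_module R I =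
     ring_as_module (R Quot I) (\<lambda>r X. (I +>\<^bsub>R\<^esub> r) \<otimes>\<^bsub>R Quot I\<^esub> X)"

definition annihilator ::
  "('a, 'c) ring_scheme \<Rightarrow> ('a, 'b, 'd) module_scheme \<Rightarrow> 'b \<Rightarrow> 'a set" where
  "annihilator R M x = {r \<in> carrier R. r \<odot>\<^bsub>M\<^esub> x = \<zero>\<^bsub>M\<^esub>}"

definition Ass :: "('a, 'c) ring_scheme \<Rightarrow> ('a, 'b, 'd) module_scheme \<Rightarrow> 'a set set" where
  "Ass R M = {p. primeideal p R \<and> (\<exists>x \<in> carrier M. p = annihilator R M x)}"


section \<open>Height and Krull dimension\<close>

definition prime_chain :: "('a, 'c) ring_scheme \<Rightarrow> nat \<Rightarrow> (nat \<Rightarrow> 'a set) \<Rightarrow> bool" where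
  "prime_chain R l c \<longleftrightarrow> (\<forall>i\<le>l. primeideal (c i) R) \<and> (\<forall>i<l. c i \<subset> c (Suc i))"

definition krull_dim :: "('a, 'c) ring_scheme \<Rightarrow> enat" where
  "krull_dim R = Sup {enat l | l c. prime_chain R l c}"

definition prime_height :: "('a, 'c) ring_scheme \<Rightarrow> 'a set \<Rightarrow> enat" where
  "prime_height R p = Sup {enat l | l c. prime_chain R l c \<and> c l = p}"

definition height :: "('a, 'c) ring_scheme \<Rightarrow> 'a set \<Rightarrow> enat" where
  "height R J = Inf {prime_height R p | p. primeideal p R \<and> J \<subseteq> p}"


section \<open>Regular sequences and grade\<close>

text \<open>The submodule \<open>(f\<^sub>1, \<dots>, f\<^sub>r)M\<close>.\<close>

primrec seq_mult :: "('a, 'b, 'd) module_scheme \<Rightarrow> 'a list \<Rightarrow> 'b set" where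
  "seq_mult M [] = {\<zero>\<^bsub>M\<^esub>}"
| "seq_mult M (f # fs) =
     {(f \<odot>\<^bsub>M\<^esub> x) \<oplus>\<^bsub>M\<^esub> u | x u. x \<in> carrier M \<and> u \<in> seq_mult M fs}"

definition regular_sequence :: "('a, 'b, 'd) module_scheme \<Rightarrow> 'a list \<Rightarrow> bool" where
  "regular_sequence M fs \<longleftrightarrow>
     (\<forall>i<length fs. \<forall>x\<in>carrier M.
        (fs ! i) \<odot>\<^bsub>M\<^esub> x \<in> seq_mult M (take i fs) \<longrightarrow> x \<in> seq_mult M (take i fs)) \<and>
     seq_mult M fs \<noteq> carrier M"

text \<open>All maximal \<open>M\<close>-regular sequences in \<open>J\<close> have the same length when \<open>M\<close> is finitely
  generated over a Noetherian ring and \<open>J M \<noteq> M\<close>, so the supremum is that common length.\<close>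

definition grade :: "'a set \<Rightarrow> ('a, 'b, 'd) module_scheme \<Rightarrow> enat" where
  "grade J M = Sup {enat (length fs) | fs. set fs \<subseteq> J \<and> regular_sequence M fs}"


section \<open>Localization\<close>

text \<open>The fraction \<open>x/s\<close>, as an equivalence class of pairs.\<close>

definition fraction ::
  "('a, 'c) ring_scheme \<Rightarrow> ('a, 'b, 'd) module_scheme \<Rightarrow> 'a set \<Rightarrow> 'b \<Rightarrow> 'a \<Rightarrow> ('b \<times> 'a) set" where
  "fraction R M U x s = {(y, t). y \<in> carrier M \<and> t \<in> U \<and>
     (\<exists>u\<in>U. (u \<otimes>\<^bsub>R\<^esub> t) \<odot>\<^bsub>M\<^esub> x = (u \<otimes>\<^bsub>R\<^esub> s) \<odot>\<^bsub>M\<^esub> y)}"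

text \<open>Operations on classes are unions over all representatives, which
  give the same class each time. The fields \<open>mult\<close> and \<open>one\<close> are meaningful only if \<open>M\<close> is an
  \<open>R\<close>-algebra; they are used for \<open>M = R\<close>.\<close>

definition localization ::
  "('a, 'c) ring_scheme \<Rightarrow> ('a, 'b, 'd) module_scheme \<Rightarrow> 'a set \<Rightarrow> ('a, ('b \<times> 'a) set) module" where
  "localization R M U =
     \<lparr>carrier = {fraction R M U x s | x s. x \<in> carrier M \<and> s \<in> U},
      monoid.mult = (\<lambda>X Y. \<Union>(x, s)\<in>X. \<Union>(y, t)\<in>Y. fraction R M U (x \<otimes>\<^bsub>M\<^esub> y) (s \<otimes>\<^bsub>R\<^esub> t)),
      one = fraction R M U \<one>\<^bsub>M\<^esub> \<one>\<^bsub>R\<^esub>,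
      zero = fraction R M U \<zero>\<^bsub>M\<^esub> \<one>\<^bsub>R\<^esub>,
      add = (\<lambda>X Y. \<Union>(x, s)\<in>X. \<Union>(y, t)\<in>Y.
        fraction R M U ((t \<odot>\<^bsub>M\<^esub> x) \<oplus>\<^bsub>M\<^esub> (s \<odot>\<^bsub>M\<^esub> y)) (s \<otimes>\<^bsub>R\<^esub> t)),
      smult = (\<lambda>r X. \<Union>(x, s)\<in>X. fraction R M U (r \<odot>\<^bsub>M\<^esub> x) s)\<rparr>"

definition local_ring_at :: "('a, 'c) ring_scheme \<Rightarrow> 'a set \<Rightarrow> ('a, ('a \<times> 'a) set) module" where
  "local_ring_at R p = localization R (self_module R) (carrier R - p)"


section \<open>Cohen--Macaulay rings\<close>

definition depth :: "('a, 'c) ring_scheme \<Rightarrow> enat" where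
  "depth A = grade (THE m. maximalideal m A) (self_module A)"

definition cohen_macaulay :: "('a, 'c) ring_scheme \<Rightarrow> bool" where
  "cohen_macaulay R \<longleftrightarrow> cring R \<and> noetherian_ring R \<and>
     (\<forall>p. primeideal p R \<longrightarrow> depth (local_ring_at R p) = krull_dim (local_ring_at R p))"


section \<open>Local cohomology\<close>

text \<open>For \<open>J = (f\<^sub>1, \<dots>, f\<^sub>r)\<close>, \<open>H\<^sup>i\<^sub>J(M)\<close> is the \<open>i\<close>-th cohomology of the Cech complex, whose
  \<open>i\<close>-th term is the direct sum of the localizations of \<open>M\<close> at \<open>\<Prod>\<^sub>k\<^sub>\<in>\<^sub>A f\<^sub>k\<close> over the \<open>i\<close>-element
  sets \<open>A\<close> of indices. It is written with the system of generators rather than the ideal as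
  argument. Inverting a product is done by inverting its factors, so that the restriction maps
  are \<open>x/s \<mapsto> x/s\<close>.\<close>

definition cech_denoms :: "('a, 'c) ring_scheme \<Rightarrow> 'a list \<Rightarrow> nat set \<Rightarrow> 'a set" where
  "cech_denoms R fs A = {finprod R (\<lambda>k. (fs ! k) [^]\<^bsub>R\<^esub> e k) A | e :: nat \<Rightarrow> nat. True}"

definition cech_loc ::
  "('a, 'c) ring_scheme \<Rightarrow> 'a list \<Rightarrow> ('a, 'b, 'd) module_scheme \<Rightarrow> nat set \<Rightarrow>
     ('a, ('b \<times> 'a) set) module" where
  "cech_loc R fs M A = localization R M (cech_denoms R fs A)"

definition cech_restrict ::
  "('a, 'c) ring_scheme \<Rightarrow> 'a list \<Rightarrow> ('a, 'b, 'd) module_scheme \<Rightarrow> nat set \<Rightarrow>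
     ('b \<times> 'a) set \<Rightarrow> ('b \<times> 'a) set" where
  "cech_restrict R fs M B X = (\<Union>(x, s)\<in>X. fraction R M (cech_denoms R fs B) x s)"

definition cech_index :: "'a list \<Rightarrow> nat \<Rightarrow> nat set set" where
  "cech_index fs i = {A. A \<subseteq> {..<length fs} \<and> card A = i}"

definition cech_cochains ::
  "('a, 'c) ring_scheme \<Rightarrow> 'a list \<Rightarrow> ('a, 'b, 'd) module_scheme \<Rightarrow> nat \<Rightarrow>
     (nat set \<Rightarrow> ('b \<times> 'a) set) monoid" where
  "cech_cochains R fs M i =
     product_group (cech_index fs i) (\<lambda>A. add_monoid (cech_loc R fs M A))"

definition cech_diff ::
  "('a, 'c) ring_scheme \<Rightarrow> 'a list \<Rightarrow> ('a, 'b, 'd) module_scheme \<Rightarrow> nat \<Rightarrow>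
     (nat set \<Rightarrow> ('b \<times> 'a) set) \<Rightarrow> (nat set \<Rightarrow> ('b \<times> 'a) set)" where
  "cech_diff R fs M i c = (\<lambda>B \<in> cech_index fs (Suc i).
     finsum (cech_loc R fs M B)
       (\<lambda>k. let z = cech_restrict R fs M B (c (B - {k})) in
          if even (card {j \<in> B. j < k}) then z else \<ominus>\<^bsub>cech_loc R fs M B\<^esub> z) B)"

definition cech_cocycles ::
  "('a, 'c) ring_scheme \<Rightarrow> 'a list \<Rightarrow> ('a, 'b, 'd) module_scheme \<Rightarrow> nat \<Rightarrow>
     (nat set \<Rightarrow> ('b \<times> 'a) set) set" where
  "cech_cocycles R fs M i =
     kernel (cech_cochains R fs M i) (cech_cochains R fs M (Suc i)) (cech_diff R fs M i)"

definition cech_coboundaries ::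
  "('a, 'c) ring_scheme \<Rightarrow> 'a list \<Rightarrow> ('a, 'b, 'd) module_scheme \<Rightarrow> nat \<Rightarrow>
     (nat set \<Rightarrow> ('b \<times> 'a) set) set" where
  "cech_coboundaries R fs M i = (case i of
       0 \<Rightarrow> {\<one>\<^bsub>cech_cochains R fs M 0\<^esub>}
     | Suc k \<Rightarrow> cech_diff R fs M k ` carrier (cech_cochains R fs M k))"

definition local_cohomology ::
  "('a, 'c) ring_scheme \<Rightarrow> 'a list \<Rightarrow> ('a, 'b, 'd) module_scheme \<Rightarrow> nat \<Rightarrow>
     (nat set \<Rightarrow> ('b \<times> 'a) set) set monoid" where
  "local_cohomology R fs M i =
     (cech_cochains R fs M i)\<lparr>carrier := cech_cocycles R fs M i\<rparr> Mod cech_coboundaries R fs M i"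

text \<open>The invariants below belong to the ideal generated by \<open>fs\<close>. \<open>cd\<close> is a maximum, since
  \<open>H\<^sup>i\<close> vanishes for \<open>i > length fs\<close> and some \<open>H\<^sup>i\<close> is nonzero when \<open>M\<close> is finitely generated
  over a Noetherian ring and \<open>J M \<noteq> M\<close>.\<close>

definition cd :: "('a, 'c) ring_scheme \<Rightarrow> 'a list \<Rightarrow> ('a, 'b, 'd) module_scheme \<Rightarrow> enat" where
  "cd R fs M = Sup {enat i | i. \<not> trivial_group (local_cohomology R fs M i)}"

definition mgrade :: "('a, 'c) ring_scheme \<Rightarrow> 'a list \<Rightarrow> ('a, 'b, 'd) module_scheme \<Rightarrow> enat" where
  "mgrade R fs M = Inf {cd R fs (quotient_module R p) | p. p \<in> Ass R M}"

definition maximal_depth ::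
  "('a, 'c) ring_scheme \<Rightarrow> 'a list \<Rightarrow> ('a, 'b, 'd) module_scheme \<Rightarrow> bool" where
  "maximal_depth R fs M \<longleftrightarrow> grade (Idl\<^bsub>R\<^esub> (set fs)) M = mgrade R fs M"


section \<open>The polynomial ring\<close>

datatype var = VarX nat | VarY nat

type_synonym exponent = "var \<Rightarrow>\<^sub>0 nat"
type_synonym 'k mpoly = "exponent \<Rightarrow>\<^sub>0 'k"

definition vars_of :: "nat \<Rightarrow> nat \<Rightarrow> var set" where
  "vars_of m n = VarX ` {1..m} \<union> VarY ` {1..n}"

definition monoms_of :: "nat \<Rightarrow> nat \<Rightarrow> exponent set" where
  "monoms_of m n = {t. Poly_Mapping.keys t \<subseteq> vars_of m n}"

definition poly_ring :: "nat \<Rightarrow> nat \<Rightarrow> 'k::field mpoly ring" where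
  "poly_ring m n = \<lparr>carrier = {f. Poly_Mapping.keys f \<subseteq> monoms_of m n},
     monoid.mult = (*), one = 1, zero = 0, add = (+)\<rparr>"

definition monom_poly :: "exponent \<Rightarrow> 'k::field mpoly" where
  "monom_poly t = Poly_Mapping.single t 1"

definition var_poly :: "var \<Rightarrow> 'k::field mpoly" where
  "var_poly v = monom_poly (Poly_Mapping.single v 1)"

definition x_vars :: "nat \<Rightarrow> 'k::field mpoly list" where
  "x_vars m = map (\<lambda>i. var_poly (VarX i)) [1..<Suc m]"

definition y_vars :: "nat \<Rightarrow> 'k::field mpoly list" where
  "y_vars n = map (\<lambda>j. var_poly (VarY j)) [1..<Suc n]"

definition monomial_ideal :: "nat \<Rightarrow> nat \<Rightarrow> 'k::field mpoly set \<Rightarrow> bool" where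
  "monomial_ideal m n I \<longleftrightarrow>
     (\<exists>T \<subseteq> monoms_of m n. I = Idl\<^bsub>poly_ring m n\<^esub> (monom_poly ` T))"

text \<open>The ideal \<open>p\<^sup>y\<close> generated by the variables \<open>y\<^sub>j\<close> lying in \<open>p\<close>.\<close>

definition y_part :: "nat \<Rightarrow> nat \<Rightarrow> 'k::field mpoly set \<Rightarrow> 'k mpoly set" where
  "y_part m n p = Idl\<^bsub>poly_ring m n\<^esub> (set (y_vars n) \<inter> p)"

end

theory Submission
  imports Defs
begin

text \<open>
  Associated primes of a monomial ideal are generated by sets \<open>A\<close> of variables. On \<open>S/(A)\<close> the Cech
  complex of the \<open>y\<^sub>j\<close> lives in degrees at most \<open>r\<close>, the number of \<open>y\<^sub>j\<close> outside \<open>A\<close>, and in degree \<open>r\<close>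
  the fraction with numerator 1 and denominator the product of these \<open>y\<^sub>j\<close> is not a coboundary; so
  \<open>cd = r\<close>, which is (a).

  For (b) let \<open>P\<close> be generated by a set \<open>W\<close> of variables. Along a regular sequence of length \<open>l\<close> in \<open>P\<close>, an
  associated prime \<open>(A)\<close> grows to a strictly larger associated prime at each step, inside \<open>(A \<union> W)\<close>. Since
  \<open>f\<^sub>1, \<dots>, f\<^sub>l\<close> chosen from the successive differences of a chain of primes are algebraically
  independent modulo its first member, counting monomials gives \<open>l \<le> card (W - A)\<close>. Conversely, a regular
  sequence in \<open>P\<close> that cannot be extended has \<open>P \<subseteq> q\<close> for an associated prime \<open>q\<close> of the quotient.
  Its length is then the depth of \<open>(S/I)\<^sub>q\<close>, which is the dimension, and this is at least
  \<open>card (W - A)\<close> for an associated prime \<open>(A)\<close> contained in \<open>q\<close>.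
\<close>

section \<open>Ideals, regular sequences and socles\<close>

text \<open>The prime \<open>q\<close> at which a regular sequence gets stuck is associated to a
  quotient that need not be monomial, so it need not be generated by variables. This forces the
  results on chains, and on associated primes below \<open>q\<close>, to cover arbitrary primes, and
  the comparison of lengths to take place in the local ring at \<open>q\<close>. The bounds meet
  because every associated prime \<open>(A)\<close> bounds the length from above, while a single one
  below \<open>q\<close> bounds it from below. Localization is expressed by saturation: a statement
  on the localization of C/J becomes one on the ideal \<open>sat U J\<close>, so the commutative
  algebra concerns ideals in one subset \<open>C\<close> of a type with ring operations. Genuine
  fractions enter only where the definitions of local cohomology and of Cohen-Macaulay rings ask for
  them. Depth is detected by socles: a socle at \<open>q\<close> marks the end of a regular sequence
  in \<open>q\<close>. The maximal condition on ideals above \<open>I\<close> is read off from the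
  Noetherian quotient that the Cohen-Macaulay hypothesis supplies. For (a), finiteness comes from
  the finitely many sets of variables.\<close>

locale comm_subring =
  fixes C :: "'a::comm_ring_1 set"
  assumes zero_mem [simp, intro]: "0 \<in> C"
    and one_mem [simp, intro]: "1 \<in> C"
    and add_mem [simp, intro]: "x \<in> C \<Longrightarrow> y \<in> C \<Longrightarrow> x + y \<in> C"
    and uminus_mem [simp, intro]: "x \<in> C \<Longrightarrow> - x \<in> C"
    and mult_mem [simp, intro]: "x \<in> C \<Longrightarrow> y \<in> C \<Longrightarrow> x * y \<in> C"
begin

lemma diff_mem [simp, intro]: "x \<in> C \<Longrightarrow> y \<in> C \<Longrightarrow> x - y \<in> C"
  using add_mem[of x "- y"] by simp

lemma power_mem [simp, intro]: "x \<in> C \<Longrightarrow> x ^ k \<in> C"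
  by (induction k) auto

definition is_ideal :: "'a set \<Rightarrow> bool" where
  "is_ideal J \<longleftrightarrow> J \<subseteq> C \<and> 0 \<in> J \<and> (\<forall>x\<in>J. \<forall>y\<in>J. x + y \<in> J) \<and> (\<forall>r\<in>C. \<forall>x\<in>J. r * x \<in> J)"

definition is_prime :: "'a set \<Rightarrow> bool" where
  "is_prime p \<longleftrightarrow> is_ideal p \<and> p \<noteq> C \<and> (\<forall>a\<in>C. \<forall>b\<in>C. a * b \<in> p \<longrightarrow> a \<in> p \<or> b \<in> p)"

definition colon :: "'a set \<Rightarrow> 'a \<Rightarrow> 'a set" where
  "colon J z = {a \<in> C. a * z \<in> J}"

definition adjoin :: "'a set \<Rightarrow> 'a \<Rightarrow> 'a set" where
  "adjoin J x = {j + a * x | j a. j \<in> J \<and> a \<in> C}"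

fun adjoins :: "'a set \<Rightarrow> 'a list \<Rightarrow> 'a set" where
  "adjoins J [] = J"
| "adjoins J (f # fs) = adjoins (adjoin J f) fs"

definition mult_set :: "'a set \<Rightarrow> bool" where
  "mult_set U \<longleftrightarrow> U \<subseteq> C \<and> 1 \<in> U \<and> (\<forall>u\<in>U. \<forall>v\<in>U. u * v \<in> U)"

text \<open>The kernel of the map from \<open>C\<close> to the localization of C/J at
  \<open>U\<close>; membership in it replaces vanishing of a fraction.\<close>

definition sat :: "'a set \<Rightarrow> 'a set \<Rightarrow> 'a set" where
  "sat U J = {z \<in> C. \<exists>u\<in>U. u * z \<in> J}"

text \<open>Regularity on the localization at \<open>U\<close> of the cyclic module \<open>C/J\<close>; the unlocalized notion is
  \<open>U = {1}\<close>. The quotient by the sequence may vanish.\<close>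
definition nzd :: "'a set \<Rightarrow> 'a set \<Rightarrow> 'a \<Rightarrow> bool" where
  "nzd U J f \<longleftrightarrow> (\<forall>z\<in>C. f * z \<in> sat U J \<longrightarrow> z \<in> sat U J)"

definition reg_seq :: "'a set \<Rightarrow> 'a set \<Rightarrow> 'a list \<Rightarrow> bool" where
  "reg_seq U J fs \<longleftrightarrow> (\<forall>i<length fs. nzd U (adjoins J (take i fs)) (fs ! i))"

definition assoc_primes :: "'a set \<Rightarrow> 'a set set" where
  "assoc_primes K = {p. is_prime p \<and> (\<exists>z\<in>C. p = colon K z)}"

text \<open>For a prime \<open>q\<close> this is depth zero of (C/J) localized at \<open>q\<close>:
  the residue field embeds into it.\<close>

definition has_socle :: "'a set \<Rightarrow> 'a set \<Rightarrow> bool" where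
  "has_socle q J \<longleftrightarrow> (\<exists>z\<in>C. z \<notin> sat (C - q) J \<and> (\<forall>a\<in>q. a * z \<in> sat (C - q) J))"

text \<open>Noetherianity of C/I as a maximal condition, phrased with ideals of \<open>C\<close> so
  that it passes at once to every quotient by a larger ideal.\<close>

definition acc_above :: "'a set \<Rightarrow> bool" where
  "acc_above I \<longleftrightarrow> (\<forall>F. F \<noteq> {} \<and> (\<forall>J\<in>F. is_ideal J \<and> I \<subseteq> J) \<longrightarrow> (\<exists>M\<in>F. \<forall>J\<in>F. M \<subseteq> J \<longrightarrow> J = M))"

lemma ideal_add: "is_ideal J \<Longrightarrow> x \<in> J \<Longrightarrow> y \<in> J \<Longrightarrow> x + y \<in> J"
  and ideal_mult: "is_ideal J \<Longrightarrow> r \<in> C \<Longrightarrow> x \<in> J \<Longrightarrow> r * x \<in> J"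
  and ideal_mult': "is_ideal J \<Longrightarrow> r \<in> C \<Longrightarrow> x \<in> J \<Longrightarrow> x * r \<in> J"
  and ideal_zero: "is_ideal J \<Longrightarrow> 0 \<in> J"
  and ideal_sub: "is_ideal J \<Longrightarrow> x \<in> J \<Longrightarrow> x \<in> C"
  by (auto simp: is_ideal_def mult.commute)

lemma ideal_uminus: "is_ideal J \<Longrightarrow> x \<in> J \<Longrightarrow> - x \<in> J"
  using ideal_mult[of J "-1" x] by auto

lemma ideal_diff: "is_ideal J \<Longrightarrow> x \<in> J \<Longrightarrow> y \<in> J \<Longrightarrow> x - y \<in> J"
  using ideal_add[of J x "- y"] ideal_uminus by auto

lemma ideal_diff_iff: "is_ideal J \<Longrightarrow> x - y \<in> J \<Longrightarrow> x \<in> J \<longleftrightarrow> y \<in> J"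
  using ideal_add[of J "x - y" y] ideal_diff[of J x "x - y"] by auto

lemma ideal_sum: "is_ideal J \<Longrightarrow> (\<And>i. i \<in> A \<Longrightarrow> f i \<in> J) \<Longrightarrow> sum f A \<in> J"
  by (induction A rule: infinite_finite_induct) (auto simp: ideal_zero ideal_add)

lemma ideal_eq_iff_one: "is_ideal J \<Longrightarrow> J = C \<longleftrightarrow> 1 \<in> J"
  using ideal_mult'[of J _ 1] by (auto simp: is_ideal_def)

lemma ideal_carrier [simp]: "is_ideal C"
  by (auto simp: is_ideal_def)

lemma prime_ideal: "is_prime p \<Longrightarrow> is_ideal p"
  and prime_one: "is_prime p \<Longrightarrow> 1 \<notin> p"
  and prime_mult: "is_prime p \<Longrightarrow> a \<in> C \<Longrightarrow> b \<in> C \<Longrightarrow> a * b \<in> p \<Longrightarrow> a \<in> p \<or> b \<in> p"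
  unfolding is_prime_def using ideal_eq_iff_one by blast+

lemma prime_sub: "is_prime p \<Longrightarrow> x \<in> p \<Longrightarrow> x \<in> C"
  using prime_ideal ideal_sub by blast

lemma prime_power: "is_prime p \<Longrightarrow> a \<in> C \<Longrightarrow> a ^ k \<in> p \<Longrightarrow> a \<in> p"
proof (induction k)
  case (Suc k)
  then show ?case using prime_mult[of p a "a ^ k"] by auto
qed (use prime_one in auto)

lemma prod_mem: "(\<And>i. i \<in> A \<Longrightarrow> f i \<in> C) \<Longrightarrow> prod f A \<in> C"
  by (induction A rule: infinite_finite_induct) auto

lemma prime_prod:
  assumes "is_prime p" "finite A" "\<And>i. i \<in> A \<Longrightarrow> f i \<in> C" "\<And>i. i \<in> A \<Longrightarrow> f i \<notin> p"
  shows "prod f A \<in> C \<and> prod f A \<notin> p"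
  using assms(2,3,4)
proof (induction A rule: finite_induct)
  case empty
  then show ?case using prime_one assms(1) by auto
next
  case (insert x A)
  then have "prod f A \<in> C \<and> prod f A \<notin> p" by auto
  with insert assms(1) show ?case using prime_mult[of p "f x" "prod f A"] by auto
qed

lemma mult_set_compl: "is_prime p \<Longrightarrow> mult_set (C - p)"
  using prime_one prime_mult by (auto simp: mult_set_def)

lemma sat_one: "is_ideal J \<Longrightarrow> sat {1} J = J"
  by (auto simp: sat_def ideal_sub)

lemma colon_ideal: "is_ideal J \<Longrightarrow> z \<in> C \<Longrightarrow> is_ideal (colon J z)"
  by (auto simp: is_ideal_def colon_def distrib_right mult.assoc)

lemma colon_eq_carrier: "is_ideal J \<Longrightarrow> z \<in> C \<Longrightarrow> colon J z = C \<longleftrightarrow> z \<in> J"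
  using ideal_eq_iff_one[OF colon_ideal] by (auto simp: colon_def)

lemma colon_sup: "is_ideal J \<Longrightarrow> z \<in> C \<Longrightarrow> J \<subseteq> colon J z"
  by (auto simp: colon_def ideal_sub ideal_mult')

lemma adjoin_ideal: assumes "is_ideal J" "x \<in> C" shows "is_ideal (adjoin J x)"
  unfolding is_ideal_def adjoin_def
proof (intro conjI ballI)
  show "{j + a * x |j a. j \<in> J \<and> a \<in> C} \<subseteq> C" using assms by (auto simp: ideal_sub)
  show "0 \<in> {j + a * x |j a. j \<in> J \<and> a \<in> C}"
    using assms ideal_zero by (intro CollectI exI[of _ 0]) auto
next
  fix y z assume "y \<in> {j + a * x |j a. j \<in> J \<and> a \<in> C}" "z \<in> {j + a * x |j a. j \<in> J \<and> a \<in> C}"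
  then obtain j a k b where "y = j + a * x" "z = k + b * x" "j \<in> J" "k \<in> J" "a \<in> C" "b \<in> C" by auto
  then show "y + z \<in> {j + a * x |j a. j \<in> J \<and> a \<in> C}"
    using assms ideal_add by (intro CollectI exI[of _ "j + k"] exI[of _ "a + b"]) (auto simp: algebra_simps)
next
  fix r y assume "y \<in> {j + a * x |j a. j \<in> J \<and> a \<in> C}" "r \<in> C"
  then obtain j a where "y = j + a * x" "j \<in> J" "a \<in> C" by auto
  then show "r * y \<in> {j + a * x |j a. j \<in> J \<and> a \<in> C}"
    using assms \<open>r \<in> C\<close> ideal_mult[of J r j]
    by (intro CollectI exI[of _ "r * j"] exI[of _ "r * a"]) (auto simp: distrib_left mult.assoc)
qed

lemma adjoinI: "j \<in> J \<Longrightarrow> a \<in> C \<Longrightarrow> y = j + a * x \<Longrightarrow> y \<in> adjoin J x"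
  by (auto simp: adjoin_def)

lemma adjoinE:
  assumes "y \<in> adjoin J x" obtains j a where "j \<in> J" "a \<in> C" "y = j + a * x"
  using assms by (auto simp: adjoin_def)

lemma adjoin_sup: "J \<subseteq> adjoin J x"
  by (rule subsetI) (rule adjoinI[of _ _ 0], auto)

lemma adjoin_mem: "is_ideal J \<Longrightarrow> x \<in> adjoin J x"
  by (rule adjoinI[of 0 _ 1]) (auto simp: ideal_zero)

lemma adjoin_subset: "is_ideal J \<Longrightarrow> x \<in> J \<Longrightarrow> K \<subseteq> J \<Longrightarrow> adjoin K x \<subseteq> J"
  by (auto elim!: adjoinE intro!: ideal_add ideal_mult)

lemma adjoin_commute: "adjoin (adjoin J x) y = adjoin (adjoin J y) x"
  unfolding adjoin_def by (auto; metis add.assoc add.commute)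

lemma adjoins_ideal: "is_ideal J \<Longrightarrow> set fs \<subseteq> C \<Longrightarrow> is_ideal (adjoins J fs)"
  by (induction fs arbitrary: J) (auto simp: adjoin_ideal)

lemma adjoins_sup: "J \<subseteq> adjoins J fs"
  by (induction fs arbitrary: J) (use adjoin_sup in fastforce)+

lemma adjoins_append: "adjoins J (fs @ gs) = adjoins (adjoins J fs) gs"
  by (induction fs arbitrary: J) auto

lemma adjoins_snoc: "adjoins J (fs @ [f]) = adjoin (adjoins J fs) f"
  by (simp add: adjoins_append)

text \<open>Moves an element between the front and the end of a sequence. Exchanges happen at the
  end, whereas the induction needs the new element at the front, inside the base ideal.\<close>

lemma adjoins_adjoin: "adjoins (adjoin J x) fs = adjoin (adjoins J fs) x"
  by (induction fs arbitrary: J) (auto simp: adjoin_commute)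

lemma adjoins_subset: "is_ideal J \<Longrightarrow> set fs \<subseteq> J \<Longrightarrow> K \<subseteq> J \<Longrightarrow> adjoins K fs \<subseteq> J"
  by (induction fs arbitrary: K) (auto dest: adjoin_subset)

lemma sat_ideal: assumes "mult_set U" "is_ideal J" shows "is_ideal (sat U J)"
  unfolding is_ideal_def
proof (intro conjI ballI)
  show "sat U J \<subseteq> C" by (auto simp: sat_def)
  show "0 \<in> sat U J" using assms by (auto simp: sat_def mult_set_def ideal_zero intro!: bexI[of _ 1])
next
  fix x y assume "x \<in> sat U J" "y \<in> sat U J"
  then obtain u v where *: "u \<in> U" "v \<in> U" "u * x \<in> J" "v * y \<in> J" "x \<in> C" "y \<in> C" by (auto simp: sat_def)
  with assms have "u \<in> C" "v \<in> C" "u * v \<in> U" by (auto simp: mult_set_def)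
  have "(u * v) * (x + y) = v * (u * x) + u * (v * y)" by (simp add: algebra_simps)
  also have "\<dots> \<in> J" using assms * \<open>u \<in> C\<close> \<open>v \<in> C\<close> by (auto intro!: ideal_add intro: ideal_mult)
  finally show "x + y \<in> sat U J" using * \<open>u * v \<in> U\<close> by (auto simp: sat_def)
next
  fix r x assume "r \<in> C" "x \<in> sat U J"
  then obtain u where "u \<in> U" "u * x \<in> J" "x \<in> C" by (auto simp: sat_def)
  then have "u * (r * x) \<in> J" using ideal_mult[OF assms(2) \<open>r \<in> C\<close>, of "u * x"] by (simp add: algebra_simps)
  then show "r * x \<in> sat U J" using \<open>u \<in> U\<close> \<open>x \<in> C\<close> \<open>r \<in> C\<close> by (auto simp: sat_def)
qed

lemma sat_sup: "mult_set U \<Longrightarrow> is_ideal J \<Longrightarrow> J \<subseteq> sat U J"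
  by (auto simp: sat_def mult_set_def ideal_sub intro!: bexI[of _ 1])

lemma sat_mono: "J \<subseteq> K \<Longrightarrow> sat U J \<subseteq> sat U K"
  by (auto simp: sat_def)

lemma satI: "u \<in> U \<Longrightarrow> z \<in> C \<Longrightarrow> u * z \<in> J \<Longrightarrow> z \<in> sat U J"
  by (auto simp: sat_def)

lemma satE: assumes "z \<in> sat U J" obtains u where "u \<in> U" "z \<in> C" "u * z \<in> J"
  using assms by (auto simp: sat_def)

lemma sat_sat: "mult_set U \<Longrightarrow> u \<in> U \<Longrightarrow> z \<in> C \<Longrightarrow> u * z \<in> sat U J \<Longrightarrow> z \<in> sat U J"
  by (auto simp: sat_def mult_set_def mult.assoc[symmetric])

lemma mult_set_mem: "mult_set U \<Longrightarrow> u \<in> U \<Longrightarrow> u \<in> C"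
  and mult_set_mult: "mult_set U \<Longrightarrow> u \<in> U \<Longrightarrow> v \<in> U \<Longrightarrow> u * v \<in> U"
  by (auto simp: mult_set_def)

lemma nzdD: "nzd U J f \<Longrightarrow> z \<in> C \<Longrightarrow> f * z \<in> sat U J \<Longrightarrow> z \<in> sat U J"
  by (auto simp: nzd_def)

lemma nzd_cancel:
  assumes "mult_set U" "is_ideal J" "nzd U J f" "f * z \<in> J" "z \<in> C"
  shows "z \<in> sat U J"
  using nzdD[OF assms(3,5)] sat_sup[OF assms(1,2)] assms(4) by blast

text \<open>Multiplication by \<open>y\<close> followed by division by \<open>x\<close> is an isomorphism between the socles of
  \<open>M/xM\<close> and \<open>M/yM\<close>.\<close>
lemma has_socle_exchange:
  assumes q: "is_prime q" and J: "is_ideal J" and xy: "x \<in> q" "y \<in> q"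
    and x: "nzd (C - q) J x" and y: "nzd (C - q) J y"
    and soc: "has_socle q (adjoin J x)"
  shows "has_socle q (adjoin J y)"
proof -
  let ?U = "C - q"
  have U: "mult_set ?U" using q by (rule mult_set_compl)
  have xC: "x \<in> C" "y \<in> C" using xy prime_sub[OF q] by auto
  obtain z where z: "z \<in> C" "z \<notin> sat ?U (adjoin J x)" "\<And>a. a \<in> q \<Longrightarrow> a * z \<in> sat ?U (adjoin J x)"
    using soc by (auto simp: has_socle_def)
  obtain u where u: "u \<in> ?U" "u * (y * z) \<in> adjoin J x"
    using z(3)[OF xy(2)] by (auto elim: satE)
  \<comment> \<open>Up to the local unit \<open>u\<close>, \<open>w\<close> is y z / x, the image of
    the socle element \<open>z\<close> under the isomorphism.\<close>
  then obtain j w where w: "j \<in> J" "w \<in> C" "u * (y * z) = j + w * x" by (auto elim: adjoinE)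
  have uC: "u \<in> C" using u by auto
  \<comment> \<open>If \<open>w\<close> were divisible by \<open>y\<close>, cancelling
    \<open>y\<close> in u y z = w x would make \<open>z\<close> divisible by \<open>x\<close>,
    locally and modulo \<open>J\<close>.\<close>
  have "w \<notin> sat ?U (adjoin J y)"
  proof
    assume "w \<in> sat ?U (adjoin J y)"
    then obtain v k b where v: "v \<in> ?U" "k \<in> J" "b \<in> C" "v * w = k + b * y"
      by (auto elim!: satE adjoinE)
    have "v * (u * (y * z)) = v * j + (v * w) * x" using w by (simp add: algebra_simps)
    also have "\<dots> = v * j + (k + b * y) * x" using v by simp
    finally have "v * (u * (y * z)) = v * j + (k + b * y) * x" .
    then have "y * (v * u * z - b * x) = v * j + x * k" by (simp add: algebra_simps)
    moreover have "v * j + x * k \<in> J" using v w xC J by (intro ideal_add ideal_mult) auto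
    ultimately have "y * (v * u * z - b * x) \<in> J" by simp
    then have "v * u * z - b * x \<in> sat ?U J"
      by (rule nzd_cancel[OF U J y]) (use v uC z xC in auto)
    then obtain t where t: "t \<in> ?U" "t * (v * u * z - b * x) \<in> J" by (auto elim: satE)
    have "(t * (v * u)) * z = t * (v * u * z - b * x) + (t * b) * x" by (simp add: algebra_simps)
    then have A: "(t * (v * u)) * z \<in> adjoin J x" using t v by (intro adjoinI) auto
    have B: "t * (v * u) \<in> ?U" by (rule mult_set_mult[OF U t(1) mult_set_mult[OF U v(1) u(1)]])
    show False using satI[OF B z(1) A] z(2) by contradiction
  qed
  \<comment> \<open>Here x a w agrees with u y (a z) modulo \<open>J\<close>, and a z is locally
    divisible by \<open>x\<close>; cancelling \<open>x\<close> leaves a w divisible by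
    \<open>y\<close>.\<close>
  moreover have "a * w \<in> sat ?U (adjoin J y)" if a: "a \<in> q" for a
  proof -
    have aC: "a \<in> C" using prime_sub[OF q a] .
    obtain v k b where v: "v \<in> ?U" "k \<in> J" "b \<in> C" "v * (a * z) = k + b * x"
      using z(3)[OF a] by (auto elim!: satE adjoinE)
    have "x * (v * (a * w)) = v * a * (w * x)" by (simp add: algebra_simps)
    also have "\<dots> = v * a * (u * (y * z) - j)" using w by simp
    also have "\<dots> = u * y * (v * (a * z)) - v * a * j" by (simp add: algebra_simps)
    also have "\<dots> = u * y * (k + b * x) - v * a * j" using v by simp
    finally have "x * (v * (a * w) - u * b * y) = u * y * k - v * a * j"
      by (simp add: algebra_simps)
    moreover have "u * y * k - v * a * j \<in> J"
      using J v w aC xC uC by (intro ideal_diff ideal_mult) auto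
    ultimately have "x * (v * (a * w) - u * b * y) \<in> J" by simp
    then have "v * (a * w) - u * b * y \<in> sat ?U J"
      by (rule nzd_cancel[OF U J x]) (use v uC aC w xC in auto)
    then obtain t where t: "t \<in> ?U" "t * (v * (a * w) - u * b * y) \<in> J" by (auto elim: satE)
    have "(t * v) * (a * w) = t * (v * (a * w) - u * b * y) + (t * u * b) * y"
      by (simp add: algebra_simps)
    then have A: "(t * v) * (a * w) \<in> adjoin J y" using t v uC by (intro adjoinI) auto
    have B: "t * v \<in> ?U" by (rule mult_set_mult[OF U t(1) v(1)])
    show ?thesis by (rule satI[OF B _ A]) (use aC w in auto)
  qed
  ultimately show ?thesis using w by (auto simp: has_socle_def)
qed

text \<open>The half of the permutability of regular sequences that holds without Nakayama: f z = a
  h forces a = f b because \<open>h\<close> is regular modulo \<open>f\<close>, and cancelling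
  \<open>f\<close> gives z = h b.\<close>

lemma nzd_adjoin_swap:
  assumes U: "mult_set U" and J: "is_ideal J" and fh: "f \<in> C" "h \<in> C"
    and f: "nzd U J f" and h: "nzd U (adjoin J f) h"
  shows "nzd U (adjoin J h) f"
  unfolding nzd_def
proof (intro ballI impI)
  fix z assume z: "z \<in> C" "f * z \<in> sat U (adjoin J h)"
  then obtain u k a where u: "u \<in> U" "k \<in> J" "a \<in> C" "u * (f * z) = k + a * h"
    by (auto elim!: satE adjoinE)
  have uC: "u \<in> C" using U u mult_set_mem by auto
  have "h * a = - k + (u * z) * f" using u by (simp add: algebra_simps)
  then have "h * a \<in> adjoin J f" using u z uC J by (intro adjoinI[of "-k"] ideal_uminus) auto
  then have "a \<in> sat U (adjoin J f)"
    by (rule nzd_cancel[OF U adjoin_ideal[OF J fh(1)] h]) (rule u)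
  then obtain v k' b where v: "v \<in> U" "k' \<in> J" "b \<in> C" "v * a = k' + b * f"
    by (auto elim!: satE adjoinE)
  have vC: "v \<in> C" using U v mult_set_mem by auto
  have "v * (u * (f * z)) = v * k + (v * a) * h" using u by (simp add: algebra_simps)
  also have "\<dots> = v * k + (k' + b * f) * h" using v by simp
  finally have "f * (v * u * z - h * b) = v * k + h * k'" by (simp add: algebra_simps)
  moreover have "v * k + h * k' \<in> J" using J u v vC fh by (intro ideal_add ideal_mult) auto
  ultimately have "f * (v * u * z - h * b) \<in> J" by simp
  then have "v * u * z - h * b \<in> sat U J"
    by (rule nzd_cancel[OF U J f]) (use vC uC z fh v in auto)
  then obtain t where t: "t \<in> U" "t * (v * u * z - h * b) \<in> J" by (auto elim: satE)
  have tC: "t \<in> C" using U t mult_set_mem by auto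
  have "(t * (v * u)) * z = t * (v * u * z - h * b) + (t * b) * h" by (simp add: algebra_simps)
  then have "(t * (v * u)) * z \<in> adjoin J h" using t tC v by (intro adjoinI) auto
  then show "z \<in> sat U (adjoin J h)" using z U t v u by (intro satI[of "t * (v * u)"]) (auto intro: mult_set_mult)
qed

section \<open>Associated primes, their finiteness, and prime avoidance\<close>

lemma assoc_primes_sat_subset:
  assumes q: "is_prime q" and J: "is_ideal J" and p: "p \<in> assoc_primes (sat (C - q) J)"
  shows "p \<subseteq> q"
proof
  fix a assume a: "a \<in> p"
  obtain z where z: "z \<in> C" "p = colon (sat (C - q) J) z" "is_prime p"
    using p by (auto simp: assoc_primes_def)
  show "a \<in> q"
  proof (rule ccontr)
    assume aq: "a \<notin> q"
    have "z \<in> sat (C - q) J"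
      by (rule sat_sat[OF mult_set_compl[OF q], of a]) (use a aq z in \<open>auto simp: colon_def\<close>)
    then have "p = C" using colon_eq_carrier[OF sat_ideal[OF mult_set_compl[OF q] J] z(1)] z(2) by simp
    with z(3) show False by (auto simp: is_prime_def)
  qed
qed

text \<open>\<open>z\<close> generates a copy of the domain C/p in C/K, and all nonzero elements of
  a domain have the same annihilator.\<close>

lemma colon_prime_mult:
  assumes K: "is_ideal K" and z: "z \<in> C" and p: "is_prime (colon K z)" and b: "b \<in> C" "b \<notin> colon K z"
  shows "colon K (b * z) = colon K z"
proof (intro equalityI subsetI)
  fix a assume "a \<in> colon K (b * z)"
  then have "a * b \<in> colon K z" "a \<in> C" using b by (auto simp: colon_def mult.assoc)
  then show "a \<in> colon K z" using prime_mult[OF p] b by blast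
next
  fix a assume "a \<in> colon K z"
  then show "a \<in> colon K (b * z)"
    using ideal_mult[OF K b(1), of "a * z"] by (auto simp: colon_def algebra_simps)
qed

text \<open>A maximal member among the annihilators of nonzero elements is prime; the search is
  restricted to those above \<open>colon K z\<close>.\<close>

lemma exists_assoc_prime:
  assumes I: "acc_above I" and K: "is_ideal K" "I \<subseteq> K" and z: "z \<in> C" "z \<notin> K"
  shows "\<exists>p\<in>assoc_primes K. colon K z \<subseteq> p"
proof -
  let ?F = "{colon K w | w. w \<in> C \<and> w \<notin> K \<and> colon K z \<subseteq> colon K w}"
  have "?F \<noteq> {}" using z by auto
  moreover have "\<forall>J\<in>?F. is_ideal J \<and> I \<subseteq> J" using K colon_ideal colon_sup by blast
  ultimately obtain M where "M \<in> ?F" and max: "\<And>J. J \<in> ?F \<Longrightarrow> M \<subseteq> J \<Longrightarrow> J = M"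
    using I unfolding acc_above_def by meson
  then obtain w where w: "w \<in> C" "w \<notin> K" "colon K z \<subseteq> colon K w" "M = colon K w" by auto
  have "is_prime M"
    unfolding is_prime_def
  proof (intro conjI ballI impI)
    show "is_ideal M" using colon_ideal K w by auto
    show "M \<noteq> C" using colon_eq_carrier K w by auto
  next
    fix a b assume ab: "a \<in> C" "b \<in> C" "a * b \<in> M"
    show "a \<in> M \<or> b \<in> M"
    proof (rule disjCI)
      assume b: "b \<notin> M"
      then have bw: "b * w \<in> C" "b * w \<notin> K" using ab w by (auto simp: colon_def)
      have sub: "M \<subseteq> colon K (b * w)"
      proof
        fix c assume "c \<in> M"
        then show "c \<in> colon K (b * w)"
          using w ideal_mult[OF K(1) ab(2), of "c * w"] by (auto simp: colon_def algebra_simps)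
      qed
      then have "colon K (b * w) = M" using bw w by (intro max) auto
      moreover have "a \<in> colon K (b * w)" using ab w by (auto simp: colon_def algebra_simps)
      ultimately show "a \<in> M" by simp
    qed
  qed
  then show ?thesis using w by (auto simp: assoc_primes_def)
qed

text \<open>Noetherian induction in place of a prime filtration. Let \<open>M\<close> be a maximal
  counterexample and let \<open>z\<close> generate a copy of C/p in C/M. A cyclic submodule
  isomorphic to C/p' either meets this copy, and then p' = p, or embeds into C/(M + (z)), which has
  finitely many associated primes by maximality.\<close>

lemma finite_assoc_primes:
  assumes I: "acc_above I" and K: "is_ideal K" "I \<subseteq> K"
  shows "finite (assoc_primes K)"
proof (rule ccontr)
  let ?F = "{K. is_ideal K \<and> I \<subseteq> K \<and> infinite (assoc_primes K)}"
  assume "infinite (assoc_primes K)"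
  then have "?F \<noteq> {}" using K by auto
  moreover have "\<forall>J\<in>?F. is_ideal J \<and> I \<subseteq> J" by auto
  ultimately obtain M where "M \<in> ?F" and max: "\<And>J. J \<in> ?F \<Longrightarrow> M \<subseteq> J \<Longrightarrow> J = M"
    using I unfolding acc_above_def by meson
  then have M: "is_ideal M" "I \<subseteq> M" "infinite (assoc_primes M)" by auto
  then obtain p where "p \<in> assoc_primes M" using infinite_imp_nonempty by blast
  then obtain z where z: "is_prime p" "z \<in> C" "p = colon M z" by (auto simp: assoc_primes_def)
  have zM: "z \<notin> M" using colon_eq_carrier[OF M(1) z(2)] z by (auto simp: is_prime_def)
  let ?K = "adjoin M z"
  have Kid: "is_ideal ?K" "I \<subseteq> ?K" "M \<subseteq> ?K" using adjoin_ideal adjoin_sup[of M z] M z by auto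
  have "?K \<noteq> M" using adjoin_mem M zM by auto
  then have fin: "finite (assoc_primes ?K)" using max[of ?K] Kid by auto
  have "assoc_primes M \<subseteq> insert p (assoc_primes ?K)"
  proof
    fix p' assume "p' \<in> assoc_primes M"
    then obtain w where w: "is_prime p'" "w \<in> C" "p' = colon M w" by (auto simp: assoc_primes_def)
    show "p' \<in> insert p (assoc_primes ?K)"
    proof (cases "\<exists>b\<in>C. b * w \<in> ?K \<and> b * w \<notin> M")
      case True
      then obtain b k a where b: "b \<in> C" "b * w \<notin> M" "b * w = k + a * z" "k \<in> M" "a \<in> C"
        by (auto elim: adjoinE)
      have az: "a * z \<notin> M" using b ideal_add[OF M(1)] by metis
      have "p' = colon M (b * w)" using colon_prime_mult[OF M(1), of w b] w b by (auto simp: colon_def)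
      also have "\<dots> = colon M (a * z)"
      proof -
        have "c * (b * w) \<in> M \<longleftrightarrow> c * (a * z) \<in> M" if "c \<in> C" for c
          using ideal_diff_iff[OF M(1), of "c * (b * w)" "c * (a * z)"] ideal_mult[OF M(1) that b(4)]
          unfolding b(3) by (simp add: distrib_left)
        then show ?thesis by (auto simp: colon_def)
      qed
      also have "\<dots> = p" using colon_prime_mult[OF M(1), of z a] z b az by (auto simp: colon_def)
      finally show ?thesis by simp
    next
      case False
      then have "p' = colon ?K w" using w Kid by (auto simp: colon_def)
      then show ?thesis using w by (auto simp: assoc_primes_def)
    qed
  qed
  with fin M(3) show False using finite_subset by blast
qed

text \<open>An element avoiding \<open>F\<close> that falls into the new prime \<open>p\<close> is
  corrected by an element of \<open>q\<close> outside \<open>p\<close> lying in the primes of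
  \<open>F\<close> that matter.\<close>

lemma prime_avoidance:
  assumes "finite F" "\<And>p. p \<in> F \<Longrightarrow> is_prime p" "is_ideal q" "\<And>p. p \<in> F \<Longrightarrow> \<not> q \<subseteq> p"
  shows "\<exists>h\<in>q. \<forall>p\<in>F. h \<notin> p"
  using assms
proof (induction F rule: finite_induct)
  case empty
  then show ?case using ideal_zero by auto
next
  case (insert p F)
  then obtain h where h: "h \<in> q" "\<forall>r\<in>F. h \<notin> r" by auto
  show ?case
  proof (cases "h \<in> p")
    case True
    have pp: "is_prime p" using insert by auto
    obtain y where y: "y \<in> q" "y \<notin> p" using insert.prems(3)[of p] by auto
    \<comment> \<open>Primes of \<open>F\<close> inside \<open>p\<close> are avoided as soon as
      \<open>p\<close> is. The others each contribute a factor, so the correction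
      \<open>?P * y\<close> lies in all of them but not in \<open>p\<close>.\<close>
    let ?F = "{r \<in> F. \<not> r \<subseteq> p}"
    define g where "g r = (SOME a. a \<in> r \<and> a \<notin> p)" for r
    have "g r \<in> r \<and> g r \<notin> p" if "r \<in> ?F" for r
      unfolding g_def by (rule someI_ex) (use that in blast)
    then have g: "\<And>r. r \<in> ?F \<Longrightarrow> g r \<in> r" "\<And>r. r \<in> ?F \<Longrightarrow> g r \<notin> p" by blast+
    have gC: "g r \<in> C" if "r \<in> ?F" for r
      using that g(1) insert.prems(1) prime_ideal ideal_sub by blast
    let ?P = "prod g ?F"
    have P: "?P \<in> C" "?P \<notin> p" using prime_prod[OF pp, of ?F g] gC g insert(1) by auto
    have Pr: "?P \<in> r" if r: "r \<in> ?F" for r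
    proof -
      have "?P = g r * prod g (?F - {r})" using r insert(1) by (intro prod.remove) auto
      moreover have "prod g (?F - {r}) \<in> C" using gC by (intro prod_mem) auto
      ultimately show ?thesis using r g(1)[OF r] insert.prems(1)[of r] prime_ideal ideal_mult' by auto
    qed
    have yC: "y \<in> C" using y insert.prems ideal_sub by auto
    let ?h = "h + ?P * y"
    have "?h \<in> q" using h y P insert.prems(2) by (intro ideal_add ideal_mult) auto
    moreover have "?P * y \<notin> p" using prime_mult[OF pp P(1) yC] P y by auto
    then have hp: "?h \<notin> p" using ideal_diff[OF prime_ideal[OF pp], of ?h h] True by auto
    moreover have "?h \<notin> r" if "r \<in> F" for r
    proof (cases "r \<subseteq> p")
      case True
      then show ?thesis using hp by auto
    next
      case False
      then have "?P * y \<in> r" using that Pr insert.prems(1)[of r] prime_ideal ideal_mult' yC by auto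
      then show ?thesis
        using ideal_diff[OF prime_ideal, of r ?h "?P * y"] h that insert.prems(1) by auto
    qed
    ultimately show ?thesis by auto
  qed (use h in auto)
qed

lemma sat_adjoinE:
  assumes "z \<in> sat U (adjoin J x)"
  obtains u j a where "u \<in> U" "j \<in> J" "a \<in> C" "u * z = j + a * x" "z \<in> C"
  using assms by (blast elim: satE adjoinE)

lemma assoc_primes_zero_divisor:
  assumes I: "acc_above I" and K: "is_ideal K" "I \<subseteq> K" and f: "f \<in> C" "\<And>p. p \<in> assoc_primes K \<Longrightarrow> f \<notin> p"
    and z: "z \<in> C" "f * z \<in> K"
  shows "z \<in> K"
  using exists_assoc_prime[OF I K z(1)] f z by (auto simp: colon_def)

text \<open>Without a socle, \<open>q\<close> is not an associated prime of any of the localized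
  quotients. All their associated primes lie in \<open>q\<close>, hence properly, and there are
  finitely many of them, so prime avoidance applies to all quotients at once.\<close>

lemma exists_common_nzd:
  assumes I: "acc_above I" and q: "is_prime q" and F: "finite F"
    and J: "\<And>J. J \<in> F \<Longrightarrow> is_ideal J \<and> I \<subseteq> J \<and> \<not> has_socle q J"
  shows "\<exists>h\<in>q. \<forall>J\<in>F. nzd (C - q) J h"
proof -
  let ?sat = "sat (C - q)"
  have s: "is_ideal (?sat J)" "I \<subseteq> ?sat J" if "J \<in> F" for J
    using J[OF that] sat_ideal[OF mult_set_compl[OF q]] sat_sup[OF mult_set_compl[OF q]] by auto
  let ?A = "\<Union>J\<in>F. assoc_primes (?sat J)"
  have A1: "finite ?A" using F s finite_assoc_primes[OF I] by auto
  have A2: "is_prime p" if "p \<in> ?A" for p using that by (auto simp: assoc_primes_def)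
  have A3: "\<not> q \<subseteq> p" if p: "p \<in> ?A" for p
  proof
    assume qp: "q \<subseteq> p"
    obtain K where K: "K \<in> F" "p \<in> assoc_primes (?sat K)" using p by auto
    then have "p = q" using qp assoc_primes_sat_subset[OF q] J by blast
    with K obtain z where z: "z \<in> C" "q = colon (?sat K) z" "is_prime q" by (auto simp: assoc_primes_def)
    then have "z \<notin> ?sat K" using colon_eq_carrier[OF s(1)[OF K(1)]] by (auto simp: is_prime_def)
    moreover have "\<forall>a\<in>q. a * z \<in> ?sat K" by (subst z(2)) (auto simp: colon_def)
    ultimately show False using J[OF K(1)] z(1) by (auto simp: has_socle_def)
  qed
  have "\<exists>h\<in>q. \<forall>p\<in>?A. h \<notin> p"
    by (rule prime_avoidance[OF A1 A2 prime_ideal[OF q] A3])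
  then obtain h where h: "h \<in> q" "\<forall>p\<in>?A. h \<notin> p" by (rule bexE)
  have hp: "h \<notin> p" if "J \<in> F" "p \<in> assoc_primes (?sat J)" for J p
    using h(2) that by (simp add: UN_I)
  have hC: "h \<in> C" using prime_sub[OF q h(1)] .
  have "nzd (C - q) J h" if "J \<in> F" for J
    unfolding nzd_def using assoc_primes_zero_divisor[OF I s[OF that] hC hp[OF that]] by simp
  then show ?thesis using h(1) by blast
qed

section \<open>Regular sequences, socles and the growth of associated primes\<close>

lemma nzd_imp_no_socle: "f \<in> q \<Longrightarrow> nzd (C - q) J f \<Longrightarrow> \<not> has_socle q J"
  unfolding has_socle_def nzd_def by meson

lemma reg_seq_snoc:
  "reg_seq U J (fs @ [f]) \<longleftrightarrow> reg_seq U J fs \<and> nzd U (adjoins J fs) f"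
proof -
  have "(\<forall>i<Suc (length fs). nzd U (adjoins J (take i (fs @ [f]))) ((fs @ [f]) ! i)) \<longleftrightarrow>
    (\<forall>i<length fs. nzd U (adjoins J (take i fs)) (fs ! i)) \<and> nzd U (adjoins J fs) f"
    unfolding less_Suc_eq by (auto simp: nth_append)
  then show ?thesis by (simp add: reg_seq_def)
qed

lemma reg_seq_take: "reg_seq U J fs \<Longrightarrow> reg_seq U J (take k fs)"
  by (auto simp: reg_seq_def min_def split: if_splits)

text \<open>Regularity of \<open>h\<close> modulo the first i + 1 elements makes
  \<open>fs ! i\<close> regular modulo the first i elements and \<open>h\<close>, by
  \<open>nzd_adjoin_swap\<close>. This is why \<open>h\<close> has to be regular modulo the prefixes
  and not only modulo \<open>J\<close>.\<close>

lemma reg_seq_adjoin: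
  assumes U: "mult_set U" and J: "is_ideal J" and fs: "set fs \<subseteq> C" and h: "h \<in> C"
    and reg: "reg_seq U J fs" and hr: "\<And>i. i \<le> length fs \<Longrightarrow> nzd U (adjoins J (take i fs)) h"
  shows "reg_seq U (adjoin J h) fs"
  unfolding reg_seq_def
proof (intro allI impI)
  fix i assume i: "i < length fs"
  have t: "set (take i fs) \<subseteq> C" using fs set_take_subset[of i fs] by blast
  have h': "nzd U (adjoin (adjoins J (take i fs)) (fs ! i)) h"
    using hr[of "Suc i"] i by (simp add: take_Suc_conv_app_nth adjoins_snoc)
  have f: "fs ! i \<in> C" "nzd U (adjoins J (take i fs)) (fs ! i)"
    using i fs reg nth_mem[OF i] by (auto simp: reg_seq_def)
  show "nzd U (adjoins (adjoin J h) (take i fs)) (fs ! i)"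
    unfolding adjoins_adjoin
    by (rule nzd_adjoin_swap[OF U adjoins_ideal[OF J t] f(1) h f(2) h'])
qed

text \<open>Rees' theorem that all maximal regular sequences in \<open>q\<close> have the same length, without Ext:
  a common nonzerodivisor \<open>h\<close> on all the intermediate quotients replaces the last element of
  either sequence, and can then be moved to the front.\<close>
theorem has_socle_reg_seq:
  assumes I: "acc_above I" and q: "is_prime q" and J: "is_ideal J" "I \<subseteq> J"
    and fs: "set fs \<subseteq> q" "reg_seq (C - q) J fs" and gs: "set gs \<subseteq> q" "reg_seq (C - q) J gs"
    and len: "length fs = length gs" and soc: "has_socle q (adjoins J fs)"
  shows "has_socle q (adjoins J gs)"
  using J fs gs len soc
proof (induction fs arbitrary: J gs rule: rev_induct)
  case Nil
  then show ?case by simp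
next
  case (snoc f fs)
  from snoc.prems(7) obtain gs' g where gs': "gs = gs' @ [g]" "length gs' = length fs"
    by (cases gs rule: rev_cases) auto
  have qC: "q \<subseteq> C" using q prime_ideal by (auto simp: is_ideal_def)
  let ?U = "C - q"
  have U: "mult_set ?U" using q by (rule mult_set_compl)
  note J = snoc.prems(1)
  \<comment> \<open>Each proper prefix is continued by a regular element of \<open>q\<close>, which
    excludes a socle; hence \<open>exists_common_nzd\<close> applies to all prefixes of both
    sequences together.\<close>
  have noso: "\<not> has_socle q (adjoins J (take i hs))"
    if "set (hs @ [h]) \<subseteq> q" "reg_seq ?U J (hs @ [h])" "i \<le> length hs" for hs h i
  proof -
    have i: "i < length (hs @ [h])" using that by simp
    then have "nzd ?U (adjoins J (take i (hs @ [h]))) ((hs @ [h]) ! i)"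
      using that(2) unfolding reg_seq_def by blast
    moreover have "(hs @ [h]) ! i \<in> q" using nth_mem[OF i] that(1) by blast
    ultimately show ?thesis using nzd_imp_no_socle that(3) by simp
  qed
  let ?F = "(\<lambda>i. adjoins J (take i fs)) ` {..length fs} \<union> (\<lambda>i. adjoins J (take i gs')) ` {..length fs}"
  have "\<exists>h\<in>q. \<forall>J\<in>?F. nzd ?U J h"
  proof (rule exists_common_nzd[OF I q])
    fix K assume "K \<in> ?F"
    then obtain i hs h where *: "K = adjoins J (take i hs)" "set (hs @ [h]) \<subseteq> q" "reg_seq ?U J (hs @ [h])"
      "i \<le> length hs"
      using snoc.prems gs' by (elim UnE imageE) (metis atMost_iff)+
    then have "set (take i hs) \<subseteq> C" using qC set_take_subset[of i hs] by auto
    then have "is_ideal K" unfolding * by (intro adjoins_ideal J)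
    moreover have "I \<subseteq> K" using adjoins_sup[of J "take i hs"] snoc.prems(2) unfolding * by blast
    ultimately show "is_ideal K \<and> I \<subseteq> K \<and> \<not> has_socle q K" using noso * by blast
  qed auto
  then obtain h where h: "h \<in> q" "\<And>i. i \<le> length fs \<Longrightarrow> nzd ?U (adjoins J (take i fs)) h"
     "\<And>i. i \<le> length gs' \<Longrightarrow> nzd ?U (adjoins J (take i gs')) h"
    using gs'(2) by auto
  have hC: "h \<in> C" using h qC by auto
  have sC: "set fs \<subseteq> C" "set gs' \<subseteq> C" using snoc.prems gs' qC by auto
  \<comment> \<open>Exchange of the last element \<open>f\<close> for \<open>h\<close>, which is
    then read as part of the base ideal.\<close>
  have "has_socle q (adjoins (adjoin J h) fs)"
    unfolding adjoins_adjoin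
  proof (rule has_socle_exchange[OF q])
    show "has_socle q (adjoin (adjoins J fs) f)" using snoc.prems by (simp add: adjoins_snoc)
    show "nzd ?U (adjoins J fs) f" using snoc.prems by (simp add: reg_seq_snoc)
    show "nzd ?U (adjoins J fs) h" using h(2)[of "length fs"] by simp
  qed (use J sC h snoc.prems in \<open>auto intro: adjoins_ideal\<close>)
  note soc = this
  have r1: "reg_seq ?U (adjoin J h) fs"
    using snoc.prems h by (intro reg_seq_adjoin[OF U J sC(1) hC]) (auto simp: reg_seq_snoc)
  have r2: "reg_seq ?U (adjoin J h) gs'"
    using snoc.prems gs' h by (intro reg_seq_adjoin[OF U J sC(2) hC]) (auto simp: reg_seq_snoc)
  have "I \<subseteq> adjoin J h" using snoc.prems(2) adjoin_sup[of J h] by blast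
  \<comment> \<open>Over the base \<open>J + (h)\<close> both sequences are shorter by one. The
    exchange of \<open>h\<close> for \<open>g\<close> that follows undoes the shift.\<close>
  then have "has_socle q (adjoins (adjoin J h) gs')"
    by (rule snoc.IH[OF adjoin_ideal[OF J hC] _ _ r1 _ r2 _ soc]) (use snoc.prems gs' in auto)
  then have "has_socle q (adjoin (adjoins J gs') h)" by (simp add: adjoins_adjoin)
  then have "has_socle q (adjoin (adjoins J gs') g)"
  proof (rule has_socle_exchange[OF q, rotated -1])
    show "nzd ?U (adjoins J gs') g" using snoc.prems gs' by (simp add: reg_seq_snoc)
    show "nzd ?U (adjoins J gs') h" using h(3)[of "length gs'"] by simp
  qed (use J sC h snoc.prems gs' in \<open>auto intro: adjoins_ideal\<close>)
  then show ?case by (simp add: gs' adjoins_snoc)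
qed

text \<open>If \<open>gs\<close> were longer, its prefix of length \<open>length fs\<close> would
  leave a socle too, contradicting the regularity of the next element of \<open>gs\<close>.\<close>

lemma reg_seq_length_le:
  assumes I: "acc_above I" and q: "is_prime q" and J: "is_ideal J" "I \<subseteq> J"
    and fs: "set fs \<subseteq> q" "reg_seq (C - q) J fs" and soc: "has_socle q (adjoins J fs)"
    and gs: "set gs \<subseteq> q" "reg_seq (C - q) J gs"
  shows "length gs \<le> length fs"
proof (rule ccontr)
  assume len: "\<not> length gs \<le> length fs"
  let ?r = "length fs"
  have "has_socle q (adjoins J (take ?r gs))"
    using gs len set_take_subset[of ?r gs]
    by (intro has_socle_reg_seq[OF I q J fs _ _ _ soc]) (auto intro: reg_seq_take)
  moreover have "nzd (C - q) (adjoins J (take ?r gs)) (gs ! ?r)" "gs ! ?r \<in> q"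
    using gs len by (auto simp: reg_seq_def)
  ultimately show False using nzd_imp_no_socle by blast
qed

text \<open>A maximality argument replaces Nakayama's lemma: if \<open>(J : p)\<close> were contained in \<open>xM\<close>
  locally at \<open>q\<close>, an element \<open>z\<close> of it with \<open>J + (z)\<close> maximal could be divided by \<open>x\<close>.\<close>
lemma assoc_primes_nzd:
  assumes I: "acc_above I" and q: "is_prime q" and J: "is_ideal J" "I \<subseteq> J"
    and x: "x \<in> q" "nzd (C - q) J x" and p: "p \<in> assoc_primes (sat (C - q) J)"
  shows "\<exists>p'\<in>assoc_primes (sat (C - q) (adjoin J x)). p \<subset> p'"
proof -
  let ?U = "C - q"
  let ?J = "sat ?U J" and ?K = "sat ?U (adjoin J x)"
  have U: "mult_set ?U" using q by (rule mult_set_compl)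
  have qC: "q \<subseteq> C" using q prime_ideal by (auto simp: is_ideal_def)
  then have xC: "x \<in> C" using x by auto
  have Ji: "is_ideal ?J" "I \<subseteq> ?J" using J sat_ideal[OF U] sat_sup[OF U] by blast+
  have Ai: "is_ideal (adjoin J x)" by (rule adjoin_ideal[OF J(1) xC])
  have JK: "J \<subseteq> ?K" using adjoin_sup[of J x] sat_sup[OF U Ai] by (rule subset_trans)
  have Ki: "is_ideal ?K" "I \<subseteq> ?K" using sat_ideal[OF U Ai] JK J(2) by auto
  have xK: "x \<in> ?K" using sat_sup[OF U Ai] adjoin_mem[OF J(1), of x] by (rule subsetD)
  obtain w where w: "is_prime p" "w \<in> C" "p = colon ?J w" using p by (auto simp: assoc_primes_def)
  have wJ: "w \<notin> ?J" using colon_eq_carrier[OF Ji(1) w(2)] w(1,3) unfolding is_prime_def by blast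
  \<comment> \<open>\<open>?P\<close> describes the nonzero elements killed by \<open>p\<close> in
    the localized module.\<close>
  let ?P = "\<lambda>z. z \<in> C \<and> z \<notin> ?J \<and> (\<forall>a\<in>p. a * z \<in> ?J)"
  let ?F = "{sat ?U (adjoin ?J z) | z. ?P z}"
  have "?P w" using w wJ by (auto simp: colon_def)
  then have "?F \<noteq> {}" by auto
  moreover have "\<forall>J\<in>?F. is_ideal J \<and> I \<subseteq> J"
  proof
    fix L assume "L \<in> ?F"
    then obtain z where z: "L = sat ?U (adjoin ?J z)" "z \<in> C" by blast
    have "is_ideal (adjoin ?J z)" using Ji z adjoin_ideal by blast
    then show "is_ideal L \<and> I \<subseteq> L"
      unfolding z using sat_ideal[OF U] sat_sup[OF U] adjoin_sup[of ?J z] Ji by blast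
  qed
  ultimately obtain M where "M \<in> ?F" and max: "\<And>J. J \<in> ?F \<Longrightarrow> M \<subseteq> J \<Longrightarrow> J = M"
    using I unfolding acc_above_def by meson
  then obtain z where z: "M = sat ?U (adjoin ?J z)" "?P z" by auto
  have zK: "z \<notin> ?K"
  proof
    assume "z \<in> ?K"
    then obtain u j b where u: "u \<in> ?U" "j \<in> J" "b \<in> C" "u * z = j + b * x" by (auto elim!: satE adjoinE)
    have uC: "u \<in> C" using u by auto
    have jJ: "j \<in> ?J" using u sat_sup[OF U J(1)] by blast
    \<comment> \<open>\<open>b\<close> stands for z / x. It is again killed by \<open>p\<close>
      since \<open>x\<close> can be cancelled, and nonzero since \<open>z\<close> is.\<close>
    have "?P b"
    proof (intro conjI ballI)
      show "b \<in> C" by fact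
      show "b \<notin> ?J"
      proof
        assume "b \<in> ?J"
        then have "j + b * x \<in> ?J" using Ji xC jJ by (intro ideal_add ideal_mult') auto
        then show False using sat_sat[OF U u(1), of z J] u(4) z by auto
      qed
    next
      fix a assume a: "a \<in> p"
      have aC: "a \<in> C" using a w by (auto simp: colon_def)
      have az: "a * z \<in> ?J" using a z by blast
      have "x * (a * b) = u * (a * z) - a * j" using u(4) by (simp add: algebra_simps)
      also have "\<dots> \<in> ?J"
        by (rule ideal_diff[OF Ji(1) ideal_mult[OF Ji(1) uC az] ideal_mult[OF Ji(1) aC jJ]])
      finally have "x * (a * b) \<in> ?J" .
      then show "a * b \<in> ?J" by (rule nzdD[OF x(2), rotated]) (use aC u in auto)
    qed
    then have bF: "sat ?U (adjoin ?J b) \<in> ?F" and bP: "?P b" by blast+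
    have zb: "z \<in> sat ?U (adjoin ?J b)"
      using u z jJ xC by (intro satI[OF u(1)]) (auto intro!: adjoinI[of j _ x] simp: mult.commute)
    have aJ: "is_ideal (adjoin ?J b)" using Ji bP adjoin_ideal by auto
    have Mb: "M \<subseteq> sat ?U (adjoin ?J b)"
    proof
      fix y assume "y \<in> M"
      then obtain v k c where v: "v \<in> ?U" "k \<in> ?J" "c \<in> C" "v * y = k + c * z" "y \<in> C"
        using z(1) by (blast elim: sat_adjoinE)
      have "k \<in> sat ?U (adjoin ?J b)"
        using v(2) sat_sup[OF U aJ] adjoin_sup[of ?J b] by blast
      then have "v * y \<in> sat ?U (adjoin ?J b)"
        unfolding v(4)
        by (rule ideal_add[OF sat_ideal[OF U aJ] _ ideal_mult[OF sat_ideal[OF U aJ] v(3) zb]])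
      then show "y \<in> sat ?U (adjoin ?J b)" by (rule sat_sat[OF U v(1,5)])
    qed
    have "sat ?U (adjoin ?J b) = M" by (rule max[OF bF Mb])
    moreover have "b \<in> sat ?U (adjoin ?J b)" using sat_sup[OF U aJ] adjoin_mem[OF Ji(1)] by blast
    ultimately have "b \<in> sat ?U (adjoin ?J z)" using z(1) by simp
    then obtain v k c where v: "v \<in> ?U" "k \<in> ?J" "c \<in> C" "v * b = k + c * z"
      by (rule sat_adjoinE)
    \<comment> \<open>The Nakayama step. By maximality \<open>b\<close> is locally a multiple of
      \<open>z\<close>, so z = b x turns into a relation with coefficient
      \<open>v * u - c * x\<close>. This is a unit at \<open>q\<close> because \<open>x\<close> lies
      in \<open>q\<close>, and \<open>z\<close> would vanish.\<close>
    have "(v * u - c * x) * z = v * (u * z) - c * x * z" by (simp add: algebra_simps)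
    also have "\<dots> = v * (j + b * x) - c * x * z" using u by simp
    also have "\<dots> = v * j + (v * b) * x - c * x * z" by (simp add: algebra_simps)
    also have "\<dots> = v * j + (k + c * z) * x - c * x * z" using v by simp
    also have "\<dots> = v * j + x * k" by (simp add: algebra_simps)
    also have "\<dots> \<in> ?J" using v jJ xC Ji by (intro ideal_add ideal_mult) auto
    finally have "(v * u - c * x) * z \<in> ?J" .
    moreover have "v * u - c * x \<in> ?U"
    proof -
      have "v * u \<notin> q" using mult_set_mult[OF U v(1) u(1)] by simp
      moreover have "c * x \<in> q" by (rule ideal_mult[OF prime_ideal[OF q] v(3) x(1)])
      then have "v * u - c * x \<in> q \<Longrightarrow> v * u \<in> q"
        using ideal_add[OF prime_ideal[OF q], of "v * u - c * x" "c * x"] by simp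
      ultimately show ?thesis using v uC xC by auto
    qed
    ultimately have "z \<in> ?J" using z(2) sat_sat[OF U, of "v * u - c * x" z J] by simp
    then show False using z(2) by simp
  qed
  let ?c = "colon ?K z"
  obtain p' where p': "p' \<in> assoc_primes ?K" "?c \<subseteq> p'"
    using exists_assoc_prime[OF I Ki(1,2) _ zK] z by auto
  have "p \<subseteq> ?c"
  proof
    fix a assume a: "a \<in> p"
    have "?J \<subseteq> ?K" using sat_mono adjoin_sup by blast
    then show "a \<in> ?c" using a z w by (auto simp: colon_def)
  qed
  moreover have "x \<in> ?c" using xK xC z Ki(1) by (auto simp: colon_def intro: ideal_mult')
  moreover have "x \<notin> p"
  proof
    assume "x \<in> p"
    then have "x * w \<in> ?J" using w by (auto simp: colon_def)
    then show False using nzdD[OF x(2) w(2)] wJ by auto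
  qed
  ultimately show ?thesis using p' by blast
qed

definition chain :: "nat \<Rightarrow> (nat \<Rightarrow> 'a set) \<Rightarrow> bool" where
  "chain l c \<longleftrightarrow> (\<forall>i\<le>l. is_prime (c i)) \<and> (\<forall>i<l. c i \<subset> c (Suc i))"

lemma chain_subset: "chain l c \<Longrightarrow> i \<le> j \<Longrightarrow> j \<le> l \<Longrightarrow> c i \<subseteq> c j"
proof (induction j)
  case (Suc j)
  then have "c j \<subset> c (Suc j)" by (simp add: chain_def)
  then show ?case using Suc by (cases "i = Suc j") auto
qed simp

end

section \<open>Monomial ideals and their associated primes\<close>

text \<open>Any linear order will do: it induces a term order on the exponents, hence leading monomials.\<close>
instantiation var :: linorder
begin

fun var_code :: "var \<Rightarrow> nat" where
  "var_code (VarX i) = 2 * i"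
| "var_code (VarY i) = 2 * i + 1"

definition less_eq_var :: "var \<Rightarrow> var \<Rightarrow> bool" where
  "less_eq_var a b \<longleftrightarrow> var_code a \<le> var_code b"

definition less_var :: "var \<Rightarrow> var \<Rightarrow> bool" where
  "less_var a b \<longleftrightarrow> var_code a < var_code b"

lemma var_code_inj: "var_code a = var_code b \<Longrightarrow> a = b"
  by (cases a; cases b) (simp_all, presburger+)

instance
proof
  fix a b c :: var
  show "a < b \<longleftrightarrow> a \<le> b \<and> \<not> b \<le> a" "a \<le> a" "a \<le> b \<Longrightarrow> b \<le> c \<Longrightarrow> a \<le> c" "a \<le> b \<or> b \<le> a"
    by (simp_all only: less_eq_var_def less_var_def) linarith+
  show "a \<le> b \<Longrightarrow> b \<le> a \<Longrightarrow> a = b"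
    by (rule var_code_inj) (simp add: less_eq_var_def)
qed

end

abbreviation keys :: "('a \<Rightarrow>\<^sub>0 'b::zero) \<Rightarrow> 'a set" where "keys \<equiv> Poly_Mapping.keys"
abbreviation lookup :: "('a \<Rightarrow>\<^sub>0 'b::zero) \<Rightarrow> 'a \<Rightarrow> 'b" where "lookup \<equiv> Poly_Mapping.lookup"
abbreviation single :: "'a \<Rightarrow> 'b \<Rightarrow> 'a \<Rightarrow>\<^sub>0 'b::zero" where "single \<equiv> Poly_Mapping.single"
abbreviation mon :: "'a \<Rightarrow> 'a \<Rightarrow>\<^sub>0 'b::zero_neq_one" where "mon t \<equiv> single t 1"

type_synonym ('v, 'k) vpoly = "('v \<Rightarrow>\<^sub>0 nat) \<Rightarrow>\<^sub>0 'k"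

lemma poly_expand: "(\<Sum>t\<in>keys f. single t (lookup f t)) = f"
  by (rule poly_mapping_eqI) (auto simp: lookup_sum lookup_single when_def in_keys_iff)

lemma lookup_mult_sum:
  fixes f g :: "'a::comm_monoid_add \<Rightarrow>\<^sub>0 'b::comm_semiring_1"
  shows "lookup (f * g) k = (\<Sum>a\<in>keys f. \<Sum>b\<in>keys g. lookup f a * lookup g b when k = a + b)"
proof -
  have "f * g = (\<Sum>a\<in>keys f. single a (lookup f a)) * (\<Sum>b\<in>keys g. single b (lookup g b))"
    by (simp add: poly_expand)
  also have "\<dots> = (\<Sum>a\<in>keys f. \<Sum>b\<in>keys g. single (a + b) (lookup f a * lookup g b))"
    by (simp add: sum_product mult_single)
  finally have "f * g = (\<Sum>a\<in>keys f. \<Sum>b\<in>keys g. single (a + b) (lookup f a * lookup g b))" .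
  then have "lookup (f * g) k =
      lookup (\<Sum>a\<in>keys f. \<Sum>b\<in>keys g. single (a + b) (lookup f a * lookup g b)) k" by (rule arg_cong)
  then show ?thesis by (simp add: lookup_sum lookup_single when_def eq_commute)
qed

lemma lookup_single_mult:
  fixes f :: "'a::cancel_comm_monoid_add \<Rightarrow>\<^sub>0 'b::comm_semiring_1"
  shows "lookup (single t c * f) (t + s) = c * lookup f s"
  by (cases "c = 0") (auto simp: lookup_mult_sum when_def in_keys_iff)

lemma keys_mon_mult:
  fixes f :: "'a::cancel_comm_monoid_add \<Rightarrow>\<^sub>0 'b::comm_semiring_1"
  shows "keys (mon t * f) = (+) t ` keys f"
proof
  show "keys (mon t * f) \<subseteq> (+) t ` keys f" using keys_mult[of "mon t" f] by (auto split: if_splits)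
  show "(+) t ` keys f \<subseteq> keys (mon t * f)" by (auto simp: in_keys_iff lookup_single_mult)
qed

text \<open>Addition is strictly monotone for the order on exponents, so only the two leading terms
  contribute to this exponent and their product cannot cancel.\<close>

lemma Max_keys_add:
  fixes f g :: "('v::linorder \<Rightarrow>\<^sub>0 nat) \<Rightarrow>\<^sub>0 'k::field"
  assumes "f \<noteq> 0" "g \<noteq> 0"
  shows "Max (keys f) + Max (keys g) \<in> keys (f * g)"
proof -
  let ?a = "Max (keys f)" and ?b = "Max (keys g)"
  have ab: "?a \<in> keys f" "?b \<in> keys g" using assms by (auto intro!: Max_in)
  have *: "(lookup f a * lookup g b when ?a + ?b = a + b) =
      (if b = ?b then if a = ?a then lookup f ?a * lookup g ?b else 0 else 0)"
    if "a \<in> keys f" "b \<in> keys g" for a b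
  proof (cases "a = ?a \<and> b = ?b")
    case False
    have le: "a \<le> ?a" "b \<le> ?b" using that by auto
    then have "a < ?a \<or> b < ?b" using False by (auto simp: order.order_iff_strict)
    then have "a + b < ?a + ?b" using le add_less_le_mono add_le_less_mono by blast
    then have "?a + ?b \<noteq> a + b" by auto
    with False show ?thesis by auto
  qed auto
  have "lookup (f * g) (?a + ?b) = (\<Sum>a\<in>keys f. \<Sum>b\<in>keys g.
      (if b = ?b then if a = ?a then lookup f ?a * lookup g ?b else 0 else 0))"
    unfolding lookup_mult_sum by (intro sum.cong refl *)
  also have "\<dots> = lookup f ?a * lookup g ?b" using ab by simp
  finally show ?thesis using ab by (auto simp: in_keys_iff)
qed

locale monomial_ring =
  fixes V :: "'v::linorder set" and C :: "('v, 'k::field) vpoly set"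
  assumes C_def: "C = {f. \<forall>t\<in>keys f. keys t \<subseteq> V}" and finite_V: "finite V"
begin

section \<open>Exponents, monomial ideals and ideals generated by variables\<close>

definition exps :: "('v \<Rightarrow>\<^sub>0 nat) set" where
  "exps = {t. keys t \<subseteq> V}"

lemma exps_0 [simp]: "0 \<in> exps" by (simp add: exps_def)

lemma exps_add [simp]: "s \<in> exps \<Longrightarrow> t \<in> exps \<Longrightarrow> s + t \<in> exps"
  using Poly_Mapping.keys_add[of s t] by (auto simp: exps_def)

lemma mem_C: "f \<in> C \<longleftrightarrow> keys f \<subseteq> exps"
  by (auto simp: C_def exps_def)

lemma single_C [simp]: "t \<in> exps \<Longrightarrow> single t c \<in> C"
  by (auto simp: mem_C)

sublocale comm_subring C
proof
  fix x y assume "x \<in> C" "y \<in> C"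
  then have xy: "keys x \<subseteq> exps" "keys y \<subseteq> exps" by (simp_all add: mem_C)
  show "x + y \<in> C" using Poly_Mapping.keys_add[of x y] xy unfolding mem_C by blast
  have "{a + b |a b. a \<in> keys x \<and> b \<in> keys y} \<subseteq> exps" using xy exps_add by blast
  then show "x * y \<in> C" using keys_mult[of x y] unfolding mem_C by blast
  have "keys (- x) = keys x" by (simp add: in_keys_iff set_eq_iff)
  then show "- x \<in> C" using xy by (simp add: mem_C)
qed (simp_all add: mem_C)

definition monideal :: "('v \<Rightarrow>\<^sub>0 nat) set \<Rightarrow> ('v, 'k) vpoly set" where
  "monideal E = {f. keys f \<subseteq> E}"

definition upclosed :: "('v \<Rightarrow>\<^sub>0 nat) set \<Rightarrow> bool" where
  "upclosed E \<longleftrightarrow> E \<subseteq> exps \<and> (\<forall>s\<in>exps. \<forall>t\<in>E. s + t \<in> E)"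

definition var_ideal :: "'v set \<Rightarrow> ('v, 'k) vpoly set" where
  "var_ideal A = monideal {t \<in> exps. keys t \<inter> A \<noteq> {}}"

lemma mon_mem_monideal [simp]: "mon t \<in> monideal E \<longleftrightarrow> t \<in> E"
  by (simp add: monideal_def)

lemma monideal_ideal: assumes "upclosed E" shows "is_ideal (monideal E)"
  unfolding is_ideal_def
proof (intro conjI ballI)
  show "monideal E \<subseteq> C" using assms by (auto simp: monideal_def upclosed_def mem_C)
  show "0 \<in> monideal E" by (simp add: monideal_def)
  fix x y assume "x \<in> monideal E" "y \<in> monideal E"
  then show "x + y \<in> monideal E" using Poly_Mapping.keys_add[of x y] by (auto simp: monideal_def)
next
  fix r x assume "r \<in> C" "x \<in> monideal E"
  then have "{a + b |a b. a \<in> keys r \<and> b \<in> keys x} \<subseteq> E"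
    using assms unfolding monideal_def upclosed_def mem_C by blast
  then show "r * x \<in> monideal E" using keys_mult[of r x] unfolding monideal_def by blast
qed

lemma keys_add_nat: "keys ((s :: 'v \<Rightarrow>\<^sub>0 nat) + t) = keys s \<union> keys t"
  by (auto simp: in_keys_iff lookup_add)

lemma upclosed_vars: "upclosed {t \<in> exps. keys t \<inter> A \<noteq> {}}"
  by (auto simp: upclosed_def keys_add_nat)

lemma var_ideal_ideal: "is_ideal (var_ideal A)"
  unfolding var_ideal_def by (rule monideal_ideal[OF upclosed_vars])

lemma mem_var_ideal: "f \<in> var_ideal A \<longleftrightarrow> f \<in> C \<and> (\<forall>t\<in>keys f. keys t \<inter> A \<noteq> {})"
  by (auto simp: var_ideal_def monideal_def mem_C)

lemma mon_mem_var_ideal: "t \<in> exps \<Longrightarrow> mon t \<in> var_ideal A \<longleftrightarrow> keys t \<inter> A \<noteq> {}"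
  by (simp add: mem_var_ideal)

lemma var_ideal_mono: "A \<subseteq> B \<Longrightarrow> var_ideal A \<subseteq> var_ideal B"
  unfolding mem_var_ideal subset_iff by blast

text \<open>The normal form modulo \<open>var_ideal A\<close>, that is, the substitution of 0 for
  the variables in \<open>A\<close>.\<close>

definition drop_vars :: "'v set \<Rightarrow> ('v, 'k) vpoly \<Rightarrow> ('v, 'k) vpoly" where
  "drop_vars A f = Poly_Mapping.mapp (\<lambda>t c. if keys t \<inter> A = {} then c else 0) f"

lemma lookup_drop_vars: "lookup (drop_vars A f) t = (if keys t \<inter> A = {} then lookup f t else 0)"
  by (auto simp: drop_vars_def lookup_mapp in_keys_iff when_def)

lemma keys_drop_vars: "keys (drop_vars A f) = {t \<in> keys f. keys t \<inter> A = {}}"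
  unfolding set_eq_iff in_keys_iff[of _ "drop_vars A f"] lookup_drop_vars by (simp add: in_keys_iff)

lemma drop_vars_C: "f \<in> C \<Longrightarrow> drop_vars A f \<in> C"
  by (auto simp: mem_C keys_drop_vars)

lemma drop_vars_diff: "f \<in> C \<Longrightarrow> f - drop_vars A f \<in> var_ideal A"
  unfolding mem_var_ideal Ball_def in_keys_iff[of _ "f - drop_vars A f"] lookup_minus lookup_drop_vars
  by (simp add: drop_vars_C)

lemma drop_vars_eq_0: "f \<in> C \<Longrightarrow> drop_vars A f = 0 \<longleftrightarrow> f \<in> var_ideal A"
  unfolding keys_eq_empty[symmetric] keys_drop_vars mem_var_ideal by auto

text \<open>Modulo the ideal both factors can be replaced by their normal forms. If these are
  nonzero, their leading exponents avoid \<open>A\<close>, and the sum occurs in the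
  product.\<close>

lemma var_ideal_prime: "is_prime (var_ideal A)"
  unfolding is_prime_def
proof (intro conjI ballI impI)
  show "is_ideal (var_ideal A)" by (rule var_ideal_ideal)
  show "var_ideal A \<noteq> C" using mon_mem_var_ideal[of 0 A] single_C[of 0 1] by auto
  fix f g assume fg: "f \<in> C" "g \<in> C" "f * g \<in> var_ideal A"
  show "f \<in> var_ideal A \<or> g \<in> var_ideal A"
  proof (rule ccontr)
    assume "\<not> (f \<in> var_ideal A \<or> g \<in> var_ideal A)"
    then have nz: "drop_vars A f \<noteq> 0" "drop_vars A g \<noteq> 0" using drop_vars_eq_0 fg by auto
    let ?f = "drop_vars A f" and ?g = "drop_vars A g"
    have "f * g - ?f * ?g = g * (f - ?f) + ?f * (g - ?g)" by (simp add: algebra_simps)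
    also have "\<dots> \<in> var_ideal A"
      by (intro ideal_add ideal_mult var_ideal_ideal drop_vars_diff drop_vars_C fg)
    finally have "?f * ?g \<in> var_ideal A" using ideal_diff_iff[OF var_ideal_ideal] fg by blast
    moreover have "Max (keys ?f) + Max (keys ?g) \<in> keys (?f * ?g)" by (rule Max_keys_add[OF nz])
    moreover have "Max (keys ?f) \<in> keys ?f" "Max (keys ?g) \<in> keys ?g" using nz by (auto intro!: Max_in)
    ultimately have "keys (Max (keys ?f) + Max (keys ?g)) \<inter> A \<noteq> {}"
      "Max (keys ?f) \<in> keys ?f" "Max (keys ?g) \<in> keys ?g" by (auto simp: mem_var_ideal)
    then show False unfolding keys_add_nat by (auto simp: keys_drop_vars)
  qed
qed

lemma mon_split: "v \<in> keys t \<Longrightarrow> single v 1 + (t - single v 1) = (t :: 'v \<Rightarrow>\<^sub>0 nat)"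
  by (rule poly_mapping_eqI) (auto simp: lookup_add lookup_minus lookup_single when_def in_keys_iff)

lemma exps_split: "v \<in> keys t \<Longrightarrow> t \<in> exps \<Longrightarrow> single v 1 \<in> exps \<and> t - single v 1 \<in> exps"
  by (auto simp: exps_def in_keys_iff lookup_minus)

lemma exps_induct [consumes 1, case_names zero step]:
  assumes "t \<in> exps" "P 0" "\<And>t v. t \<in> exps \<Longrightarrow> v \<in> V \<Longrightarrow> P t \<Longrightarrow> P (single v 1 + t)"
  shows "P t"
  using assms(1)
proof (induction "\<Sum>v\<in>V. lookup t v" arbitrary: t)
  case 0
  then have "\<forall>v\<in>V. lookup t v = 0" using finite_V by simp
  then have "t = 0" using 0 by (intro poly_mapping_eqI) (auto simp: exps_def in_keys_iff)
  then show ?case using assms by simp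
next
  case (Suc k)
  have "\<exists>v\<in>V. lookup t v \<noteq> 0"
  proof (rule ccontr)
    assume "\<not> ?thesis"
    then have "(\<Sum>v\<in>V. lookup t v) = 0" by simp
    with Suc show False by simp
  qed
  then obtain v where v: "v \<in> keys t" "v \<in> V" by (auto simp: in_keys_iff)
  let ?t = "t - single v 1"
  have t: "t = single v 1 + ?t" using mon_split[OF v(1)] by simp
  have "(\<Sum>w\<in>V. lookup t w) = (\<Sum>w\<in>V. lookup (single v 1) w) + (\<Sum>w\<in>V. lookup ?t w)"
    by (subst t) (simp add: lookup_add sum.distrib)
  also have "(\<Sum>w\<in>V. lookup (single v (1::nat)) w) = 1"
    using v finite_V by (simp add: lookup_single when_def)
  finally have "k = (\<Sum>w\<in>V. lookup ?t w)" using Suc(2) by simp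
  then have "P ?t" using Suc(1) exps_split[OF v(1) Suc(3)] by blast
  then show ?case using assms(3)[of ?t v] exps_split[OF v(1) Suc(3)] v t by simp
qed

lemma prime_mon:
  assumes "is_prime p" "t \<in> exps" "mon t \<in> p"
  shows "\<exists>v\<in>keys t. mon (single v 1) \<in> p"
  using assms(2,3)
proof (induction t rule: exps_induct)
  case zero
  then show ?case using prime_one[OF assms(1)] by simp
next
  case (step t v)
  have v: "single v 1 \<in> exps" using step by (simp add: exps_def)
  have "mon (single v 1) * mon t \<in> p" using step by (simp add: mult_single)
  then have "mon (single v 1) \<in> p \<or> mon t \<in> p" using prime_mult[OF assms(1)] v step by simp
  then show ?case using step by (auto simp: keys_add_nat)
qed

lemma ideal_mon_single:
  assumes "is_ideal p" "t \<in> exps" "mon t \<in> p" shows "single t c \<in> p"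
  using ideal_mult[OF assms(1) single_C[of 0 c] assms(3)] by (simp add: mult_single)

lemma ideal_terms:
  assumes p: "is_ideal p" and f: "f \<in> C" "\<And>t. t \<in> keys f \<Longrightarrow> mon t \<in> p"
  shows "f \<in> p"
proof -
  have "single t (lookup f t) \<in> p" if "t \<in> keys f" for t
    using ideal_mon_single[OF p _ f(2)[OF that]] f(1) that by (auto simp: mem_C)
  then have "(\<Sum>t\<in>keys f. single t (lookup f t)) \<in> p" by (rule ideal_sum[OF p])
  then show ?thesis by (simp add: poly_expand)
qed

lemma ideal_mon_add: "is_ideal p \<Longrightarrow> s \<in> exps \<Longrightarrow> mon t \<in> p \<Longrightarrow> mon (s + t) \<in> p"
  using ideal_mult[of p "mon s" "mon t"] by (simp add: mult_single)

text \<open>Among all \<open>z\<close> with annihilator \<open>p\<close> one with the fewest terms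
  is taken. If the leading monomial of some f in \<open>p\<close> were outside \<open>p\<close>,
  multiplying \<open>z\<close> by it would keep both the annihilator and the number of terms; but
  the new leading term lies in the ideal because f z does, so it could be deleted.\<close>

lemma assoc_prime_var_ideal:
  assumes E: "upclosed E" and p: "p \<in> assoc_primes (monideal E)"
  shows "\<exists>A\<subseteq>V. p = var_ideal A"
proof -
  let ?I = "monideal E"
  have I: "is_ideal ?I" using E by (rule monideal_ideal)
  have pp: "is_prime p" using p by (simp add: assoc_primes_def)
  have pI: "is_ideal p" using pp by (rule prime_ideal)
  let ?Z = "\<lambda>z. z \<in> C \<and> p = colon ?I z"
  have "\<exists>z. ?Z z" using p by (auto simp: assoc_primes_def)
  then obtain z where z: "?Z z" and min: "\<And>w. ?Z w \<Longrightarrow> card (keys z) \<le> card (keys w)"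
    using ex_has_least_nat[of ?Z _ "\<lambda>w. card (keys w)"] by metis
  have zI: "z \<notin> ?I" using z colon_eq_carrier[OF I] pp by (auto simp: is_prime_def)
  then have z0: "z \<noteq> 0" by (auto simp: monideal_def)
  have lm: "mon (Max (keys f)) \<in> p" if f: "f \<in> p" "f \<noteq> 0" for f
  proof (rule ccontr)
    let ?a = "Max (keys f)" and ?b = "Max (keys z)"
    assume a: "mon ?a \<notin> p"
    have fC: "f \<in> C" using prime_sub[OF pp f(1)] .
    have aM: "?a \<in> keys f" "?b \<in> keys z" using f z0 by (auto intro!: Max_in)
    then have aE: "?a \<in> exps" using fC by (auto simp: mem_C)
    let ?w = "mon ?a * z"
    have w: "?w \<in> C" "p = colon ?I ?w"
      using colon_prime_mult[OF I, of z "mon ?a"] z pp a aE by simp_all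
    have "f * z \<in> ?I" using f z by (auto simp: colon_def)
    then have E1: "?a + ?b \<in> E" using Max_keys_add[OF f(2) z0] by (auto simp: monideal_def)
    let ?s = "single (?a + ?b) (lookup ?w (?a + ?b))"
    let ?w' = "?w - ?s"
    have s: "?s \<in> ?I" using E1 by (auto simp: monideal_def)
    have wC: "?w' \<in> C" using w ideal_sub[OF I s] by auto
    have "c * ?w' \<in> ?I \<longleftrightarrow> c * ?w \<in> ?I" if "c \<in> C" for c
      using ideal_diff_iff[OF I, of "c * ?w" "c * ?w'"] ideal_mult[OF I that s]
      by (simp add: right_diff_distrib)
    then have "p = colon ?I ?w'" unfolding w(2) by (auto simp: colon_def)
    then have "card (keys z) \<le> card (keys ?w')" using min wC by blast
    moreover have "card (keys ?w') < card (keys ?w)"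
    proof (rule psubset_card_mono)
      have "keys ?w' \<subseteq> keys ?w" by (auto simp: in_keys_iff lookup_minus lookup_single when_def split: if_splits)
      moreover have "?a + ?b \<in> keys ?w" using aM by (simp add: keys_mon_mult)
      moreover have "?a + ?b \<notin> keys ?w'" by (simp add: in_keys_iff lookup_minus)
      ultimately show "keys ?w' \<subset> keys ?w" by blast
    qed simp
    moreover have "card (keys ?w) = card (keys z)" unfolding keys_mon_mult by (rule card_image) simp
    ultimately show False by simp
  qed
  \<comment> \<open>Leading terms are stripped one by one, so \<open>p\<close> contains every
    monomial of each of its elements. Being prime, it is then generated by variables.\<close>
  have mons: "f \<in> p \<Longrightarrow> t \<in> keys f \<Longrightarrow> mon t \<in> p" for f t
  proof (induction "card (keys f)" arbitrary: f rule: less_induct)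
    case less
    let ?a = "Max (keys f)"
    have f0: "f \<noteq> 0" using less by auto
    have a: "mon ?a \<in> p" by (rule lm[OF less(2) f0])
    have aM: "?a \<in> keys f" using f0 by (auto intro!: Max_in)
    then have aE: "?a \<in> exps" using prime_sub[OF pp less(2)] by (auto simp: mem_C)
    show ?case
    proof (cases "t = ?a")
      case False
      let ?g = "f - single ?a (lookup f ?a)"
      have "?g \<in> p" using ideal_diff[OF pI less(2) ideal_mon_single[OF pI aE a]] .
      moreover have "keys ?g = keys f - {?a}"
        by (auto simp: in_keys_iff lookup_minus lookup_single when_def split: if_splits)
      moreover from this have "card (keys ?g) < card (keys f)"
        using card_Diff1_less[OF finite_keys aM] by (simp only:)
      ultimately show ?thesis using less(1)[of ?g] less(3) False by auto
    qed (use a in simp)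
  qed
  define A where "A = {v \<in> V. mon (single v 1) \<in> p}"
  have "p = var_ideal A"
  proof (intro equalityI subsetI)
    fix f assume f: "f \<in> p"
    have fC: "f \<in> C" using prime_sub[OF pp f] .
    have "keys t \<inter> A \<noteq> {}" if t: "t \<in> keys f" for t
    proof -
      have te: "t \<in> exps" using fC t by (auto simp: mem_C)
      obtain v where "v \<in> keys t" "mon (single v 1) \<in> p" using prime_mon[OF pp te mons[OF f t]] by blast
      then show ?thesis using te by (auto simp: A_def exps_def)
    qed
    then show "f \<in> var_ideal A" using fC by (simp add: mem_var_ideal)
  next
    fix f assume f: "f \<in> var_ideal A"
    show "f \<in> p"
    proof (rule ideal_terms[OF pI])
      show fC: "f \<in> C" using f by (simp add: mem_var_ideal)
      fix t assume t: "t \<in> keys f"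
      then obtain v where v: "v \<in> keys t" "v \<in> A" using f by (auto simp: mem_var_ideal)
      have te: "t \<in> exps" using fC t by (auto simp: mem_C)
      have "mon ((t - single v 1) + single v 1) \<in> p"
        using exps_split[OF v(1) te] v by (intro ideal_mon_add pI) (auto simp: A_def)
      then show "mon t \<in> p" using mon_split[OF v(1)] by (simp add: add.commute)
    qed
  qed
  then show ?thesis by (intro exI[of _ A]) (auto simp: A_def)
qed

text \<open>The set \<open>bad\<close> is the exponent set of the monomial ideal \<open>{f. \<exists>s\<notin>q. s f \<in> I}\<close>. A monomial \<open>u\<close>
  outside it that is multiplied into it by as many variables as possible has a prime colon ideal.\<close>
lemma exists_assoc_var_ideal:
  assumes E: "upclosed E" and q: "is_prime q" and sub: "monideal E \<subseteq> q"
  shows "\<exists>A\<subseteq>V. var_ideal A \<in> assoc_primes (monideal E) \<and> var_ideal A \<subseteq> q"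
proof -
  let ?I = "monideal E"
  have I: "is_ideal ?I" using E by (rule monideal_ideal)
  have qI: "is_ideal q" using q by (rule prime_ideal)
  have up: "s + t \<in> E" if "s \<in> exps" "t \<in> E" for s t using E that by (auto simp: upclosed_def)
  define bad where "bad u \<longleftrightarrow> (\<exists>s\<in>exps. mon s \<notin> q \<and> s + u \<in> E)" for u
  have bad_up: "bad (s + u)" if "bad u" "s \<in> exps" for u s
  proof -
    obtain r where r: "r \<in> exps" "mon r \<notin> q" "r + u \<in> E" using \<open>bad u\<close> by (auto simp: bad_def)
    then have "r + (s + u) \<in> E" using up[OF that(2) r(3)] by (simp add: ac_simps)
    then show ?thesis using r by (auto simp: bad_def)
  qed
  have bad_cancel: "bad u" if "bad (s + u)" "s \<in> exps" "mon s \<notin> q" for u s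
  proof -
    obtain r where r: "r \<in> exps" "mon r \<notin> q" "r + (s + u) \<in> E" using \<open>bad (s + u)\<close> by (auto simp: bad_def)
    have "mon (r + s) = mon r * (mon s :: ('v, 'k) vpoly)" by (simp add: mult_single)
    then have "mon (r + s) \<notin> q" using prime_mult[OF q, of "mon r" "mon s"] r that by auto
    then show ?thesis using r that by (auto simp: bad_def add.assoc intro!: bexI[of _ "r + s"])
  qed
  \<comment> \<open>The variables that send \<open>u\<close> into the ideal locally at
    \<open>q\<close>: the candidate for \<open>A\<close>.\<close>
  define W where "W u = {v \<in> V. bad (single v 1 + u)}" for u
  let ?G = "\<lambda>u. u \<in> exps \<and> \<not> bad u"
  have "mon s \<in> q" if "s \<in> E" for s using sub that mon_mem_monideal by blast
  then have G0: "?G 0" by (auto simp: bad_def)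
  have "card (W w) \<le> card V" for w
    by (rule card_mono[OF finite_V]) (auto simp: W_def)
  then have "\<exists>u. ?G u \<and> (\<forall>w. ?G w \<longrightarrow> card (W w) \<le> card (W u))"
    by (intro ex_has_greatest_nat[of ?G, OF G0, where b = "Suc (card V)"]) (simp add: less_Suc_eq_le)
  then obtain u where u: "?G u" and max: "\<And>w. ?G w \<Longrightarrow> card (W w) \<le> card (W u)" by metis
  have finW: "finite (W w)" for w using finite_V by (simp add: W_def)
  \<comment> \<open>Multiplication by a variable outside \<open>W u\<close> gives a monomial that is
    not bad, and it cannot enlarge \<open>W\<close> since \<open>W u\<close> has maximal size. So
    the argument can be repeated along a whole monomial.\<close>
  have good: "\<not> bad (w + u)" if "w \<in> exps" "keys w \<inter> W u = {}" for w
    using that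
  proof (induction w rule: exps_induct)
    case zero
    then show ?case using u by simp
  next
    case (step t v)
    then have "\<not> bad (t + u)" "v \<notin> W u" by (auto simp: keys_add_nat)
    have "bad (single v 1 + (t + u))" if "bad (single v 1 + u)" for v
      using bad_up[OF that step(1)] by (simp only: add.left_commute[of t])
    then have "W u \<subseteq> W (t + u)" unfolding W_def by blast
    moreover have "card (W (t + u)) \<le> card (W u)" using \<open>\<not> bad (t + u)\<close> u step(1) by (intro max) auto
    ultimately have "W u = W (t + u)" using card_seteq[OF finW] by blast
    then have "v \<notin> W (t + u)" using \<open>v \<notin> W u\<close> by simp
    then show ?case using step(2) by (simp add: W_def add.assoc)
  qed
  have "\<forall>v\<in>W u. \<exists>s. s \<in> exps \<and> mon s \<notin> q \<and> s + (single v 1 + u) \<in> E" by (auto simp: W_def bad_def)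
  then obtain s where s: "\<And>v. v \<in> W u \<Longrightarrow> s v \<in> exps \<and> mon (s v) \<notin> q \<and> s v + (single v 1 + u) \<in> E"
    by metis
  \<comment> \<open>One multiplier for all variables of \<open>W u\<close>: outside \<open>q\<close>
    by primality, and a multiple of each \<open>s v\<close>. It turns membership in the localized
    ideal into membership in the ideal itself.\<close>
  define t where "t = (\<Sum>v\<in>W u. s v)"
  have sum: "(\<Sum>v\<in>X. s v) \<in> exps \<and> mon (\<Sum>v\<in>X. s v) \<notin> q" if "finite X" "X \<subseteq> W u" for X
    using that
  proof (induction X rule: finite_induct)
    case empty
    then show ?case using prime_one[OF q] by simp
  next
    case (insert v X)
    have "mon (s v + sum s X) = mon (s v) * (mon (sum s X) :: ('v, 'k) vpoly)" by (simp add: mult_single)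
    then show ?case using insert prime_mult[OF q, of "mon (s v)" "mon (sum s X)"] s[of v] by auto
  qed
  have t: "t \<in> exps" "mon t \<notin> q" using sum[of "W u"] finW by (auto simp: t_def)
  have ts: "\<exists>r\<in>exps. t = r + s v" if "v \<in> W u" for v
  proof
    show "t = (\<Sum>v\<in>W u - {v}. s v) + s v"
      using sum.remove[OF finW that, of s] by (simp add: t_def add.commute)
    show "(\<Sum>v\<in>W u - {v}. s v) \<in> exps" using sum[of "W u - {v}"] finW by auto
  qed
  let ?u = "t + u"
  have uE: "?u \<in> exps" using t u by simp
  have gu: "\<not> bad ?u" using bad_cancel[of t u] t u by auto
  have "colon ?I (mon ?u) = var_ideal (W u)"
  proof (intro equalityI subsetI)
    fix f assume f: "f \<in> colon ?I (mon ?u)"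
    then have fC: "f \<in> C" and "keys (mon ?u * f) \<subseteq> E" by (auto simp: colon_def monideal_def mult.commute)
    then have fE: "\<And>r. r \<in> keys f \<Longrightarrow> ?u + r \<in> E" by (auto simp: keys_mon_mult)
    have "keys r \<inter> W u \<noteq> {}" if r: "r \<in> keys f" for r
    proof
      assume "keys r \<inter> W u = {}"
      then have "\<not> bad (r + u)" using good[of r] r fC by (auto simp: mem_C)
      moreover have "t + (r + u) \<in> E" using fE[OF r] by (simp add: ac_simps)
      ultimately show False using t by (auto simp: bad_def)
    qed
    then show "f \<in> var_ideal (W u)" using fC by (simp add: mem_var_ideal)
  next
    fix f assume f: "f \<in> var_ideal (W u)"
    have "?u + r \<in> E" if r: "r \<in> keys f" for r
    proof -
      obtain v where v: "v \<in> keys r" "v \<in> W u" using f r by (auto simp: mem_var_ideal)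
      have rE: "r \<in> exps" using f r by (auto simp: mem_var_ideal mem_C)
      obtain a where a: "a \<in> exps" "t = a + s v" using ts[OF v(2)] by blast
      have "(a + (r - single v 1)) + (s v + (single v 1 + u)) \<in> E"
        using a exps_split[OF v(1) rE] s[OF v(2)] by (intro up[OF exps_add]) simp_all
      also have "(a + (r - single v 1)) + (s v + (single v 1 + u)) = ?u + (single v 1 + (r - single v 1))"
        by (simp only: a(2) ac_simps)
      also have "\<dots> = ?u + r" by (simp only: mon_split[OF v(1)])
      finally show ?thesis .
    qed
    then have "mon ?u * f \<in> ?I" by (auto simp: monideal_def keys_mon_mult)
    then show "f \<in> colon ?I (mon ?u)" using f by (auto simp: colon_def mult.commute mem_var_ideal)
  qed
  then have ass: "var_ideal (W u) \<in> assoc_primes ?I"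
    using var_ideal_prime uE by (auto simp: assoc_primes_def intro!: bexI[of _ "mon ?u"])
  \<comment> \<open>A monomial outside \<open>q\<close> in the annihilator would witness that
    \<open>?u\<close> is bad.\<close>
  moreover have "var_ideal (W u) \<subseteq> q"
  proof
    fix f assume f: "f \<in> var_ideal (W u)"
    show "f \<in> q"
    proof (rule ccontr)
      assume "f \<notin> q"
      then obtain r where r: "r \<in> keys f" "mon r \<notin> q"
        using ideal_terms[OF qI, of f] f by (auto simp: mem_var_ideal)
      have rE: "r \<in> exps" using f r by (auto simp: mem_var_ideal mem_C)
      have "mon r \<in> colon ?I (mon ?u)"
        using f r rE \<open>colon ?I (mon ?u) = var_ideal (W u)\<close> by (auto simp: mon_mem_var_ideal mem_var_ideal)
      then have "r + ?u \<in> E" by (auto simp: colon_def mult_single)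
      then show False using gu r rE by (auto simp: bad_def)
    qed
  qed
  ultimately show ?thesis by (intro exI[of _ "W u"]) (auto simp: W_def)
qed

end

section \<open>Chains of primes in a polynomial ring\<close>

lemma pow_growth:
  fixes a b E :: nat
  assumes "\<And>d. d ^ a \<le> (d * E + 1) ^ b"
  shows "a \<le> b"
proof (rule ccontr)
  assume "\<not> a \<le> b"
  then have ab: "Suc b \<le> a" by simp
  \<comment> \<open>Just above (E + 1)^b, so that d^(b+1) exceeds (d (E + 1))^b.\<close>
  define d where "d = Suc (Suc E ^ b)"
  have d: "1 \<le> d" by (simp add: d_def)
  have "d * d ^ b \<le> d ^ a" using power_increasing[OF ab d] by simp
  also have "\<dots> \<le> (d * E + 1) ^ b" by (rule assms)
  also have "\<dots> \<le> (d * Suc E) ^ b" using d by (intro power_mono) auto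
  also have "\<dots> = Suc E ^ b * d ^ b" by (simp only: power_mult_distrib mult.commute)
  finally have "d \<le> Suc E ^ b" using d by simp
  then show False by (simp add: d_def)
qed

section \<open>Linear independence modulo a prime and counting of monomials\<close>

context monomial_ring
begin

text \<open>For an ideal \<open>p\<close>: linear independence over K of the images of the family in
  C/p. The scalar c is the constant polynomial \<open>single 0 c\<close>.\<close>

definition indep :: "('v, 'k) vpoly set \<Rightarrow> 'i set \<Rightarrow> ('i \<Rightarrow> ('v, 'k) vpoly) \<Rightarrow> bool" where
  "indep p X \<phi> \<longleftrightarrow> (\<forall>a. (\<Sum>x\<in>X. single 0 (a x) * \<phi> x) \<in> p \<longrightarrow> (\<forall>x\<in>X. a x = 0))"

lemma indepD:
  assumes "indep p X \<phi>" "(\<Sum>x\<in>X. single 0 (a x) * \<phi> x) \<in> p" shows "\<forall>x\<in>X. a x = 0"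
  using assms(1)[unfolded indep_def, THEN spec[of _ a]] assms(2) by blast

text \<open>The bound is on each exponent separately rather than on the total degree: then w
  variables admit exactly (D + 1)^w monomials, and bounds add up in products.\<close>

definition bounded_exps :: "nat \<Rightarrow> ('v, 'k) vpoly set" where
  "bounded_exps D = {f \<in> C. \<forall>t\<in>keys f. \<forall>v. lookup t v \<le> D}"

lemma bounded_exps_mult:
  assumes "f \<in> bounded_exps D" "g \<in> bounded_exps D'"
  shows "f * g \<in> bounded_exps (D + D')"
  unfolding bounded_exps_def
proof (intro CollectI conjI ballI allI)
  show "f * g \<in> C" using assms by (simp add: bounded_exps_def)
  fix t v assume "t \<in> keys (f * g)"
  then obtain a b where ab: "t = a + b" "a \<in> keys f" "b \<in> keys g" using keys_mult[of f g] by blast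
  then have "lookup a v \<le> D" "lookup b v \<le> D'" using assms by (auto simp: bounded_exps_def)
  then show "lookup t v \<le> D + D'" by (simp add: ab lookup_add)
qed

lemma bounded_exps_one: "1 \<in> bounded_exps D"
  by (simp add: bounded_exps_def)

lemma bounded_exps_power: "f \<in> bounded_exps D \<Longrightarrow> f ^ k \<in> bounded_exps (k * D)"
  by (induction k) (use bounded_exps_one bounded_exps_mult in auto)

lemma bounded_exps_mono: "D \<le> D' \<Longrightarrow> bounded_exps D \<subseteq> bounded_exps D'"
  by (auto simp: bounded_exps_def intro: order_trans)

lemma bounded_exps_exists: assumes "f \<in> C" shows "\<exists>D. f \<in> bounded_exps D"
proof -
  let ?D = "\<Sum>t\<in>keys f. \<Sum>v\<in>V. lookup t v"
  have "lookup t v \<le> ?D" if t: "t \<in> keys f" for t v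
  proof (cases "v \<in> V")
    case True
    have "lookup t v \<le> (\<Sum>v\<in>V. lookup t v)" by (rule member_le_sum[OF True _ finite_V]) simp
    also have "\<dots> \<le> ?D" by (rule member_le_sum[OF t]) simp_all
    finally show ?thesis .
  next
    case False
    then have "v \<notin> keys t" using assms t by (auto simp: mem_C exps_def)
    then show ?thesis by (simp add: in_keys_iff)
  qed
  then show ?thesis using assms by (auto simp: bounded_exps_def)
qed

text \<open>Write a relation as a sum of G_k f^k in \<open>p\<close> and let m be the least index
  with a nonzero coefficient. As \<open>f\<close> is not in the prime \<open>p\<close>, f^m can be
  cancelled; modulo \<open>q\<close>, which contains \<open>f\<close>, only G_m survives, and
  independence modulo \<open>q\<close> kills its coefficients.\<close>

lemma indep_step:
  assumes p: "is_prime p" and q: "is_prime q" and pq: "p \<subseteq> q" and f: "f \<in> q" "f \<notin> p"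
    and X: "finite X" "\<And>x. x \<in> X \<Longrightarrow> \<phi> x \<in> C" "indep q X \<phi>"
  shows "indep p (X \<times> {..<d}) (\<lambda>(x, k). \<phi> x * f ^ k)"
  unfolding indep_def
proof (intro allI impI, rule ccontr)
  fix a :: "_ \<times> nat \<Rightarrow> 'k"
  assume sum: "(\<Sum>x\<in>X \<times> {..<d}. single 0 (a x) * (case x of (x, k) \<Rightarrow> \<phi> x * f ^ k)) \<in> p"
  assume nz: "\<not> (\<forall>x\<in>X \<times> {..<d}. a x = 0)"
  have fC: "f \<in> C" by (rule prime_sub[OF q f(1)])
  define G where "G k = (\<Sum>x\<in>X. single 0 (a (x, k)) * \<phi> x)" for k
  have GC: "G k \<in> C" for k
    unfolding G_def by (rule ideal_sum[OF ideal_carrier]) (simp add: X)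
  have "(\<Sum>x\<in>X \<times> {..<d}. single 0 (a x) * (case x of (x, k) \<Rightarrow> \<phi> x * f ^ k))
      = (\<Sum>x\<in>X. \<Sum>k<d. single 0 (a (x, k)) * (\<phi> x * f ^ k))"
    unfolding sum.cartesian_product by (intro sum.cong) auto
  also have "\<dots> = (\<Sum>k<d. \<Sum>x\<in>X. single 0 (a (x, k)) * (\<phi> x * f ^ k))" by (rule sum.swap)
  also have "\<dots> = (\<Sum>k<d. G k * f ^ k)"
    by (simp add: G_def sum_distrib_right mult.assoc)
  finally have Gp: "(\<Sum>k<d. G k * f ^ k) \<in> p" using sum by simp
  let ?P = "\<lambda>k. k < d \<and> (\<exists>x\<in>X. a (x, k) \<noteq> 0)"
  have "\<exists>k. ?P k" using nz by auto
  define m where "m = (LEAST k. ?P k)"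
  have m: "?P m" unfolding m_def using \<open>\<exists>k. ?P k\<close> by (rule LeastI_ex)
  have "G k = 0" if "k < m" for k
  proof -
    have "\<not> ?P k" using not_less_Least that unfolding m_def by blast
    moreover have "k < d" using m that by simp
    ultimately show ?thesis by (simp add: G_def)
  qed
  then have "(\<Sum>k<d. G k * f ^ k) = (\<Sum>k\<in>{m..<d}. G k * f ^ k)"
    by (intro sum.mono_neutral_right) auto
  also have "\<dots> = G m * f ^ m + (\<Sum>k\<in>{Suc m..<d}. G k * f ^ k)"
    using m by (simp add: sum.atLeast_Suc_lessThan)
  also have "(\<Sum>k\<in>{Suc m..<d}. G k * f ^ k) = f ^ m * (f * (\<Sum>k\<in>{Suc m..<d}. G k * f ^ (k - Suc m)))"
  proof -
    have "G k * f ^ k = f ^ m * (f * (G k * f ^ (k - Suc m)))" if "k \<in> {Suc m..<d}" for k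
    proof -
      have "f ^ k = f ^ (m + Suc (k - Suc m))" using that by simp
      then show ?thesis by (simp only: power_add power_Suc ac_simps)
    qed
    then show ?thesis unfolding sum_distrib_left by (rule sum.cong[OF refl])
  qed
  also have "G m * f ^ m + f ^ m * (f * (\<Sum>k\<in>{Suc m..<d}. G k * f ^ (k - Suc m)))
    = f ^ m * (G m + f * (\<Sum>k\<in>{Suc m..<d}. G k * f ^ (k - Suc m)))" by (simp only: distrib_left mult.commute)
  finally have eq: "f ^ m * (G m + f * (\<Sum>k\<in>{Suc m..<d}. G k * f ^ (k - Suc m))) \<in> p" (is "f ^ m * (G m + f * ?H) \<in> p")
    using Gp by simp
  have HC: "?H \<in> C" by (rule ideal_sum[OF ideal_carrier]) (simp add: GC fC)
  have "f ^ m \<notin> p" using prime_power[OF p fC] f by blast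
  then have "G m + f * ?H \<in> p" using prime_mult[OF p _ _ eq] GC HC fC by blast
  then have "G m + f * ?H \<in> q" using pq by blast
  moreover have "f * ?H \<in> q" by (rule ideal_mult'[OF prime_ideal[OF q] HC f(1)])
  ultimately have "G m \<in> q" using ideal_diff[OF prime_ideal[OF q], of "G m + f * ?H" "f * ?H"] by simp
  then have "\<forall>x\<in>X. a (x, m) = 0"
    unfolding G_def by (rule indepD[OF X(3), of "\<lambda>x. a (x, m)"])
  with m show False by blast
qed

lemma indep_reindex:
  assumes "indep p X \<phi>" "bij_betw h Y X"
  shows "indep p Y (\<phi> \<circ> h)"
  unfolding indep_def
proof (intro allI impI)
  fix a assume a: "(\<Sum>y\<in>Y. single 0 (a y) * (\<phi> \<circ> h) y) \<in> p"
  let ?b = "\<lambda>x. a (the_inv_into Y h x)"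
  have inj: "inj_on h Y" and im: "h ` Y = X" using assms(2) by (auto simp: bij_betw_def)
  have "(\<Sum>x\<in>X. single 0 (?b x) * \<phi> x) = (\<Sum>y\<in>Y. single 0 (a y) * (\<phi> \<circ> h) y)"
    unfolding im[symmetric] by (subst sum.reindex[OF inj]) (simp add: the_inv_into_f_f[OF inj])
  then have "(\<Sum>x\<in>X. single 0 (?b x) * \<phi> x) \<in> p" using a by simp
  then have "\<forall>x\<in>X. ?b x = 0" by (rule indepD[OF assms(1), of ?b])
  then show "\<forall>y\<in>Y. a y = 0" using im the_inv_into_f_f[OF inj] by force
qed

text \<open>The family consists of the products of the powers below \<open>d\<close> of elements
  f_1, ..., f_l taken from the successive differences of the chain. Essential is that
  \<open>E\<close> does not depend on \<open>d\<close>: there are \<open>d ^ l\<close> products, but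
  their exponents grow only linearly in \<open>d\<close>.\<close>

lemma indep_chain:
  "chain l c \<Longrightarrow> \<exists>E. \<forall>d. \<exists>\<phi>. (\<forall>x<d ^ l. \<phi> x \<in> bounded_exps (d * E)) \<and> indep (c 0) {..<d ^ l} \<phi>"
proof (induction l arbitrary: c)
  case 0
  then have p: "is_prime (c 0)" by (simp add: chain_def)
  have "indep (c 0) {..<Suc 0} (\<lambda>_. 1)"
    unfolding indep_def
  proof (intro allI impI ballI)
    fix a x assume a: "(\<Sum>x<Suc 0. single 0 (a x) * 1) \<in> c 0" and x: "x \<in> {..<Suc 0}"
    show "a x = 0"
    proof (rule ccontr)
      assume "a x \<noteq> 0"
      then have "single 0 (inverse (a 0)) * single 0 (a 0) = (1 :: ('v, 'k) vpoly)"
        using x by (simp add: mult_single)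
      moreover have "single 0 (inverse (a 0)) * single 0 (a 0) \<in> c 0"
        using a by (intro ideal_mult[OF prime_ideal[OF p]]) simp_all
      ultimately show False using prime_one[OF p] by simp
    qed
  qed
  then show ?case using bounded_exps_one by (intro exI[of _ 0] allI exI[of _ "\<lambda>_. 1"]) simp
next
  case (Suc l)
  have pq: "is_prime (c 0)" "is_prime (c 1)" "c 0 \<subset> c 1" using Suc(2) by (auto simp: chain_def)
  then obtain f where f: "f \<in> c 1" "f \<notin> c 0" by blast
  have "chain l (\<lambda>i. c (Suc i))" using Suc(2) by (auto simp: chain_def)
  then obtain E where E: "\<And>d. \<exists>\<phi>. (\<forall>x<d ^ l. \<phi> x \<in> bounded_exps (d * E)) \<and> indep (c 1) {..<d ^ l} \<phi>"
    using Suc(1)[of "\<lambda>i. c (Suc i)"] by auto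
  have fC: "f \<in> C" by (rule prime_sub[OF pq(2) f(1)])
  obtain D where D: "f \<in> bounded_exps D" using bounded_exps_exists[OF fC] by blast
  have "\<exists>\<psi>. (\<forall>x<d ^ Suc l. \<psi> x \<in> bounded_exps (d * (E + D))) \<and> indep (c 0) {..<d ^ Suc l} \<psi>" for d
  proof -
    obtain \<phi> where \<phi>: "\<And>x. x < d ^ l \<Longrightarrow> \<phi> x \<in> bounded_exps (d * E)" "indep (c 1) {..<d ^ l} \<phi>"
      using E[of d] by blast
    let ?\<psi> = "\<lambda>(x, k). \<phi> x * f ^ k"
    have ind: "indep (c 0) ({..<d ^ l} \<times> {..<d}) ?\<psi>"
      by (rule indep_step[OF pq(1,2) _ f]) (use pq \<phi> in \<open>auto simp: bounded_exps_def\<close>)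
    have card: "card {..<d ^ Suc l} = card ({..<d ^ l} \<times> {..<d})" by (simp add: card_cartesian_product)
    obtain h where h: "bij_betw h {..<d ^ Suc l} ({..<d ^ l} \<times> {..<d})"
      using finite_same_card_bij[OF _ _ card] by auto
    have "?\<psi> y \<in> bounded_exps (d * (E + D))" if yy: "y \<in> {..<d ^ l} \<times> {..<d}" for y
    proof -
      obtain x k where y: "y = (x, k)" "x < d ^ l" "k < d" using yy by auto
      have "\<phi> x * f ^ k \<in> bounded_exps (d * E + k * D)"
        by (intro bounded_exps_mult bounded_exps_power \<phi> y D)
      moreover have "d * E + k * D \<le> d * (E + D)" using y(3) by (simp add: distrib_left)
      ultimately show ?thesis using bounded_exps_mono y by auto
    qed
    then have "\<forall>x<d ^ Suc l. (?\<psi> \<circ> h) x \<in> bounded_exps (d * (E + D))"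
      using bij_betwE[OF h] by simp
    moreover have "indep (c 0) {..<d ^ Suc l} (?\<psi> \<circ> h)" by (rule indep_reindex[OF ind h])
    ultimately show ?thesis by blast
  qed
  then show ?case by blast
qed

sublocale vs: vector_space "\<lambda>c f. single 0 c * f :: ('v, 'k) vpoly"
  by unfold_locales (simp_all add: distrib_left distrib_right single_add mult_single mult.assoc[symmetric])

lemma bounded_exps_card:
  assumes "finite W"
  shows "finite {t. keys t \<subseteq> W \<and> (\<forall>v. lookup t v \<le> D)}" (is "finite ?T")
    "card {t. keys t \<subseteq> W \<and> (\<forall>v. lookup t v \<le> D)} \<le> (D + 1) ^ card W"
proof -
  let ?r = "\<lambda>t. restrict (lookup t) W"
  have inj: "inj_on ?r ?T"
  proof (rule inj_onI)
    fix s t assume st: "s \<in> ?T" "t \<in> ?T" "?r s = ?r t"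
    have "lookup s v = lookup t v" for v
    proof (cases "v \<in> W")
      case True then show ?thesis using st(3) by (metis restrict_apply')
    next
      case False then have "v \<notin> keys s" "v \<notin> keys t" using st by auto
      then show ?thesis by (simp add: in_keys_iff)
    qed
    then show "s = t" by (rule poly_mapping_eqI)
  qed
  have sub: "?r ` ?T \<subseteq> Pi\<^sub>E W (\<lambda>_. {..D})" by auto
  have fin: "finite (Pi\<^sub>E W (\<lambda>_. {..D}))" using assms by (auto intro: finite_PiE)
  show "finite ?T" by (rule inj_on_finite[OF inj sub fin])
  show "card ?T \<le> (D + 1) ^ card W"
    using card_inj_on_le[OF inj sub fin] by (simp add: card_PiE assms)
qed

text \<open>Dropping the variables of \<open>B\<close> changes the family only by elements of
  \<open>p\<close>, so it stays independent, and now lies in the span of the monomials in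
  \<open>V - B\<close> with exponents at most \<open>D\<close>.\<close>

lemma indep_card_le:
  assumes p: "is_ideal p" "var_ideal B \<subseteq> p" and X: "finite X" "\<And>x. x \<in> X \<Longrightarrow> \<phi> x \<in> bounded_exps D" "indep p X \<phi>"
  shows "card X \<le> (D + 1) ^ card (V - B)"
proof -
  let ?\<psi> = "\<lambda>x. drop_vars B (\<phi> x)"
  have \<phi>C: "\<phi> x \<in> C" if "x \<in> X" for x using X(2)[OF that] by (simp add: bounded_exps_def)
  have zero: "\<forall>x\<in>X. a x = 0" if "(\<Sum>x\<in>X. single 0 (a x) * ?\<psi> x) = 0" for a
  proof -
    have "(\<Sum>x\<in>X. single 0 (a x) * \<phi> x) = (\<Sum>x\<in>X. single 0 (a x) * (\<phi> x - ?\<psi> x))"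
      using that by (simp add: right_diff_distrib sum_subtractf)
    also have "\<dots> \<in> p"
      using p(2) drop_vars_diff[OF \<phi>C] by (intro ideal_sum[OF p(1)] ideal_mult[OF p(1)]) auto
    finally show ?thesis using X(3) unfolding indep_def by blast
  qed
  have inj: "inj_on ?\<psi> X"
  proof (rule inj_onI, rule ccontr)
    fix x y assume xy: "x \<in> X" "y \<in> X" "?\<psi> x = ?\<psi> y" "x \<noteq> y"
    let ?a = "\<lambda>z. if z = x then 1 else if z = y then -1 else 0 :: 'k"
    have "(\<Sum>z\<in>X. single 0 (?a z) * ?\<psi> z) = (\<Sum>z\<in>{x, y}. single 0 (?a z) * ?\<psi> z)"
      using xy X(1) by (intro sum.mono_neutral_right) auto
    also have "\<dots> = 0" using xy by (simp add: single_uminus)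
    finally have "?a x = 0" using zero[of ?a] xy(1) by blast
    then show False by simp
  qed
  have ind: "vs.independent (?\<psi> ` X)"
  proof (rule vs.independent_if_scalars_zero)
    show "finite (?\<psi> ` X)" using X by simp
    fix b y assume b: "(\<Sum>y\<in>?\<psi> ` X. single 0 (b y) * y) = 0" and "y \<in> ?\<psi> ` X"
    then obtain x where x: "x \<in> X" "y = ?\<psi> x" by blast
    have "(\<Sum>x\<in>X. single 0 (b (?\<psi> x)) * ?\<psi> x) = 0"
      using b by (subst (asm) sum.reindex[OF inj]) simp
    then have "\<forall>x\<in>X. b (?\<psi> x) = 0" by (rule zero)
    then show "b y = 0" using x by simp
  qed
  let ?T = "{t. keys t \<subseteq> V - B \<and> (\<forall>v. lookup t v \<le> D)}"
  have T: "finite ?T" "card ?T \<le> (D + 1) ^ card (V - B)"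
    using bounded_exps_card[of "V - B" D] finite_V by simp_all
  have "?\<psi> x \<in> vs.span (mon ` ?T)" if x: "x \<in> X" for x
  proof -
    have "single t (lookup (?\<psi> x) t) \<in> vs.span (mon ` ?T)" if t: "t \<in> keys (?\<psi> x)" for t
    proof -
      have "t \<in> ?T" using t X(2)[OF x] \<phi>C[OF x] by (auto simp: keys_drop_vars bounded_exps_def mem_C exps_def)
      then have "single 0 (lookup (?\<psi> x) t) * mon t \<in> vs.span (mon ` ?T)"
        by (intro vs.span_scale vs.span_base) blast
      then show ?thesis by (simp add: mult_single)
    qed
    then have "(\<Sum>t\<in>keys (?\<psi> x). single t (lookup (?\<psi> x) t)) \<in> vs.span (mon ` ?T)" by (rule vs.span_sum)
    then show ?thesis by (simp only: poly_expand)
  qed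
  then have "?\<psi> ` X \<subseteq> vs.span (mon ` ?T)" by blast
  then have "card (?\<psi> ` X) \<le> card (mon ` ?T :: ('v, 'k) vpoly set)"
    using vs.independent_span_bound[OF _ ind] T by blast
  also have "\<dots> \<le> card ?T" by (rule card_image_le[OF T(1)])
  finally show ?thesis using T(2) by (simp add: card_image[OF inj])
qed

text \<open>For every \<open>d\<close> there are \<open>d ^ l\<close> independent elements in a
  space of dimension at most \<open>(d * E + 1) ^ card (V - B)\<close>, and the growth in
  \<open>d\<close> decides.\<close>

theorem chain_length_le:
  assumes c: "chain l c" and B: "var_ideal B \<subseteq> c 0"
  shows "l \<le> card (V - B)"
proof -
  obtain E where E: "\<And>d. \<exists>\<phi>. (\<forall>x<d ^ l. \<phi> x \<in> bounded_exps (d * E)) \<and> indep (c 0) {..<d ^ l} \<phi>"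
    using indep_chain[OF c] by blast
  have "d ^ l \<le> (d * E + 1) ^ card (V - B)" for d
  proof -
    obtain \<phi> where \<phi>: "\<And>x. x < d ^ l \<Longrightarrow> \<phi> x \<in> bounded_exps (d * E)" "indep (c 0) {..<d ^ l} \<phi>"
      using E[of d] by blast
    have "is_ideal (c 0)" using c prime_ideal by (simp add: chain_def)
    from indep_card_le[OF this B _ _ \<phi>(2)] show ?thesis using \<phi>(1) by simp
  qed
  then show ?thesis by (rule pow_growth)
qed

section \<open>Chains between ideals generated by variables\<close>

lemma var_ideal_psubset: "A \<subset> B \<Longrightarrow> B \<subseteq> V \<Longrightarrow> var_ideal A \<subset> var_ideal B"
proof -
  assume AB: "A \<subset> B" "B \<subseteq> V"
  then obtain v where v: "v \<in> B" "v \<notin> A" by blast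
  have "single v 1 \<in> exps" using v AB by (auto simp: exps_def)
  then have "mon (single v 1) \<in> var_ideal B" "mon (single v 1) \<notin> var_ideal A"
    using v by (auto simp: mon_mem_var_ideal)
  then show ?thesis using var_ideal_mono[of A B] AB by blast
qed

lemma var_chain_exists:
  assumes "A \<subseteq> B" "B \<subseteq> V"
  shows "\<exists>c. chain (card (B - A)) c \<and> c 0 = var_ideal A \<and> c (card (B - A)) = var_ideal B"
proof -
  have "finite (B - A)" using assms finite_V finite_subset by blast
  then show ?thesis using assms
  proof (induction "B - A" arbitrary: B rule: finite_induct)
    case empty
    then have "B = A" by blast
    then show ?case using var_ideal_prime by (intro exI[of _ "\<lambda>_. var_ideal A"]) (simp add: chain_def)
  next
    case (insert v F)
    let ?B = "B - {v}" and ?l = "card F"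
    have "v \<in> B" "v \<notin> A" using insert.hyps(4) by blast+
    then have F: "F = ?B - A" "A \<subseteq> ?B" "?B \<subseteq> V"
      using insert.hyps(2,4) insert.prems by blast+
    obtain c where c: "chain ?l c" "c 0 = var_ideal A" "c ?l = var_ideal ?B"
      using insert(3)[OF F] F by auto
    have l: "card (B - A) = Suc ?l" using insert by (metis card_insert_disjoint)
    let ?c = "\<lambda>i. if i \<le> ?l then c i else var_ideal B"
    have "var_ideal ?B \<subset> var_ideal B" using insert(4,6) by (intro var_ideal_psubset) auto
    then have "chain (Suc ?l) ?c"
      using c var_ideal_prime by (auto simp: chain_def le_Suc_eq less_Suc_eq)
    then show ?case unfolding l using c by (intro exI[of _ ?c]) auto
  qed
qed

text \<open>The inclusion \<open>c l \<subseteq> e 0\<close> may be an equality, so the joined chain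
  leaves out \<open>e 0\<close> and steps from \<open>c l\<close> to \<open>e 1\<close>; this keeps
  the length at \<open>l + k\<close>.\<close>

lemma chain_append:
  assumes c: "chain l c" and e: "chain k e" and sub: "c l \<subseteq> e 0"
  shows "\<exists>c'. chain (l + k) c' \<and> c' 0 = c 0"
proof (cases "k = 0")
  case True
  then show ?thesis using c by auto
next
  case False
  let ?c = "\<lambda>i. if i \<le> l then c i else e (i - l)"
  have "chain (l + k) ?c"
    unfolding chain_def
  proof (intro conjI allI impI)
    fix i assume "i \<le> l + k"
    then show "is_prime (?c i)" using c e by (auto simp: chain_def)
  next
    fix i assume i: "i < l + k"
    consider "i < l" | "i = l" | "i > l" by linarith
    then show "?c i \<subset> ?c (Suc i)"
    proof cases
      case 2
      have "e 0 \<subset> e (Suc 0)" using e False by (simp add: chain_def)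
      then show ?thesis using 2 sub by auto
    next
      case 3
      then have "e (i - l) \<subset> e (Suc (i - l))" using e i by (simp add: chain_def)
      then show ?thesis using 3 by (simp add: Suc_diff_le)
    qed (use c in \<open>auto simp: chain_def\<close>)
  qed
  then show ?thesis by (intro exI[of _ ?c]) simp
qed

text \<open>Prolonged from \<open>var_ideal B\<close> to \<open>var_ideal V\<close>, the chain gains
  \<open>card (V - B)\<close> steps, while \<open>card (V - A)\<close> bounds the total.\<close>

theorem chain_between_le:
  assumes c: "chain l c" and AB: "var_ideal A \<subseteq> c 0" "c l \<subseteq> var_ideal B" "A \<subseteq> B" "B \<subseteq> V"
  shows "l \<le> card (B - A)"
proof -
  obtain e where e: "chain (card (V - B)) e" "e 0 = var_ideal B" using var_chain_exists[OF AB(4)] by blast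
  obtain c' where "chain (l + card (V - B)) c'" "c' 0 = c 0" using chain_append[OF c e(1)] AB(2) e(2) by auto
  then have le: "l + card (V - B) \<le> card (V - A)" using chain_length_le AB(1) by metis
  have "finite B" using AB(4) finite_V finite_subset by blast
  then have "card (V - A) = card (V - B) + card (B - A)"
    using finite_V AB(3,4) by (subst card_Un_disjoint[symmetric]) (auto intro!: arg_cong[of _ _ card])
  with le show ?thesis by simp
qed

end

section \<open>Localization\<close>

locale module_localization = module R M for R and M (structure) +
  fixes U
  assumes U_sub: "U \<subseteq> carrier R" and U_one: "\<one>\<^bsub>R\<^esub> \<in> U"
    and U_mult: "s \<in> U \<Longrightarrow> t \<in> U \<Longrightarrow> s \<otimes>\<^bsub>R\<^esub> t \<in> U"
begin

abbreviation "L \<equiv> localization R M U"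
abbreviation "frc \<equiv> fraction R M U"

lemma U_carrier [simp]: "s \<in> U \<Longrightarrow> s \<in> carrier R"
  using U_sub by blast

lemma smult_smult: "a \<in> carrier R \<Longrightarrow> b \<in> carrier R \<Longrightarrow> x \<in> carrier M \<Longrightarrow>
    a \<odot> (b \<odot> x) = (a \<otimes>\<^bsub>R\<^esub> b) \<odot> x"
  by (simp add: smult_assoc1)

definition frac_rel :: "'c \<Rightarrow> 'a \<Rightarrow> 'c \<Rightarrow> 'a \<Rightarrow> bool" where
  "frac_rel x s y t \<longleftrightarrow> (\<exists>u\<in>U. (u \<otimes>\<^bsub>R\<^esub> t) \<odot> x = (u \<otimes>\<^bsub>R\<^esub> s) \<odot> y)"

lemma frac_rel_refl: "frac_rel x s x s"
  using U_one by (auto simp: frac_rel_def)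

lemma frac_rel_sym: "frac_rel x s y t \<Longrightarrow> frac_rel y t x s"
  unfolding frac_rel_def by (metis)

lemma frac_rel_trans:
  assumes "frac_rel x s y t" "frac_rel y t z r" and c: "x \<in> carrier M" "y \<in> carrier M" "z \<in> carrier M"
    "s \<in> U" "t \<in> U" "r \<in> U"
  shows "frac_rel x s z r"
proof -
  obtain u where u: "u \<in> U" "(u \<otimes>\<^bsub>R\<^esub> t) \<odot> x = (u \<otimes>\<^bsub>R\<^esub> s) \<odot> y" using assms by (auto simp: frac_rel_def)
  obtain v where v: "v \<in> U" "(v \<otimes>\<^bsub>R\<^esub> r) \<odot> y = (v \<otimes>\<^bsub>R\<^esub> t) \<odot> z" using assms by (auto simp: frac_rel_def)
  have R: "u \<in> carrier R" "v \<in> carrier R" "s \<in> carrier R" "t \<in> carrier R" "r \<in> carrier R" using u v c by auto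
  have "((u \<otimes>\<^bsub>R\<^esub> v \<otimes>\<^bsub>R\<^esub> t) \<otimes>\<^bsub>R\<^esub> r) \<odot> x = (v \<otimes>\<^bsub>R\<^esub> r) \<odot> ((u \<otimes>\<^bsub>R\<^esub> t) \<odot> x)"
    using R c by (simp add: smult_smult R.m_ac)
  also have "\<dots> = (u \<otimes>\<^bsub>R\<^esub> s) \<odot> ((v \<otimes>\<^bsub>R\<^esub> r) \<odot> y)"
    unfolding u(2) using R c by (simp add: smult_smult R.m_ac)
  also have "\<dots> = ((u \<otimes>\<^bsub>R\<^esub> v \<otimes>\<^bsub>R\<^esub> t) \<otimes>\<^bsub>R\<^esub> s) \<odot> z"
    unfolding v(2) using R c by (simp add: smult_smult R.m_ac)
  finally show ?thesis using u v c U_mult by (auto simp: frac_rel_def)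
qed

lemma mem_frac: "(y, t) \<in> frc x s \<longleftrightarrow> y \<in> carrier M \<and> t \<in> U \<and> frac_rel x s y t"
  by (auto simp: fraction_def frac_rel_def)

lemma frac_self: "x \<in> carrier M \<Longrightarrow> s \<in> U \<Longrightarrow> (x, s) \<in> frc x s"
  by (simp add: mem_frac frac_rel_refl)

lemma frac_eq:
  assumes c: "x \<in> carrier M" "y \<in> carrier M" "s \<in> U" "t \<in> U"
  shows "frc x s = frc y t \<longleftrightarrow> frac_rel x s y t"
proof
  assume "frc x s = frc y t"
  then have "(y, t) \<in> frc x s" using frac_self[OF c(2,4)] by simp
  then show "frac_rel x s y t" by (simp add: mem_frac)
next
  assume r: "frac_rel x s y t"
  show "frc x s = frc y t"
  proof (intro equalityI subsetI; clarify)
    fix z r assume "(z, r) \<in> frc x s"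
    then show "(z, r) \<in> frc y t" using c frac_rel_trans[OF frac_rel_sym[OF r], of z r] by (simp add: mem_frac)
  next
    fix z r assume "(z, r) \<in> frc y t"
    then show "(z, r) \<in> frc x s" using c frac_rel_trans[OF \<open>frac_rel x s y t\<close>, of z r] by (simp add: mem_frac)
  qed
qed

lemma frac_cancel:
  assumes "x \<in> carrier M" "s \<in> U" "t \<in> U"
  shows "frc (t \<odot> x) (t \<otimes>\<^bsub>R\<^esub> s) = frc x s"
  using assms U_mult U_one
  by (subst frac_eq) (auto simp: frac_rel_def smult_smult R.m_ac intro!: bexI[of _ "\<one>\<^bsub>R\<^esub>"])

text \<open>The operations of \<open>localization\<close> are unions over representatives; a union
  of equal sets over a nonempty class is its value at any one of them.\<close>

lemma frac_cong_UN:
  assumes "x \<in> carrier M" "s \<in> U" "\<And>y t. y \<in> carrier M \<Longrightarrow> t \<in> U \<Longrightarrow> frac_rel x s y t \<Longrightarrow> F y t = F x s"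
  shows "(\<Union>(y, t)\<in>frc x s. F y t) = F x s"
proof -
  have "F y t = F x s" if "(y, t) \<in> frc x s" for y t using assms(3)[of y t] that by (simp add: mem_frac)
  then show ?thesis using frac_self[OF assms(1,2)] by fast
qed

lemma frac_cong_UN2:
  assumes x: "x \<in> carrier M" "s \<in> U" and y: "y \<in> carrier M" "t \<in> U"
    and F: "\<And>x' s' y' t'. \<lbrakk>x' \<in> carrier M; s' \<in> U; y' \<in> carrier M; t' \<in> U;
      frac_rel x s x' s'; frac_rel y t y' t'\<rbrakk> \<Longrightarrow> F x' s' y' t' = F x s y t"
  shows "(\<Union>(x', s')\<in>frc x s. \<Union>(y', t')\<in>frc y t. F x' s' y' t') = F x s y t"
proof -
  have inner: "(\<Union>(y', t')\<in>frc y t. F x' s' y' t') = F x s y t"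
    if x': "x' \<in> carrier M" "s' \<in> U" "frac_rel x s x' s'" for x' s'
  proof -
    have "(\<Union>(y', t')\<in>frc y t. F x' s' y' t') = F x' s' y t"
      by (rule frac_cong_UN[OF y]) (use F[OF x'(1,2) _ _ x'(3)] frac_rel_refl y in metis)
    also have "\<dots> = F x s y t" by (rule F[OF x'(1,2) y x'(3) frac_rel_refl])
    finally show ?thesis .
  qed
  have "(\<Union>(x', s')\<in>frc x s. \<Union>(y', t')\<in>frc y t. F x' s' y' t') = (\<Union>(y', t')\<in>frc y t. F x s y' t')"
    by (rule frac_cong_UN[OF x]) (simp add: inner inner[OF x frac_rel_refl])
  then show ?thesis by (simp add: inner[OF x frac_rel_refl])
qed

lemma carrier_L: "carrier L = {frc x s | x s. x \<in> carrier M \<and> s \<in> U}"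
  by (simp add: localization_def)

lemma L_cases:
  assumes "X \<in> carrier L" obtains x s where "x \<in> carrier M" "s \<in> U" "X = frc x s"
  using assms by (auto simp: carrier_L)

lemma frac_closed: "x \<in> carrier M \<Longrightarrow> s \<in> U \<Longrightarrow> frc x s \<in> carrier L"
  by (auto simp: carrier_L)

lemma zero_L: "\<zero>\<^bsub>L\<^esub> = frc \<zero> \<one>\<^bsub>R\<^esub>"
  by (simp add: localization_def)

lemma frac_rel_add:
  assumes r: "frac_rel x s x' s'" "frac_rel y t y' t'"
    and c: "x \<in> carrier M" "y \<in> carrier M" "x' \<in> carrier M" "y' \<in> carrier M" "s \<in> U" "t \<in> U" "s' \<in> U" "t' \<in> U"
  shows "frac_rel ((t \<odot> x) \<oplus> (s \<odot> y)) (s \<otimes>\<^bsub>R\<^esub> t) ((t' \<odot> x') \<oplus> (s' \<odot> y')) (s' \<otimes>\<^bsub>R\<^esub> t')"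
proof -
  obtain u where u: "u \<in> U" "(u \<otimes>\<^bsub>R\<^esub> s') \<odot> x = (u \<otimes>\<^bsub>R\<^esub> s) \<odot> x'" using r by (auto simp: frac_rel_def)
  obtain v where v: "v \<in> U" "(v \<otimes>\<^bsub>R\<^esub> t') \<odot> y = (v \<otimes>\<^bsub>R\<^esub> t) \<odot> y'" using r by (auto simp: frac_rel_def)
  have R: "u \<in> carrier R" "v \<in> carrier R" "s \<in> carrier R" "t \<in> carrier R" "s' \<in> carrier R" "t' \<in> carrier R"
    using u v c by auto
  let ?w = "u \<otimes>\<^bsub>R\<^esub> v"
  have "(?w \<otimes>\<^bsub>R\<^esub> (s' \<otimes>\<^bsub>R\<^esub> t')) \<odot> ((t \<odot> x) \<oplus> (s \<odot> y))
    = (v \<otimes>\<^bsub>R\<^esub> t' \<otimes>\<^bsub>R\<^esub> t) \<odot> ((u \<otimes>\<^bsub>R\<^esub> s') \<odot> x) \<oplus> (u \<otimes>\<^bsub>R\<^esub> s' \<otimes>\<^bsub>R\<^esub> s) \<odot> ((v \<otimes>\<^bsub>R\<^esub> t') \<odot> y)"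
    using R c by (simp add: smult_r_distr smult_smult R.m_ac)
  also have "\<dots> = (?w \<otimes>\<^bsub>R\<^esub> (s \<otimes>\<^bsub>R\<^esub> t)) \<odot> ((t' \<odot> x') \<oplus> (s' \<odot> y'))"
    unfolding u(2) v(2) using R c by (simp add: smult_r_distr smult_smult R.m_ac)
  finally show ?thesis using u v U_mult by (auto simp: frac_rel_def)
qed

lemma add_L:
  assumes c: "x \<in> carrier M" "y \<in> carrier M" "s \<in> U" "t \<in> U"
  shows "frc x s \<oplus>\<^bsub>L\<^esub> frc y t = frc ((t \<odot> x) \<oplus> (s \<odot> y)) (s \<otimes>\<^bsub>R\<^esub> t)"
proof -
  have "(\<Union>(x', s')\<in>frc x s. \<Union>(y', t')\<in>frc y t. frc ((t' \<odot> x') \<oplus> (s' \<odot> y')) (s' \<otimes>\<^bsub>R\<^esub> t'))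
      = frc ((t \<odot> x) \<oplus> (s \<odot> y)) (s \<otimes>\<^bsub>R\<^esub> t)"
    by (rule frac_cong_UN2[OF c(1,3,2,4)], rule frac_eq[THEN iffD2, OF _ _ _ _ frac_rel_sym[OF frac_rel_add]])
      (use c U_mult in simp_all)
  then show ?thesis by (simp add: localization_def)
qed

lemma zero_eq_frac: "s \<in> U \<Longrightarrow> frc \<zero> s = \<zero>\<^bsub>L\<^esub>"
  unfolding zero_L using U_one by (subst frac_eq) (auto simp: frac_rel_def intro!: bexI[of _ "\<one>\<^bsub>R\<^esub>"])

lemma minus_frac:
  assumes "x \<in> carrier M" "s \<in> U"
  shows "frc (\<ominus> x) s \<oplus>\<^bsub>L\<^esub> frc x s = \<zero>\<^bsub>L\<^esub>"
proof -
  have "s \<odot> (\<ominus> x) \<oplus> s \<odot> x = s \<odot> (\<ominus> x \<oplus> x)"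
    using assms by (intro smult_r_distr[symmetric]) auto
  also have "\<dots> = \<zero>" using assms by (simp add: M.l_neg)
  finally show ?thesis
    using add_L[of "\<ominus> x" x s s] zero_eq_frac[OF U_mult[OF assms(2) assms(2)]] assms by simp
qed

lemma abelian_group_L: "abelian_group L"
proof (rule abelian_groupI)
  fix X Y assume XY: "X \<in> carrier L" "Y \<in> carrier L"
  then obtain x s y t where *: "X = frc x s" "Y = frc y t" "x \<in> carrier M" "y \<in> carrier M" "s \<in> U" "t \<in> U"
    by (metis L_cases)
  then show "X \<oplus>\<^bsub>L\<^esub> Y \<in> carrier L" using U_mult by (auto simp: add_L intro!: frac_closed)
  show "X \<oplus>\<^bsub>L\<^esub> Y = Y \<oplus>\<^bsub>L\<^esub> X" using * by (simp add: add_L M.add.m_comm R.m_comm)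
  fix Z assume "Z \<in> carrier L"
  then obtain z r where z: "Z = frc z r" "z \<in> carrier M" "r \<in> U" by (metis L_cases)
  show "X \<oplus>\<^bsub>L\<^esub> Y \<oplus>\<^bsub>L\<^esub> Z = X \<oplus>\<^bsub>L\<^esub> (Y \<oplus>\<^bsub>L\<^esub> Z)"
    using * z U_mult by (simp add: add_L smult_r_distr smult_smult M.add.m_assoc R.m_ac)
next
  show "\<zero>\<^bsub>L\<^esub> \<in> carrier L" unfolding zero_L by (intro frac_closed U_one) simp
next
  fix X assume "X \<in> carrier L"
  then obtain x s where *: "X = frc x s" "x \<in> carrier M" "s \<in> U" by (metis L_cases)
  then show "\<zero>\<^bsub>L\<^esub> \<oplus>\<^bsub>L\<^esub> X = X" unfolding zero_L using U_one by (simp add: add_L)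
  show "\<exists>Y\<in>carrier L. Y \<oplus>\<^bsub>L\<^esub> X = \<zero>\<^bsub>L\<^esub>"
    unfolding * using * minus_frac frac_closed by (intro bexI[of _ "frc (\<ominus> x) s"]) auto
qed

sublocale L: abelian_group L by (rule abelian_group_L)

lemma a_inv_frac: "x \<in> carrier M \<Longrightarrow> s \<in> U \<Longrightarrow> \<ominus>\<^bsub>L\<^esub> frc x s = frc (\<ominus> x) s"
  using L.minus_equality[OF minus_frac frac_closed frac_closed] by simp

lemma frac_eq_zero:
  assumes "x \<in> carrier M" "s \<in> U"
  shows "frc x s = \<zero>\<^bsub>L\<^esub> \<longleftrightarrow> (\<exists>u\<in>U. u \<odot> x = \<zero>)"
  unfolding zero_L using assms U_one by (subst frac_eq) (auto simp: frac_rel_def)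

lemma trivial_L:
  assumes "u \<in> U" "\<And>x. x \<in> carrier M \<Longrightarrow> u \<odot> x = \<zero>"
  shows "carrier L = {\<zero>\<^bsub>L\<^esub>}"
proof -
  have "X = \<zero>\<^bsub>L\<^esub>" if "X \<in> carrier L" for X
    using that assms by (elim L_cases) (auto simp: frac_eq_zero)
  then show ?thesis using L.zero_closed by blast
qed

end

section \<open>Localization of a commutative ring\<close>

lemma module_self: assumes "cring R" shows "module R (self_module R)"
proof -
  interpret cring R by fact
  have "abelian_group (self_module R)"
    by (rule abelian_groupI) (auto simp: ring_as_module_def a_assoc intro: a_comm l_neg)
  then show ?thesis
    by (intro moduleI) (auto simp: ring_as_module_def cring_axioms l_distr r_distr m_assoc)
qed

locale ring_localization = R?: cring R for R (structure) +
  fixes U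
  assumes U_sub: "U \<subseteq> carrier R" and U_one: "\<one> \<in> U"
    and U_mult: "s \<in> U \<Longrightarrow> t \<in> U \<Longrightarrow> s \<otimes> t \<in> U"
begin

sublocale module_localization R "self_module R" U
  by (intro module_localization.intro module_self module_localization_axioms.intro R.cring_axioms)
     (use U_sub U_one U_mult in auto)

lemma self_simps: "carrier (self_module R) = carrier R" "\<zero>\<^bsub>self_module R\<^esub> = \<zero>" "\<one>\<^bsub>self_module R\<^esub> = \<one>"
  "add (self_module R) = add R" "mult (self_module R) = mult R" "smult (self_module R) = mult R"
  by (simp_all add: ring_as_module_def)

lemma one_L: "\<one>\<^bsub>L\<^esub> = frc \<one> \<one>"
  by (simp add: localization_def self_simps)

lemma frac_rel_mult:
  assumes r: "frac_rel x s x' s'" "frac_rel y t y' t'"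
    and c: "x \<in> carrier R" "y \<in> carrier R" "x' \<in> carrier R" "y' \<in> carrier R" "s \<in> U" "t \<in> U" "s' \<in> U" "t' \<in> U"
  shows "frac_rel (x \<otimes> y) (s \<otimes> t) (x' \<otimes> y') (s' \<otimes> t')"
proof -
  obtain u where u: "u \<in> U" "(u \<otimes> s') \<otimes> x = (u \<otimes> s) \<otimes> x'" using r by (auto simp: frac_rel_def self_simps)
  obtain v where v: "v \<in> U" "(v \<otimes> t') \<otimes> y = (v \<otimes> t) \<otimes> y'" using r by (auto simp: frac_rel_def self_simps)
  have R: "u \<in> carrier R" "v \<in> carrier R" "s \<in> carrier R" "t \<in> carrier R" "s' \<in> carrier R" "t' \<in> carrier R"
    using u v c U_sub by auto
  have "((u \<otimes> v) \<otimes> (s' \<otimes> t')) \<otimes> (x \<otimes> y) = ((u \<otimes> s') \<otimes> x) \<otimes> ((v \<otimes> t') \<otimes> y)"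
    using R c by (simp add: R.m_ac)
  also have "\<dots> = ((u \<otimes> v) \<otimes> (s \<otimes> t)) \<otimes> (x' \<otimes> y')"
    unfolding u(2) v(2) using R c by (simp add: R.m_ac)
  finally show ?thesis using u v U_mult by (auto simp: frac_rel_def self_simps)
qed

lemma mult_L:
  assumes c: "x \<in> carrier R" "y \<in> carrier R" "s \<in> U" "t \<in> U"
  shows "frc x s \<otimes>\<^bsub>L\<^esub> frc y t = frc (x \<otimes> y) (s \<otimes> t)"
proof -
  note c' = c[folded self_simps(1)]
  have "(\<Union>(x', s')\<in>frc x s. \<Union>(y', t')\<in>frc y t. frc (x' \<otimes> y') (s' \<otimes> t')) = frc (x \<otimes> y) (s \<otimes> t)"
    by (rule frac_cong_UN2[OF c'(1,3,2,4)], rule frac_eq[THEN iffD2, OF _ _ _ _ frac_rel_sym[OF frac_rel_mult]])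
      (use c U_mult in \<open>simp_all add: self_simps\<close>)
  then show ?thesis by (simp add: localization_def self_simps)
qed

lemma ring_L_cases:
  assumes "X \<in> carrier L" obtains x s where "x \<in> carrier R" "s \<in> U" "X = frc x s"
  using assms by (auto simp: carrier_L self_simps)

lemma ring_add_L:
  "x \<in> carrier R \<Longrightarrow> y \<in> carrier R \<Longrightarrow> s \<in> U \<Longrightarrow> t \<in> U \<Longrightarrow>
    frc x s \<oplus>\<^bsub>L\<^esub> frc y t = frc ((t \<otimes> x) \<oplus> (s \<otimes> y)) (s \<otimes> t)"
  using add_L[of x y s t] by (simp add: self_simps)

lemma ring_frac_closed: "x \<in> carrier R \<Longrightarrow> s \<in> U \<Longrightarrow> frc x s \<in> carrier L"
  by (simp add: frac_closed self_simps)

lemma ring_frac_eq: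
  assumes "x \<in> carrier R" "y \<in> carrier R" "s \<in> U" "t \<in> U"
  shows "frc x s = frc y t \<longleftrightarrow> (\<exists>u\<in>U. (u \<otimes> t) \<otimes> x = (u \<otimes> s) \<otimes> y)"
  using assms frac_eq[of x y s t] by (simp add: self_simps frac_rel_def)

lemma cring_L: "cring L"
proof (rule cringI)
  show "abelian_group L" by (rule abelian_group_L)
  show "comm_monoid L"
  proof (rule comm_monoidI)
    show "\<one>\<^bsub>L\<^esub> \<in> carrier L" unfolding one_L by (intro ring_frac_closed U_one) simp
  next
    fix X Y assume "X \<in> carrier L" "Y \<in> carrier L"
    then obtain x s y t where *: "X = frc x s" "Y = frc y t" "x \<in> carrier R" "y \<in> carrier R" "s \<in> U" "t \<in> U"
      by (metis ring_L_cases)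
    then show "X \<otimes>\<^bsub>L\<^esub> Y \<in> carrier L" using U_mult by (auto simp: mult_L intro!: ring_frac_closed)
    show "X \<otimes>\<^bsub>L\<^esub> Y = Y \<otimes>\<^bsub>L\<^esub> X" using * by (simp add: mult_L R.m_comm)
    fix Z assume "Z \<in> carrier L"
    then obtain z r where z: "Z = frc z r" "z \<in> carrier R" "r \<in> U" by (metis ring_L_cases)
    show "X \<otimes>\<^bsub>L\<^esub> Y \<otimes>\<^bsub>L\<^esub> Z = X \<otimes>\<^bsub>L\<^esub> (Y \<otimes>\<^bsub>L\<^esub> Z)"
      using * z U_mult by (simp add: mult_L R.m_assoc)
  next
    fix X assume "X \<in> carrier L"
    then obtain x s where *: "X = frc x s" "x \<in> carrier R" "s \<in> U" by (metis ring_L_cases)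
    then show "\<one>\<^bsub>L\<^esub> \<otimes>\<^bsub>L\<^esub> X = X" unfolding one_L using U_one by (simp add: mult_L)
  qed
next
  fix X Y Z assume "X \<in> carrier L" "Y \<in> carrier L" "Z \<in> carrier L"
  then obtain x s y t z r where *: "X = frc x s" "Y = frc y t" "Z = frc z r"
    "x \<in> carrier R" "y \<in> carrier R" "s \<in> U" "t \<in> U" "z \<in> carrier R" "r \<in> U"
    by (metis ring_L_cases)
  have l: "(X \<oplus>\<^bsub>L\<^esub> Y) \<otimes>\<^bsub>L\<^esub> Z = frc (((t \<otimes> x) \<oplus> (s \<otimes> y)) \<otimes> z) (s \<otimes> t \<otimes> r)"
    using * U_mult by (simp add: mult_L ring_add_L)
  have "X \<otimes>\<^bsub>L\<^esub> Z \<oplus>\<^bsub>L\<^esub> Y \<otimes>\<^bsub>L\<^esub> Z = frc ((t \<otimes> r) \<otimes> (x \<otimes> z) \<oplus> (s \<otimes> r) \<otimes> (y \<otimes> z)) ((s \<otimes> r) \<otimes> (t \<otimes> r))"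
    using * U_mult by (simp add: mult_L ring_add_L)
  \<comment> \<open>The two sides of distributivity differ by a factor \<open>r\<close> in numerator
    and denominator, which is split off here and cancelled next.\<close>
  also have "\<dots> = frc (r \<otimes> (((t \<otimes> x) \<oplus> (s \<otimes> y)) \<otimes> z)) (r \<otimes> (s \<otimes> t \<otimes> r))"
    using * by (simp add: R.l_distr R.r_distr R.m_ac)
  also have "\<dots> = frc (((t \<otimes> x) \<oplus> (s \<otimes> y)) \<otimes> z) (s \<otimes> t \<otimes> r)"
    using frac_cancel[of "((t \<otimes> x) \<oplus> (s \<otimes> y)) \<otimes> z" "s \<otimes> t \<otimes> r" r] * U_mult by (simp add: self_simps)
  finally show "(X \<oplus>\<^bsub>L\<^esub> Y) \<otimes>\<^bsub>L\<^esub> Z = X \<otimes>\<^bsub>L\<^esub> Z \<oplus>\<^bsub>L\<^esub> Y \<otimes>\<^bsub>L\<^esub> Z" using l by simp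
qed

end

section \<open>Quotient rings and cyclic modules\<close>

context comm_subring
begin

text \<open>The bridge to the record-based algebra of the statement: the polynomial ring there is an
  instance of this record.\<close>

definition sring :: "'a ring" where
  "sring = \<lparr>carrier = C, monoid.mult = (*), one = 1, zero = 0, add = (+)\<rparr>"

lemma sring_simps [simp]:
  "carrier sring = C" "mult sring = (*)" "\<one>\<^bsub>sring\<^esub> = 1" "\<zero>\<^bsub>sring\<^esub> = 0" "add sring = (+)"
  by (simp_all add: sring_def)

lemma cring_sring: "cring sring"
proof (rule cringI)
  show "abelian_group sring"
  proof (rule abelian_groupI)
    fix x assume "x \<in> carrier sring"
    then show "\<exists>y\<in>carrier sring. y \<oplus>\<^bsub>sring\<^esub> x = \<zero>\<^bsub>sring\<^esub>" by (intro bexI[of _ "- x"]) auto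
  qed (auto simp: add.assoc add.commute)
  show "comm_monoid sring" by (rule comm_monoidI) (auto simp: mult.assoc mult.commute)
qed (auto simp: distrib_right)

sublocale sr: cring sring by (rule cring_sring)

lemma sring_minus [simp]: "x \<in> C \<Longrightarrow> \<ominus>\<^bsub>sring\<^esub> x = - x"
  by (rule sr.minus_equality) auto

lemma sring_pow [simp]: "x [^]\<^bsub>sring\<^esub> (k :: nat) = x ^ k"
  by (induction k) (auto simp: mult.commute)

lemma sring_finprod: "(\<And>i. i \<in> A \<Longrightarrow> f i \<in> C) \<Longrightarrow> finprod sring f A = prod f A"
  by (induction A rule: infinite_finite_induct) (auto simp: sr.finprod_insert Pi_def)

lemma ideal_iff: "ideal J sring \<longleftrightarrow> is_ideal J"
proof
  assume "ideal J sring"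
  then interpret ideal J sring .
  show "is_ideal J"
    unfolding is_ideal_def using a_subset additive_subgroup.zero_closed[OF is_additive_subgroup] a_closed I_l_closed by auto
next
  assume J: "is_ideal J"
  show "ideal J sring"
  proof (rule idealI)
    show "ring sring" by (rule sr.ring_axioms)
    show "subgroup J (add_monoid sring)"
    proof (rule sr.add.subgroupI)
      fix x assume x: "x \<in> J"
      then have "x \<in> C" using J ideal_sub by blast
      then show "\<ominus>\<^bsub>sring\<^esub> x \<in> J" using ideal_uminus[OF J x] by simp
    qed (use J ideal_zero in \<open>auto intro: ideal_sub ideal_add\<close>)
  qed (use J in \<open>auto intro: ideal_mult ideal_mult'\<close>)
qed

lemma primeideal_iff: "primeideal p sring \<longleftrightarrow> is_prime p"
proof
  assume "primeideal p sring"
  then interpret primeideal p sring .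
  show "is_prime p"
    unfolding is_prime_def using ideal_iff ideal_axioms I_notcarr I_prime by auto
next
  assume p: "is_prime p"
  then show "primeideal p sring"
    by (intro primeidealI) (auto simp: ideal_iff cring_sring is_prime_def)
qed

lemma genideal_subset_iff: "S \<subseteq> C \<Longrightarrow> is_ideal J \<Longrightarrow> Idl\<^bsub>sring\<^esub> S \<subseteq> J \<longleftrightarrow> S \<subseteq> J"
  using sr.genideal_self[of S] sr.genideal_minimal[of J S] by (auto simp: ideal_iff)

lemma genideal_ideal: "S \<subseteq> C \<Longrightarrow> is_ideal (Idl\<^bsub>sring\<^esub> S)"
  using sr.genideal_ideal[of S] by (simp add: ideal_iff)

lemma genideal_sup: "S \<subseteq> C \<Longrightarrow> S \<subseteq> Idl\<^bsub>sring\<^esub> S"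
  using sr.genideal_self[of S] by simp

section \<open>The quotient ring and the cyclic module C/I\<close>

definition coset :: "'a set \<Rightarrow> 'a \<Rightarrow> 'a set" where
  "coset I a = (\<lambda>i. i + a) ` I"

lemma r_coset_eq: "I +>\<^bsub>sring\<^esub> a = coset I a"
  by (auto simp: a_r_coset_def' coset_def)

context
  fixes I assumes I: "is_ideal I"
begin

interpretation Id: ideal I sring using I by (simp add: ideal_iff)

lemma coset_eq: "a \<in> C \<Longrightarrow> b \<in> C \<Longrightarrow> coset I a = coset I b \<longleftrightarrow> a - b \<in> I"
proof
  assume "coset I a = coset I b"
  then have "0 + a \<in> coset I b" using ideal_zero[OF I] by (auto simp: coset_def)
  then show "a - b \<in> I" by (auto simp: coset_def)
next
  have *: "coset I a \<subseteq> coset I b" if "a - b \<in> I" for a b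
  proof
    fix z assume "z \<in> coset I a"
    then obtain i where i: "i \<in> I" "z = i + a" by (auto simp: coset_def)
    then have "z = (i + (a - b)) + b" "i + (a - b) \<in> I" using ideal_add[OF I] that by auto
    then show "z \<in> coset I b" unfolding coset_def by (rule image_eqI)
  qed
  assume "a - b \<in> I"
  moreover from this have "b - a \<in> I" using ideal_uminus[OF I, of "a - b"] by simp
  ultimately show "coset I a = coset I b" using * by blast
qed

lemma coset_zero: "coset I 0 = I"
  by (auto simp: coset_def)

lemma carrier_Quot: "carrier (sring Quot I) = coset I ` C"
  by (auto simp: FactRing_def A_RCOSETS_def' r_coset_eq)

lemma mult_Quot: "a \<in> C \<Longrightarrow> b \<in> C \<Longrightarrow> coset I a \<otimes>\<^bsub>sring Quot I\<^esub> coset I b = coset I (a * b)"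
  using Id.rcoset_mult_add[of a b] by (simp add: FactRing_def r_coset_eq)

lemma add_Quot: "a \<in> C \<Longrightarrow> b \<in> C \<Longrightarrow> coset I a \<oplus>\<^bsub>sring Quot I\<^esub> coset I b = coset I (a + b)"
  using Id.a_rcos_sum[of a b] by (simp add: FactRing_def r_coset_eq)

lemma zero_Quot: "\<zero>\<^bsub>sring Quot I\<^esub> = coset I 0"
  by (simp add: FactRing_def coset_zero)

lemma one_Quot: "\<one>\<^bsub>sring Quot I\<^esub> = coset I 1"
  by (simp add: FactRing_def r_coset_eq)

lemma cring_Quot: "cring (sring Quot I)"
  by (rule Id.quotient_is_cring[OF cring_sring])

abbreviation "QM \<equiv> quotient_module sring I"

lemma QM_simps:
  "carrier QM = coset I ` C" "\<zero>\<^bsub>QM\<^esub> = coset I 0"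
  "r \<in> C \<Longrightarrow> a \<in> C \<Longrightarrow> r \<odot>\<^bsub>QM\<^esub> coset I a = coset I (r * a)"
  "a \<in> C \<Longrightarrow> b \<in> C \<Longrightarrow> coset I a \<oplus>\<^bsub>QM\<^esub> coset I b = coset I (a + b)"
  by (simp_all add: quotient_module_def ring_as_module_def carrier_Quot zero_Quot r_coset_eq mult_Quot add_Quot)

lemma module_QM: "module sring QM"
proof (rule moduleI)
  interpret Q: cring "sring Quot I" by (rule cring_Quot)
  show "abelian_group QM"
  proof (rule abelian_groupI)
    fix X assume "X \<in> carrier QM"
    then obtain a where a: "a \<in> C" "X = coset I a" by (auto simp: QM_simps)
    then show "\<exists>Y\<in>carrier QM. Y \<oplus>\<^bsub>QM\<^esub> X = \<zero>\<^bsub>QM\<^esub>"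
      by (intro bexI[of _ "coset I (- a)"]) (simp_all add: QM_simps)
  qed (auto simp: QM_simps ac_simps)
qed (auto simp: QM_simps cring_sring algebra_simps)

lemma annihilator_eq: "z \<in> C \<Longrightarrow> annihilator sring QM (coset I z) = colon I z"
  using coset_eq[of "_ * z" 0] by (simp add: annihilator_def QM_simps colon_def cong: conj_cong)

lemma Ass_eq: "Ass sring QM = assoc_primes I"
  unfolding Ass_def assoc_primes_def primeideal_iff QM_simps using annihilator_eq by blast

lemma coset_mem_image: "is_ideal J \<Longrightarrow> I \<subseteq> J \<Longrightarrow> a \<in> C \<Longrightarrow> coset I a \<in> coset I ` J \<longleftrightarrow> a \<in> J"
proof
  assume J: "is_ideal J" "I \<subseteq> J" and a: "a \<in> C" and "coset I a \<in> coset I ` J"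
  then obtain b where b: "b \<in> J" "coset I a = coset I b" by blast
  then have "a - b \<in> J" using coset_eq[of a b] a J ideal_sub by blast
  then show "a \<in> J" using ideal_diff_iff J b by blast
qed auto

lemma coset_image_subset: "is_ideal J \<Longrightarrow> is_ideal K \<Longrightarrow> I \<subseteq> K \<Longrightarrow> coset I ` J \<subseteq> coset I ` K \<longleftrightarrow> J \<subseteq> K"
  using coset_mem_image[of K] ideal_sub[of J] by blast

lemma adjoins_Cons_rev: "set fs \<subseteq> C \<Longrightarrow> f \<in> C \<Longrightarrow> adjoins I (f # fs) = {f * a + u | a u. a \<in> C \<and> u \<in> adjoins I fs}"
  unfolding adjoins.simps adjoins_adjoin by (auto simp: adjoin_def ac_simps)

lemma seq_mult_eq: "set fs \<subseteq> C \<Longrightarrow> seq_mult QM fs = coset I ` adjoins I fs"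
proof (induction fs)
  case Nil
  have "coset I a = coset I 0" if "a \<in> I" for a using coset_eq[of a 0] that I ideal_sub by auto
  then have "coset I ` I = {coset I 0}" using ideal_zero[OF I] by blast
  then show ?case by (simp add: QM_simps)
next
  case (Cons f fs)
  then have f: "f \<in> C" "set fs \<subseteq> C" by auto
  have sub: "u \<in> C" if "u \<in> adjoins I fs" for u using ideal_sub[OF adjoins_ideal[OF I f(2)] that] .
  have "seq_mult QM (f # fs) = {coset I (f * a + u) | a u. a \<in> C \<and> u \<in> adjoins I fs}"
  proof (intro equalityI subsetI)
    fix z assume "z \<in> seq_mult QM (f # fs)"
    then obtain a u where "a \<in> C" "u \<in> adjoins I fs" "z = f \<odot>\<^bsub>QM\<^esub> coset I a \<oplus>\<^bsub>QM\<^esub> coset I u"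
      using Cons(1)[OF f(2)] by (auto simp: QM_simps(1))
    then show "z \<in> {coset I (f * a + u) | a u. a \<in> C \<and> u \<in> adjoins I fs}"
      using f sub by (auto simp: QM_simps)
  next
    fix z assume "z \<in> {coset I (f * a + u) | a u. a \<in> C \<and> u \<in> adjoins I fs}"
    then obtain a u where au: "a \<in> C" "u \<in> adjoins I fs" "z = coset I (f * a + u)" by blast
    then have "z = f \<odot>\<^bsub>QM\<^esub> coset I a \<oplus>\<^bsub>QM\<^esub> coset I u" using f sub by (simp add: QM_simps)
    moreover have "coset I u \<in> seq_mult QM fs" "coset I a \<in> carrier QM"
      using au Cons(1)[OF f(2)] by (auto simp: QM_simps(1))
    ultimately show "z \<in> seq_mult QM (f # fs)" by auto
  qed
  also have "\<dots> = coset I ` adjoins I (f # fs)"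
    unfolding adjoins_Cons_rev[OF f(2,1)] by blast
  finally show ?case .
qed

lemma regular_sequence_iff:
  assumes fs: "set fs \<subseteq> C"
  shows "regular_sequence QM fs \<longleftrightarrow> reg_seq {1} I fs \<and> adjoins I fs \<noteq> C"
proof -
  have t: "set (take i fs) \<subseteq> C" for i using fs set_take_subset[of i fs] by blast
  have J: "is_ideal (adjoins I (take i fs))" "I \<subseteq> adjoins I (take i fs)" for i
    using adjoins_ideal[OF I t] adjoins_sup by auto
  have "(\<forall>x\<in>carrier QM. (fs ! i) \<odot>\<^bsub>QM\<^esub> x \<in> seq_mult QM (take i fs) \<longrightarrow> x \<in> seq_mult QM (take i fs)) \<longleftrightarrow>
     nzd {1} (adjoins I (take i fs)) (fs ! i)" if i: "i < length fs" for i
  proof -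
    have "fs ! i \<in> C" using fs nth_mem[OF i] by blast
    then show ?thesis
      unfolding seq_mult_eq[OF t] nzd_def sat_one[OF J(1)]
      by (auto simp: QM_simps coset_mem_image[OF J])
  qed
  moreover have "seq_mult QM fs = carrier QM \<longleftrightarrow> adjoins I fs = C"
    unfolding seq_mult_eq[OF fs] QM_simps(1)
    using coset_image_subset[of C "adjoins I fs"] coset_image_subset[of "adjoins I fs" C]
      adjoins_ideal[OF I fs] adjoins_sup[of I fs] I by (auto simp: is_ideal_def)
  ultimately show ?thesis unfolding regular_sequence_def reg_seq_def by blast
qed

text \<open>In a Noetherian ring the union of a nonempty chain of ideals belongs to the chain, which
  is the hypothesis of Zorn's lemma for the images of the members of \<open>F\<close>. Ideals above
  \<open>I\<close> are recovered from their images.\<close>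

lemma noetherian_Quot_acc:
  assumes "noetherian_ring (sring Quot I)"
  shows "acc_above I"
  unfolding acc_above_def
proof (intro allI impI)
  interpret N: noetherian_ring "sring Quot I" by fact
  fix F assume F: "F \<noteq> {} \<and> (\<forall>J\<in>F. is_ideal J \<and> I \<subseteq> J)"
  let ?A = "(\<lambda>J. coset I ` J) ` F"
  have "\<exists>M\<in>?A. \<forall>X\<in>?A. M \<subseteq> X \<longrightarrow> X = M"
  proof (rule subset_Zorn_nonempty)
    show "?A \<noteq> {}" using F by blast
    fix K assume K: "K \<noteq> {}" "subset.chain ?A K"
    have "ideal (coset I ` J) (sring Quot I)" if "J \<in> F" for J
      using sr.ring_ideal_imp_quot_ideal[of I J] F that I by (simp add: ideal_iff r_coset_eq cong: image_cong)
    then have "subset.chain {J. ideal J (sring Quot I)} K"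
      using K(2) unfolding pred_on.chain_def by blast
    from N.ideal_chain_is_trivial[OF K(1) this] show "\<Union>K \<in> ?A"
      using K(2) unfolding pred_on.chain_def by blast
  qed
  then obtain N where N: "N \<in> ?A" "\<forall>X\<in>?A. N \<subseteq> X \<longrightarrow> X = N" by (rule bexE)
  then obtain M where M: "M \<in> F" "N = coset I ` M" by blast
  have "J = M" if J: "J \<in> F" "M \<subseteq> J" for J
  proof (rule equalityI[OF _ J(2)])
    have "coset I ` J = coset I ` M"
      using bspec[OF N(2) imageI[OF J(1)]] image_mono[OF J(2), of "coset I"] M(2) by simp
    moreover have "is_ideal J" "is_ideal M" "I \<subseteq> M" using F J(1) M(1) by simp_all
    ultimately show "J \<subseteq> M" using coset_image_subset[of J M] by simp
  qed
  then show "\<exists>M\<in>F. \<forall>J\<in>F. M \<subseteq> J \<longrightarrow> J = M" using M(1) by blast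
qed

end

end

section \<open>Local rings of a quotient\<close>

context comm_subring
begin

context
  fixes I q assumes I: "is_ideal I" and q: "is_prime q" and Iq: "I \<subseteq> q"
begin

abbreviation "QR \<equiv> sring Quot I"
abbreviation "qq \<equiv> coset I ` q"
abbreviation "UU \<equiv> C - q"

lemma coset_mem_qq: "a \<in> C \<Longrightarrow> coset I a \<in> qq \<longleftrightarrow> a \<in> q"
  by (rule coset_mem_image[OF I prime_ideal[OF q] Iq])

lemma primeideal_qq: "primeideal qq QR"
proof (rule primeidealI)
  show "ideal qq QR"
    using sr.ring_ideal_imp_quot_ideal[of I q] I prime_ideal[OF q] by (simp add: ideal_iff r_coset_eq cong: image_cong)
  show "cring QR" by (rule cring_Quot[OF I])
  have "coset I 1 \<in> carrier QR" "coset I 1 \<notin> qq"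
    using coset_mem_qq[of 1] prime_one[OF q] by (auto simp: carrier_Quot[OF I])
  then show "carrier QR \<noteq> qq" by blast
  fix X Y assume "X \<in> carrier QR" "Y \<in> carrier QR" and XY: "X \<otimes>\<^bsub>QR\<^esub> Y \<in> qq"
  then obtain a b where ab: "X = coset I a" "Y = coset I b" "a \<in> C" "b \<in> C" by (auto simp: carrier_Quot[OF I])
  then have "a * b \<in> q" using XY by (simp add: mult_Quot[OF I] coset_mem_qq)
  then show "X \<in> qq \<or> Y \<in> qq" using prime_mult[OF q] ab by (simp add: coset_mem_qq)
qed

lemma UU_image: "carrier QR - qq = coset I ` UU"
  using coset_mem_qq by (auto simp: carrier_Quot[OF I])

lemma ring_localization_QR: "ring_localization QR (carrier QR - qq)"
proof (intro ring_localization.intro cring_Quot[OF I] ring_localization_axioms.intro)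
  interpret primeideal qq QR by (rule primeideal_qq)
  show "\<one>\<^bsub>QR\<^esub> \<in> carrier QR - qq" using I_notcarr one_imp_carrier by auto
  fix s t assume "s \<in> carrier QR - qq" "t \<in> carrier QR - qq"
  then show "s \<otimes>\<^bsub>QR\<^esub> t \<in> carrier QR - qq" using I_prime by auto
qed auto

interpretation RL: ring_localization QR "carrier QR - qq" by (rule ring_localization_QR)

abbreviation "LL \<equiv> local_ring_at QR qq"

lemma LL_def: "LL = RL.L"
  by (simp add: local_ring_at_def)

text \<open>Fractions of the local ring of C/I at \<open>q\<close> with numerator and denominator
  lifted to \<open>C\<close>, so that their equality becomes a membership in
  \<open>I\<close>.\<close>

definition fr where "fr a s = fraction QR (self_module QR) (carrier QR - qq) (coset I a) (coset I s)"

lemma UU_C: "s \<in> UU \<Longrightarrow> s \<in> C" by simp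

lemma UU_mult: "s \<in> UU \<Longrightarrow> t \<in> UU \<Longrightarrow> s * t \<in> UU"
  using mult_set_mult[OF mult_set_compl[OF q]] .

lemma UU_one: "1 \<in> UU" using prime_one[OF q] by simp

lemma UU_coset: "s \<in> UU \<Longrightarrow> coset I s \<in> carrier QR - qq"
  unfolding UU_image by (rule imageI)

lemma C_coset: "a \<in> C \<Longrightarrow> coset I a \<in> carrier QR"
  unfolding carrier_Quot[OF I] by (rule imageI)

lemma fr_eq:
  assumes "a \<in> C" "b \<in> C" "s \<in> UU" "t \<in> UU"
  shows "fr a s = fr b t \<longleftrightarrow> (\<exists>u\<in>UU. u * t * a - u * s * b \<in> I)"
proof -
  have "fr a s = fr b t \<longleftrightarrow> (\<exists>u\<in>coset I ` UU. (u \<otimes>\<^bsub>QR\<^esub> coset I t) \<otimes>\<^bsub>QR\<^esub> coset I a = (u \<otimes>\<^bsub>QR\<^esub> coset I s) \<otimes>\<^bsub>QR\<^esub> coset I b)"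
    unfolding fr_def using RL.ring_frac_eq[OF C_coset[OF assms(1)] C_coset[OF assms(2)] UU_coset[OF assms(3)] UU_coset[OF assms(4)]]
    by (simp only: UU_image)
  also have "\<dots> \<longleftrightarrow> (\<exists>u\<in>UU. u * t * a - u * s * b \<in> I)"
    using assms by (simp add: mult_Quot[OF I] coset_eq[OF I])
  finally show ?thesis .
qed

lemma fr_cancel: "a \<in> C \<Longrightarrow> s \<in> UU \<Longrightarrow> t \<in> UU \<Longrightarrow> fr (t * a) (t * s) = fr a s"
  using UU_mult UU_one ideal_zero[OF I] by (subst fr_eq) (auto intro!: bexI[of _ 1] simp: ac_simps)

lemma carrier_LL: "carrier LL = {fr a s | a s. a \<in> C \<and> s \<in> UU}"
proof (intro equalityI subsetI)
  fix X assume "X \<in> carrier LL"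
  then obtain x s where x: "x \<in> carrier QR" "s \<in> carrier QR - qq" "X = fraction QR (self_module QR) (carrier QR - qq) x s"
    unfolding LL_def by (rule RL.ring_L_cases)
  obtain a t where "x = coset I a" "a \<in> C" "s = coset I t" "t \<in> UU"
    using x(1,2) unfolding UU_image carrier_Quot[OF I] by blast
  then show "X \<in> {fr a s | a s. a \<in> C \<and> s \<in> UU}" unfolding x(3) fr_def by blast
next
  fix X assume "X \<in> {fr a s | a s. a \<in> C \<and> s \<in> UU}"
  then obtain a s where a: "X = fr a s" "a \<in> C" "s \<in> UU" by blast
  show "X \<in> carrier LL"
    unfolding a(1) fr_def LL_def by (rule RL.ring_frac_closed[OF C_coset[OF a(2)] UU_coset[OF a(3)]])
qed

lemma LL_cases: assumes "X \<in> carrier LL" obtains a s where "X = fr a s" "a \<in> C" "s \<in> UU"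
  using assms unfolding carrier_LL by blast

lemma fr_closed: "a \<in> C \<Longrightarrow> s \<in> UU \<Longrightarrow> fr a s \<in> carrier LL"
  unfolding carrier_LL by blast

lemma fr_mult: "a \<in> C \<Longrightarrow> b \<in> C \<Longrightarrow> s \<in> UU \<Longrightarrow> t \<in> UU \<Longrightarrow> fr a s \<otimes>\<^bsub>LL\<^esub> fr b t = fr (a * b) (s * t)"
  using RL.mult_L[OF C_coset[of a] C_coset[of b] UU_coset[of s] UU_coset[of t]]
  by (simp add: LL_def fr_def mult_Quot[OF I])

lemma fr_add: "a \<in> C \<Longrightarrow> b \<in> C \<Longrightarrow> s \<in> UU \<Longrightarrow> t \<in> UU \<Longrightarrow> fr a s \<oplus>\<^bsub>LL\<^esub> fr b t = fr (t * a + s * b) (s * t)"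
  using RL.ring_add_L[OF C_coset[of a] C_coset[of b] UU_coset[of s] UU_coset[of t]]
  by (simp add: LL_def fr_def mult_Quot[OF I] add_Quot[OF I])

lemma fr_zero: "\<zero>\<^bsub>LL\<^esub> = fr 0 1"
  unfolding LL_def RL.zero_L by (simp add: fr_def RL.self_simps zero_Quot[OF I] one_Quot[OF I])

lemma fr_one: "\<one>\<^bsub>LL\<^esub> = fr 1 1"
  unfolding LL_def RL.one_L by (simp add: fr_def one_Quot[OF I])

lemma cring_LL: "cring LL" unfolding LL_def by (rule RL.cring_L)

interpretation L: cring LL by (rule cring_LL)

section \<open>Ideals and prime chains of the local ring\<close>

definition extend :: "'a set \<Rightarrow> _" where
  "extend J = {fr a s | a s. a \<in> J \<and> s \<in> UU}"

text \<open>The contraction of the extended ideal is the saturation. This is the link between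
  statements on fractions and those on \<open>sat\<close> and \<open>nzd\<close>.\<close>

lemma fr_mem_extend:
  assumes J: "is_ideal J" "I \<subseteq> J" and a: "a \<in> C" "s \<in> UU"
  shows "fr a s \<in> extend J \<longleftrightarrow> a \<in> sat UU J"
proof
  assume "fr a s \<in> extend J"
  then obtain b t where b: "b \<in> J" "t \<in> UU" "fr a s = fr b t" by (auto simp: extend_def)
  then have bC: "b \<in> C" using J ideal_sub by blast
  obtain u where u: "u \<in> UU" "u * t * a - u * s * b \<in> I" using b(3) fr_eq[OF a(1) bC a(2) b(2)] by blast
  have "u * s * b \<in> J" using u(1) a b(1) by (intro ideal_mult[OF J(1)]) auto
  moreover have "u * t * a - u * s * b \<in> J" using u J by blast
  ultimately have "u * t * a \<in> J" using ideal_diff_iff[OF J(1)] by blast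
  moreover have "u * t \<in> UU" using u b by (intro UU_mult)
  ultimately show "a \<in> sat UU J" using a by (intro satI[of "u * t"])
next
  assume "a \<in> sat UU J"
  then obtain u where u: "u \<in> UU" "u * a \<in> J" by (rule satE)
  then have "fr (u * a) (u * s) \<in> extend J" using a UU_mult by (auto simp: extend_def simp del: Diff_iff)
  then show "fr a s \<in> extend J" using fr_cancel[OF a(1,2) u(1)] by simp
qed

lemma sat_prime: "is_prime p \<Longrightarrow> p \<subseteq> q \<Longrightarrow> sat UU p = p"
  using prime_mult[of p] sat_sup[OF mult_set_compl[OF q] prime_ideal, of p]
  by (intro equalityI) (auto simp: sat_def)

lemma extend_ideal:
  assumes J: "is_ideal J" "I \<subseteq> J" shows "ideal (extend J) LL"
proof -
  note JC = ideal_sub[OF J(1)]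
  have mult: "x \<otimes>\<^bsub>LL\<^esub> a \<in> extend J" if "a \<in> extend J" "x \<in> carrier LL" for a x
  proof -
    obtain c t where x: "x = fr c t" "c \<in> C" "t \<in> UU" by (rule LL_cases[OF \<open>x \<in> carrier LL\<close>])
    obtain b s where b: "a = fr b s" "b \<in> J" "s \<in> UU"
      using \<open>a \<in> extend J\<close> unfolding extend_def by blast
    note * = b x
    then have "x \<otimes>\<^bsub>LL\<^esub> a = fr (c * b) (t * s)" using JC by (simp add: fr_mult del: Diff_iff)
    then show ?thesis using * UU_mult ideal_mult[OF J(1)] unfolding extend_def by blast
  qed
  show ?thesis
  proof (rule idealI)
    show "ring LL" by (rule L.ring_axioms)
    show "subgroup (extend J) (add_monoid LL)"
    proof (rule L.add.subgroupI)
      show "extend J \<subseteq> carrier LL" using fr_closed JC by (auto simp: extend_def simp del: Diff_iff)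
      show "extend J \<noteq> {}" using ideal_zero[OF J(1)] UU_one by (auto simp: extend_def simp del: Diff_iff)
      fix a assume a: "a \<in> extend J"
      then have aL: "a \<in> carrier LL" using fr_closed JC by (auto simp: extend_def simp del: Diff_iff)
      have "\<ominus>\<^bsub>LL\<^esub> a = (\<ominus>\<^bsub>LL\<^esub> \<one>\<^bsub>LL\<^esub>) \<otimes>\<^bsub>LL\<^esub> a" using aL L.l_minus[of "\<one>\<^bsub>LL\<^esub>" a] by simp
      then show "\<ominus>\<^bsub>LL\<^esub> a \<in> extend J" using mult[OF a] by simp
      fix b assume "b \<in> extend J"
      then obtain x s y t where *: "a = fr x s" "b = fr y t" "x \<in> J" "y \<in> J" "s \<in> UU" "t \<in> UU"
        using a unfolding extend_def by blast
      then have "a \<oplus>\<^bsub>LL\<^esub> b = fr (t * x + s * y) (s * t)" using JC by (simp add: fr_add del: Diff_iff)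
      moreover have "t * x + s * y \<in> J" using * UU_C by (intro ideal_add ideal_mult J) auto
      ultimately show "a \<oplus>\<^bsub>LL\<^esub> b \<in> extend J" using UU_mult * unfolding extend_def by blast
    qed
    fix a x assume "a \<in> extend J" "x \<in> carrier LL"
    then show "x \<otimes>\<^bsub>LL\<^esub> a \<in> extend J" by (rule mult)
    moreover have "a \<in> carrier LL" using \<open>a \<in> extend J\<close> fr_closed JC by (auto simp: extend_def simp del: Diff_iff)
    ultimately show "a \<otimes>\<^bsub>LL\<^esub> x \<in> extend J" using \<open>x \<in> carrier LL\<close> by (simp add: L.m_comm)
  qed
qed

lemma extend_prime:
  assumes p: "is_prime p" "I \<subseteq> p" "p \<subseteq> q" shows "primeideal (extend p) LL"
proof (rule primeidealI)
  note m = fr_mem_extend[OF prime_ideal[OF p(1)] p(2), unfolded sat_prime[OF p(1,3)]]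
  show "ideal (extend p) LL" by (rule extend_ideal[OF prime_ideal[OF p(1)] p(2)])
  show "cring LL" by (rule cring_LL)
  have "fr 1 1 \<notin> extend p" using m[OF one_mem UU_one] prime_one[OF p(1)] by blast
  then show "carrier LL \<noteq> extend p" using fr_closed[OF one_mem UU_one] by blast
  fix X Y assume "X \<in> carrier LL" "Y \<in> carrier LL" and XY: "X \<otimes>\<^bsub>LL\<^esub> Y \<in> extend p"
  then obtain a s b t where *: "X = fr a s" "Y = fr b t" "a \<in> C" "b \<in> C" "s \<in> UU" "t \<in> UU"
    by (metis LL_cases)
  then have "fr (a * b) (s * t) \<in> extend p" using XY by (simp add: fr_mult del: Diff_iff)
  then have "a * b \<in> p" using m[of "a * b" "s * t"] * UU_mult by simp
  then show "X \<in> extend p \<or> Y \<in> extend p" using prime_mult[OF p(1) *(3,4)] m * by blast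
qed

text \<open>Primes between \<open>I\<close> and \<open>q\<close> are saturated, so their extensions
  remain distinct primes. Only this lower bound for the dimension enters the proof.\<close>

lemma krull_dim_LL:
  assumes c: "chain l c" "I \<subseteq> c 0" "c l \<subseteq> q"
  shows "enat l \<le> krull_dim LL"
proof -
  have p: "is_prime (c i)" "I \<subseteq> c i" "c i \<subseteq> q" if "i \<le> l" for i
    using c that chain_subset[OF c(1), of 0 i] chain_subset[OF c(1), of i l] by (auto simp: chain_def)
  have "prime_chain LL l (\<lambda>i. extend (c i))"
    unfolding prime_chain_def
  proof (intro conjI allI impI)
    fix i assume "i \<le> l" then show "primeideal (extend (c i)) LL" using extend_prime p by blast
  next
    fix i assume i: "i < l"
    have s: "c i \<subset> c (Suc i)" using c i by (simp add: chain_def)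
    then obtain a where a: "a \<in> c (Suc i)" "a \<notin> c i" by blast
    have pi: "is_prime (c i)" "I \<subseteq> c i" "c i \<subseteq> q" using p[of i] i by simp_all
    have ps: "is_prime (c (Suc i))" "I \<subseteq> c (Suc i)" "c (Suc i) \<subseteq> q" using p[of "Suc i"] i by simp_all
    have aC: "a \<in> C" by (rule prime_sub[OF ps(1) a(1)])
    have "fr a 1 \<in> extend (c (Suc i))" using a(1) UU_one unfolding extend_def by blast
    moreover have "fr a 1 \<notin> extend (c i)"
      using fr_mem_extend[OF prime_ideal[OF pi(1)] pi(2) aC UU_one] sat_prime[OF pi(1,3)] a(2) by simp
    moreover have "extend (c i) \<subseteq> extend (c (Suc i))" using s unfolding extend_def by blast
    ultimately show "extend (c i) \<subset> extend (c (Suc i))" by blast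
  qed
  then show ?thesis unfolding krull_dim_def by (intro Sup_upper) blast
qed

text \<open>A fraction with numerator outside \<open>q\<close> is a unit.\<close>

lemma ideal_LL_subset:
  assumes J: "ideal J LL" "J \<noteq> carrier LL" shows "J \<subseteq> extend q"
proof
  interpret J: ideal J LL by fact
  fix X assume X: "X \<in> J"
  then obtain a s where a: "X = fr a s" "a \<in> C" "s \<in> UU" using J.a_Hcarr LL_cases by metis
  show "X \<in> extend q"
  proof (cases "a \<in> q")
    case True
    then show ?thesis using a unfolding extend_def by blast
  next
    case False
    then have aU: "a \<in> UU" using a by simp
    then have "fr s a \<otimes>\<^bsub>LL\<^esub> X = fr (s * a) (a * s)" unfolding a(1) by (intro fr_mult a UU_C)
    also have "\<dots> = \<one>\<^bsub>LL\<^esub>" unfolding fr_one using aU a UU_mult UU_one ideal_zero[OF I]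
      by (subst fr_eq) (auto intro!: bexI[of _ 1] simp: mult.commute)
    finally have "\<one>\<^bsub>LL\<^esub> \<in> J" using J.I_l_closed[OF X fr_closed[of s a]] a aU by simp
    then show ?thesis using J.one_imp_carrier J(2) by blast
  qed
qed

text \<open>\<open>depth\<close> picks the maximal ideal by a definite description, which can only
  be evaluated once uniqueness is known.\<close>

lemma maximal_LL: "(THE m. maximalideal m LL) = extend q"
proof (rule the_equality)
  have ne: "extend q \<noteq> carrier LL" "ideal (extend q) LL"
    using extend_prime[OF q Iq] by (auto simp: primeideal_def primeideal_axioms_def)
  show "maximalideal (extend q) LL"
    using ne ideal_LL_subset by (intro maximalidealI) blast+
  fix m assume m: "maximalideal m LL"
  then interpret m: maximalideal m LL .
  have "m \<subseteq> extend q" using ideal_LL_subset[OF m.ideal_axioms] m.I_notcarr by blast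
  then show "m = extend q" using m.I_maximal[OF ne(2)] ne additive_subgroup.a_subset[OF ideal.axioms(1)[OF ne(2)]] by blast
qed

section \<open>Regular sequences of the local ring\<close>

abbreviation "SM \<equiv> self_module LL"

lemma SM_simps: "carrier SM = carrier LL" "\<zero>\<^bsub>SM\<^esub> = \<zero>\<^bsub>LL\<^esub>" "add SM = add LL" "smult SM = mult LL"
  by (simp_all add: ring_as_module_def)

text \<open>Denominators are units, so the ideal generated by fractions depends on the numerators
  alone.\<close>

lemma seq_mult_LL:
  assumes "set (map fst ps) \<subseteq> C" "set (map snd ps) \<subseteq> UU"
  shows "seq_mult SM (map (\<lambda>(a, s). fr a s) ps) = extend (adjoins I (map fst ps))"
  using assms
proof (induction ps)
  case Nil
  have "fr b s = fr 0 1" if "b \<in> I" "s \<in> UU" for b s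
    using that ideal_sub[OF I] UU_one by (subst fr_eq) (auto intro!: bexI[of _ 1])
  then have "extend I = {fr 0 1}" using ideal_zero[OF I] UU_one unfolding extend_def by blast
  then show ?case by (simp add: SM_simps fr_zero)
next
  case (Cons p ps)
  obtain a s where p: "p = (a, s)" by (cases p)
  have as: "a \<in> C" "s \<in> UU" "set (map fst ps) \<subseteq> C" "set (map snd ps) \<subseteq> UU" using Cons(2,3) p by auto
  let ?as = "map fst ps"
  let ?J = "adjoins I ?as"
  have J: "is_ideal ?J" by (rule adjoins_ideal[OF I as(3)])
  have JC: "b \<in> C" if "b \<in> ?J" for b using ideal_sub[OF J that] .
  have eq: "adjoins I (a # ?as) = {a * x + b | x b. x \<in> C \<and> b \<in> ?J}" by (rule adjoins_Cons_rev[OF I as(3,1)])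
  have "seq_mult SM (map (\<lambda>(a, s). fr a s) (p # ps)) = {fr a s \<otimes>\<^bsub>LL\<^esub> X \<oplus>\<^bsub>LL\<^esub> u | X u. X \<in> carrier LL \<and> u \<in> extend ?J}"
    using Cons(1)[OF as(3,4)] by (simp add: p SM_simps)
  also have "\<dots> = extend (adjoins I (a # ?as))"
  proof (intro equalityI subsetI)
    fix z assume "z \<in> {fr a s \<otimes>\<^bsub>LL\<^esub> X \<oplus>\<^bsub>LL\<^esub> u | X u. X \<in> carrier LL \<and> u \<in> extend ?J}"
    then obtain x r b t where z: "z = fr a s \<otimes>\<^bsub>LL\<^esub> fr x r \<oplus>\<^bsub>LL\<^esub> fr b t" "x \<in> C" "r \<in> UU" "b \<in> ?J" "t \<in> UU"
      unfolding extend_def carrier_LL by blast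
    have "z = fr (t * (a * x) + (s * r) * b) (s * r * t)"
      using z as(1,2) JC[OF z(4)] UU_mult[OF as(2) z(3)] by (simp add: fr_mult fr_add del: Diff_iff)
    moreover have "t * (a * x) + (s * r) * b = a * (t * x) + (s * r) * b" by (simp add: ac_simps)
    moreover have "(s * r) * b \<in> ?J" "t * x \<in> C" using z as UU_C by (auto intro!: ideal_mult[OF J])
    moreover have "s * r * t \<in> UU" using z as by (intro UU_mult)
    ultimately show "z \<in> extend (adjoins I (a # ?as))" unfolding extend_def eq by blast
  next
    fix z assume "z \<in> extend (adjoins I (a # ?as))"
    then obtain x b t where z: "z = fr (a * x + b) t" "x \<in> C" "b \<in> ?J" "t \<in> UU" unfolding extend_def eq by blast
    have bC: "b \<in> C" using JC z by blast
    have "fr a s \<otimes>\<^bsub>LL\<^esub> fr (s * x) t \<oplus>\<^bsub>LL\<^esub> fr b t = fr (t * (a * (s * x)) + (s * t) * b) (s * t * t)"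
      using z as(1,2) bC UU_mult[OF as(2) z(4)] UU_C by (simp add: fr_mult fr_add del: Diff_iff)
    also have "\<dots> = fr ((s * t) * (a * x + b)) ((s * t) * t)" by (simp add: algebra_simps)
    also have "\<dots> = z" unfolding z(1) using z as bC UU_mult by (intro fr_cancel) auto
    finally have "z = fr a s \<otimes>\<^bsub>LL\<^esub> fr (s * x) t \<oplus>\<^bsub>LL\<^esub> fr b t" by simp
    moreover have "fr (s * x) t \<in> carrier LL" using z as by (intro fr_closed) auto
    moreover have "fr b t \<in> extend ?J" using z unfolding extend_def by blast
    ultimately show "z \<in> {fr a s \<otimes>\<^bsub>LL\<^esub> X \<oplus>\<^bsub>LL\<^esub> u | X u. X \<in> carrier LL \<and> u \<in> extend ?J}" by blast
  qed
  finally show ?case by (simp add: p)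
qed

text \<open>Passing to numerators changes each element by a unit of the local ring, and so keeps the
  length and the regularity at \<open>q\<close>.\<close>

lemma regular_sequence_LL:
  assumes fs: "set fs \<subseteq> extend q" "regular_sequence SM fs"
  shows "\<exists>gs. length gs = length fs \<and> set gs \<subseteq> q \<and> reg_seq UU I gs"
proof -
  have "\<exists>ps. fs = map (\<lambda>(a, s). fr a s) ps \<and> set (map fst ps) \<subseteq> q \<and> set (map snd ps) \<subseteq> UU"
    using fs(1)
  proof (induction fs)
    case (Cons f fs)
    then obtain ps where ps: "fs = map (\<lambda>(a, s). fr a s) ps" "set (map fst ps) \<subseteq> q" "set (map snd ps) \<subseteq> UU" by auto
    have "f \<in> extend q" using Cons(2) by simp
    then obtain a s where "f = fr a s" "a \<in> q" "s \<in> UU" unfolding extend_def by blast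
    then show ?case using ps by (intro exI[of _ "(a, s) # ps"]) auto
  qed simp
  then obtain ps where ps: "fs = map (\<lambda>(a, s). fr a s) ps" "set (map fst ps) \<subseteq> q" "set (map snd ps) \<subseteq> UU" by blast
  let ?gs = "map fst ps"
  have gC: "set ?gs \<subseteq> C" using ps(2) prime_sub[OF q] by blast
  have "nzd UU (adjoins I (take i ?gs)) (?gs ! i)" if i: "i < length ?gs" for i
    unfolding nzd_def
  proof (intro ballI impI)
    let ?J = "adjoins I (take i ?gs)"
    have ti: "set (map fst (take i ps)) \<subseteq> C" "set (map snd (take i ps)) \<subseteq> UU"
      using gC ps(3) image_mono[OF set_take_subset[of i ps], of fst] image_mono[OF set_take_subset[of i ps], of snd]
      by (simp_all only: set_map)
    have seq: "seq_mult SM (take i fs) = extend ?J"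
      using seq_mult_LL[OF ti] by (simp add: ps(1) take_map)
    have J: "is_ideal ?J" "I \<subseteq> ?J"
      using adjoins_ideal[OF I ti(1)] adjoins_sup[of I "take i ?gs"] by (simp_all only: take_map)
    fix z assume z: "z \<in> C" "?gs ! i * z \<in> sat UU ?J"
    let ?a = "?gs ! i" and ?s = "snd (ps ! i)"
    have as: "?a \<in> C" "?s \<in> UU"
      using subsetD[OF gC nth_mem[OF i]] subsetD[OF ps(3), of "map snd ps ! i"] nth_mem[of i "map snd ps"] i
      by simp_all
    have fi: "fs ! i = fr ?a ?s" using i by (simp add: ps(1) case_prod_beta)
    have "fr (?a * z) (?s * 1) \<in> extend ?J"
      using fr_mem_extend[OF J, of "?a * z" "?s * 1"] z as by simp
    moreover have "fr ?a ?s \<otimes>\<^bsub>LL\<^esub> fr z 1 = fr (?a * z) (?s * 1)" by (rule fr_mult[OF as(1) z(1) as(2) UU_one])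
    ultimately have "(fs ! i) \<odot>\<^bsub>SM\<^esub> fr z 1 \<in> seq_mult SM (take i fs)"
      unfolding seq fi SM_simps by simp
    moreover have "fr z 1 \<in> carrier SM" unfolding SM_simps by (rule fr_closed[OF z(1) UU_one])
    moreover have "i < length fs" using i by (simp add: ps(1))
    ultimately have "fr z 1 \<in> extend ?J" using fs(2) unfolding regular_sequence_def seq[symmetric] by blast
    then show "z \<in> sat UU ?J" using fr_mem_extend[OF J z(1) UU_one] by blast
  qed
  then have "reg_seq UU I ?gs" unfolding reg_seq_def by blast
  then show ?thesis using ps by (intro exI[of _ ?gs]) simp
qed

text \<open>Depth equals dimension at \<open>q\<close>, and the dimension is at least the length of
  any chain between \<open>I\<close> and \<open>q\<close>. A sequence is extracted from the supremum
  that defines the grade.\<close>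

theorem cohen_macaulay_reg_seq:
  assumes cm: "cohen_macaulay QR" and c: "chain l c" "I \<subseteq> c 0" "c l \<subseteq> q"
  shows "\<exists>gs. l \<le> length gs \<and> set gs \<subseteq> q \<and> reg_seq UU I gs"
proof (rule ccontr)
  assume no: "\<not> ?thesis"
  have "depth LL = krull_dim LL" using cm primeideal_qq by (simp add: cohen_macaulay_def)
  then have le: "enat l \<le> grade (extend q) SM"
    using krull_dim_LL[OF c] by (simp add: depth_def maximal_LL)
  have len: "length fs < l" if "set fs \<subseteq> extend q" "regular_sequence SM fs" for fs
    using regular_sequence_LL[OF that] no not_le by metis
  \<comment> \<open>Without a sequence of length \<open>l\<close> the supremum would be at most
    \<open>l - 1\<close>. The empty sequence excludes \<open>l = 0\<close>, where this natural
    number would be 0 again.\<close>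
  have "reg_seq UU I []" by (simp add: reg_seq_def)
  then have l0: "l \<noteq> 0" using no by (metis empty_subsetI le_zero_eq list.set(1) list.size(3))
  have "grade (extend q) SM \<le> enat (l - 1)"
    unfolding grade_def using len by (intro Sup_least) (fastforce simp: less_eq_Suc_le)
  then have "enat l \<le> enat (l - 1)" using le order_trans by blast
  then show False using l0 by simp
qed

end

end

section \<open>Local cohomology of a quotient by variables\<close>

lemma finsum_mem_closed:
  assumes "abelian_group G" "H \<subseteq> carrier G" "\<zero>\<^bsub>G\<^esub> \<in> H" "\<And>x y. x \<in> H \<Longrightarrow> y \<in> H \<Longrightarrow> x \<oplus>\<^bsub>G\<^esub> y \<in> H"
    and "finite B" "\<And>k. k \<in> B \<Longrightarrow> f k \<in> H"
  shows "finsum G f B \<in> H"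
proof -
  interpret abelian_group G by fact
  show ?thesis using assms(5,6)
  proof (induction B rule: finite_induct)
    case (insert k B)
    then show ?case using assms(2,4) by (subst finsum_insert) auto
  qed (use assms in simp)
qed

lemma (in group) trivial_Mod:
  assumes "K = {\<one>}" "H = {\<one>}"
  shows "trivial_group (G\<lparr>carrier := K\<rparr> Mod H)"
proof -
  let ?G = "G\<lparr>carrier := {\<one>}\<rparr>"
  interpret K: group ?G by (rule subgroup_imp_group[OF triv_subgroup])
  interpret N: normal "{\<one>}" ?G using K.one_is_normal by simp
  have "carrier (?G Mod {\<one>}) = {\<one>\<^bsub>?G Mod {\<one>}\<^esub>}"
    by (auto simp: FactGroup_def RCOSETS_def r_coset_def)
  then show ?thesis unfolding trivial_group_def assms using N.factorgroup_is_group by simp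
qed

locale cech_setup = monomial_ring V C
  for V :: "'v::linorder set" and C :: "('v, 'k::field) vpoly set" +
  fixes A :: "'v set" and vs :: "'v list"
  assumes vs: "set vs \<subseteq> V" "distinct vs"
begin

definition gens :: "('v, 'k) vpoly list" where
  "gens = map (\<lambda>v. mon (single v 1)) vs"

abbreviation "p \<equiv> var_ideal A"
abbreviation "N \<equiv> quotient_module sring p"
abbreviation "den \<equiv> cech_denoms sring gens"
abbreviation "loc \<equiv> cech_loc sring gens N"
abbreviation "coc \<equiv> cech_cochains sring gens N"
abbreviation "res \<equiv> cech_restrict sring gens N"
abbreviation "dif \<equiv> cech_diff sring gens N"
abbreviation "idx \<equiv> cech_index vs"
abbreviation "fra B f \<tau> \<equiv> fraction sring N (den B) (coset p f) (mon \<tau>)"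

text \<open>The exponent of the product of the powers \<open>e k\<close> of the generators with
  index in \<open>B\<close>; by \<open>den_eq\<close> these monomials are exactly the denominators
  for \<open>B\<close>.\<close>

definition sig :: "nat set \<Rightarrow> (nat \<Rightarrow> nat) \<Rightarrow> 'v \<Rightarrow>\<^sub>0 nat" where
  "sig B e = (\<Sum>k\<in>B. single (vs ! k) (e k))"

lemma cech_index_gens [simp]: "cech_index gens i = idx i"
  by (simp add: cech_index_def gens_def)

lemma idx_iff: "B \<in> idx i \<longleftrightarrow> B \<subseteq> {..<length vs} \<and> card B = i"
  by (simp add: cech_index_def)

lemma idx_finite: "B \<in> idx i \<Longrightarrow> finite B"
  using finite_subset by (auto simp: idx_iff)

lemma lookup_sig:
  assumes "B \<subseteq> {..<length vs}" "k < length vs"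
  shows "lookup (sig B e) (vs ! k) = (if k \<in> B then e k else 0)"
proof -
  have fin: "finite B" using assms finite_subset by auto
  have "lookup (sig B e) (vs ! k) = (\<Sum>j\<in>B. if j = k then e j else 0)"
    unfolding sig_def lookup_sum lookup_single when_def
    using assms nth_eq_iff_index_eq[OF vs(2)] by (intro sum.cong) auto
  then show ?thesis using fin by simp
qed

lemma keys_sig: "B \<subseteq> {..<length vs} \<Longrightarrow> keys (sig B e) \<subseteq> (!) vs ` B"
  using keys_sum[of "\<lambda>k. single (vs ! k) (e k)" B] by (auto simp: sig_def split: if_splits)

lemma keys_sig_V: "B \<subseteq> {..<length vs} \<Longrightarrow> keys (sig B e) \<subseteq> V"
  using keys_sig[of B e] vs(1) nth_mem by fastforce

lemma sig_exps: "B \<subseteq> {..<length vs} \<Longrightarrow> sig B e \<in> exps"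
  using keys_sig_V by (simp add: exps_def)

lemma sig_add: "sig B e + sig B e' = sig B (\<lambda>k. e k + e' k)"
  by (simp add: sig_def single_add sum.distrib)

lemma mon_power: "(mon t :: ('v, 'k) vpoly) ^ k = mon (\<Sum>i<k. t)"
  by (induction k) (simp_all add: mult_single add.commute)

lemma mon_prod: "finite B \<Longrightarrow> (\<Prod>k\<in>B. mon (h k) :: ('v, 'k) vpoly) = mon (\<Sum>k\<in>B. h k)"
  by (induction B rule: finite_induct) (simp_all add: mult_single)

lemma single_sum: "(\<Sum>i<k. single v (1::nat)) = single v k"
  by (rule poly_mapping_eqI) (simp add: lookup_sum lookup_single when_def)

lemma gens_C: "k < length vs \<Longrightarrow> gens ! k \<in> C"
  using vs(1) nth_mem[of k vs] by (auto simp: mem_C exps_def gens_def)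

lemma den_eq:
  assumes B: "B \<subseteq> {..<length vs}"
  shows "den B = {mon (sig B e) | e. True}"
proof -
  have fin: "finite B" using B finite_subset by auto
  have "finprod sring (\<lambda>k. (gens ! k) [^]\<^bsub>sring\<^esub> e k) B = mon (sig B e)" for e :: "nat \<Rightarrow> nat"
  proof -
    have "finprod sring (\<lambda>k. (gens ! k) [^]\<^bsub>sring\<^esub> e k) B = (\<Prod>k\<in>B. (gens ! k) ^ e k)"
      unfolding sring_pow using B gens_C by (intro sring_finprod) blast
    also have "\<dots> = (\<Prod>k\<in>B. mon (single (vs ! k) (e k)))"
    proof (rule prod.cong[OF refl])
      fix k assume "k \<in> B"
      then have "k < length vs" using B by auto
      then show "(gens ! k) ^ e k = mon (single (vs ! k) (e k))" by (simp only: gens_def nth_map mon_power single_sum)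
    qed
    also have "\<dots> = mon (sig B e)" unfolding sig_def by (rule mon_prod[OF fin])
    finally show ?thesis .
  qed
  then show ?thesis unfolding cech_denoms_def by simp
qed

lemma mon_sig_den: "B \<subseteq> {..<length vs} \<Longrightarrow> mon (sig B e) \<in> den B"
  by (auto simp: den_eq)

lemma denE: assumes "B \<subseteq> {..<length vs}" "s \<in> den B" obtains e where "s = mon (sig B e)"
  using assms by (auto simp: den_eq)

lemma p_ideal: "is_ideal p" by (rule var_ideal_ideal)

lemma module_loc: assumes "B \<subseteq> {..<length vs}" shows "module_localization sring N (den B)"
proof (intro module_localization.intro module_QM[OF p_ideal] module_localization_axioms.intro)
  show "den B \<subseteq> carrier sring" using assms sig_exps by (auto simp: den_eq)
  have "sig B (\<lambda>_. 0) = 0" by (simp add: sig_def)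
  then show "\<one>\<^bsub>sring\<^esub> \<in> den B" using mon_sig_den[OF assms, of "\<lambda>_. 0"] by simp
  fix s t assume "s \<in> den B" "t \<in> den B"
  then obtain e e' where "s = mon (sig B e)" "t = mon (sig B e')" using denE[OF assms] by metis
  then show "s \<otimes>\<^bsub>sring\<^esub> t \<in> den B" by (simp add: mult_single sig_add mon_sig_den[OF assms])
qed

lemma loc_group: "B \<subseteq> {..<length vs} \<Longrightarrow> abelian_group (loc B)"
  unfolding cech_loc_def by (rule module_localization.abelian_group_L[OF module_loc])

lemma loc_cases:
  assumes "B \<subseteq> {..<length vs}" "X \<in> carrier (loc B)"
  obtains f e where "f \<in> C" "X = fra B f (sig B e)"
proof -
  interpret module_localization sring N "den B" by (rule module_loc[OF assms(1)])
  obtain x s where x: "x \<in> carrier N" "s \<in> den B" "X = frc x s"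
    using assms(2) unfolding cech_loc_def by (rule L_cases)
  obtain e where "s = mon (sig B e)" using denE[OF assms(1) x(2)] .
  then show ?thesis using x that by (auto simp: QM_simps(1)[OF p_ideal])
qed

lemma fra_closed: "B \<subseteq> {..<length vs} \<Longrightarrow> f \<in> C \<Longrightarrow> fra B f (sig B e) \<in> carrier (loc B)"
  unfolding cech_loc_def
  by (rule module_localization.frac_closed[OF module_loc]) (auto simp: QM_simps(1)[OF p_ideal] intro: mon_sig_den)

lemma sig_mono: "B \<subseteq> B' \<Longrightarrow> finite B' \<Longrightarrow> sig B e = sig B' (\<lambda>k. if k \<in> B then e k else 0)"
  unfolding sig_def by (rule sum.mono_neutral_cong_left) auto

lemma den_mono: "B \<subseteq> B' \<Longrightarrow> B' \<subseteq> {..<length vs} \<Longrightarrow> den B \<subseteq> den B'"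
  using sig_mono[of B B'] finite_subset[of B' "{..<length vs}"] by (auto simp: den_eq)

lemma res_fra:
  assumes B: "B \<subseteq> B'" "B' \<subseteq> {..<length vs}" and f: "f \<in> C"
  shows "res B' (fra B f (sig B e)) = fra B' f (sig B e)"
proof -
  have B1: "B \<subseteq> {..<length vs}" using B by blast
  interpret L1: module_localization sring N "den B" by (rule module_loc[OF B1])
  interpret L2: module_localization sring N "den B'" by (rule module_loc[OF B(2)])
  have sub: "den B \<subseteq> den B'" by (rule den_mono[OF B])
  have x: "coset p f \<in> carrier N" using f by (simp add: QM_simps(1)[OF p_ideal])
  have s: "mon (sig B e) \<in> den B" by (rule mon_sig_den[OF B1])
  show ?thesis
    unfolding cech_restrict_def
  proof (rule L1.frac_cong_UN[OF x s])
    fix y t assume y: "y \<in> carrier N" "t \<in> den B" "L1.frac_rel (coset p f) (mon (sig B e)) y t"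
    then have "L2.frac_rel (coset p f) (mon (sig B e)) y t"
      using sub unfolding L1.frac_rel_def L2.frac_rel_def by blast
    then have "L2.frc (coset p f) (mon (sig B e)) = L2.frc y t"
      using L2.frac_eq x y s sub by blast
    then show "L2.frc y t = L2.frc (coset p f) (mon (sig B e))" by simp
  qed
qed

lemma res_closed:
  assumes "B \<subseteq> B'" "B' \<subseteq> {..<length vs}" "X \<in> carrier (loc B)"
  shows "res B' X \<in> carrier (loc B')"
proof -
  have B1: "B \<subseteq> {..<length vs}" using assms by blast
  obtain f e where f: "f \<in> C" "X = fra B f (sig B e)" by (rule loc_cases[OF B1 assms(3)])
  have "sig B e = sig B' (\<lambda>k. if k \<in> B then e k else 0)"
    using assms by (intro sig_mono) (auto intro: finite_subset)
  then show ?thesis unfolding f(2) res_fra[OF assms(1,2) f(1)] using fra_closed[OF assms(2) f(1)] by simp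
qed

text \<open>A variable of \<open>A\<close> acts as zero on the quotient by \<open>p\<close>, so
  inverting it annihilates the module.\<close>

lemma loc_trivial:
  assumes B: "B \<subseteq> {..<length vs}" "k \<in> B" "vs ! k \<in> A"
  shows "carrier (loc B) = {\<zero>\<^bsub>loc B\<^esub>}"
  unfolding cech_loc_def
proof (rule module_localization.trivial_L[OF module_loc[OF B(1)]])
  let ?t = "sig B (\<lambda>j. if j = k then 1 else 0)"
  show "mon ?t \<in> den B" by (rule mon_sig_den[OF B(1)])
  have k: "k < length vs" using B by auto
  have t: "?t \<in> exps" by (rule sig_exps[OF B(1)])
  have "lookup ?t (vs ! k) = 1" using lookup_sig[OF B(1) k] B(2) by simp
  then have "vs ! k \<in> keys ?t" by (simp add: in_keys_iff)
  then have tp: "mon ?t \<in> p" using mon_mem_var_ideal[OF t] B(3) by blast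
  fix x assume "x \<in> carrier N"
  then obtain f where f: "f \<in> C" "x = coset p f" by (auto simp: QM_simps(1)[OF p_ideal])
  have "mon ?t * f \<in> p" by (rule ideal_mult'[OF p_ideal f(1) tp])
  then show "mon ?t \<odot>\<^bsub>N\<^esub> x = \<zero>\<^bsub>N\<^esub>"
    using f t coset_eq[OF p_ideal, of "mon ?t * f" 0] by (simp add: QM_simps[OF p_ideal])
qed

section \<open>Cochains and the differential\<close>

lemma carrier_coc: "carrier (coc i) = (\<Pi>\<^sub>E B\<in>idx i. carrier (loc B))"
  by (simp add: cech_cochains_def)

lemma one_coc: "\<one>\<^bsub>coc i\<^esub> = (\<lambda>B\<in>idx i. \<zero>\<^bsub>loc B\<^esub>)"
  by (simp add: cech_cochains_def)

lemma group_coc: "group (coc i)"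
  unfolding cech_cochains_def cech_index_gens
proof (rule product_group)
  fix B assume "B \<in> idx i"
  then show "group (add_monoid (loc B))" using abelian_group.a_group[OF loc_group] by (simp add: idx_iff)
qed

lemma dif_term:
  assumes c: "c \<in> carrier (coc i)" and B: "B \<in> idx (Suc i)" and k: "k \<in> B"
  shows "c (B - {k}) \<in> carrier (loc (B - {k}))" "B - {k} \<subseteq> B" "B - {k} \<subseteq> {..<length vs}"
proof -
  have "B - {k} \<in> idx i" using B k idx_finite[OF B] by (auto simp: idx_iff)
  then show "c (B - {k}) \<in> carrier (loc (B - {k}))" using c unfolding carrier_coc by (rule PiE_mem[rotated])
  show "B - {k} \<subseteq> B" "B - {k} \<subseteq> {..<length vs}" using B by (auto simp: idx_iff)
qed

text \<open>The subgroup \<open>H\<close> is kept general: taken to be everything, it shows that the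
  differential is well defined; taken to be \<open>nonneg_part\<close>, it confines the coboundaries
  of top degree.\<close>

lemma dif_mem:
  assumes c: "c \<in> carrier (coc i)" and B: "B \<in> idx (Suc i)"
    and H: "H \<subseteq> carrier (loc B)" "\<zero>\<^bsub>loc B\<^esub> \<in> H" "\<And>x y. x \<in> H \<Longrightarrow> y \<in> H \<Longrightarrow> x \<oplus>\<^bsub>loc B\<^esub> y \<in> H"
      "\<And>x. x \<in> H \<Longrightarrow> \<ominus>\<^bsub>loc B\<^esub> x \<in> H"
    and r: "\<And>k. k \<in> B \<Longrightarrow> res B (c (B - {k})) \<in> H"
  shows "dif i c B \<in> H"
proof -
  have "dif i c B = finsum (loc B) (\<lambda>k. let z = res B (c (B - {k})) in
      if even (card {j \<in> B. j < k}) then z else \<ominus>\<^bsub>loc B\<^esub> z) B"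
    using B by (simp add: cech_diff_def)
  also have "\<dots> \<in> H"
    using B r H(4) by (intro finsum_mem_closed[OF loc_group H(1,2,3)] idx_finite[OF B]) (auto simp: idx_iff Let_def)
  finally show ?thesis .
qed

lemma dif_closed:
  assumes "c \<in> carrier (coc i)" shows "dif i c \<in> carrier (coc (Suc i))"
  unfolding carrier_coc
proof (rule PiE_I)
  fix B assume B: "B \<in> idx (Suc i)"
  then have Bn: "B \<subseteq> {..<length vs}" by (simp add: idx_iff)
  interpret G: abelian_group "loc B" by (rule loc_group[OF Bn])
  show "dif i c B \<in> carrier (loc B)"
    by (rule dif_mem[OF assms B _ _ _ _ res_closed[OF dif_term(2)[OF assms B] Bn dif_term(1)[OF assms B]]])
      auto
qed (simp add: cech_diff_def)

text \<open>The generators that survive modulo \<open>p\<close>. A different index set of at least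
  this size contains a variable of \<open>A\<close>, so its localization vanishes.\<close>

abbreviation "B0 \<equiv> {k. k < length vs \<and> vs ! k \<notin> A}"

lemma card_B0: "card B0 = card (set vs - A)"
proof -
  have "bij_betw ((!) vs) B0 (set vs - A)"
    using vs(2) by (auto simp: bij_betw_def inj_on_def nth_eq_iff_index_eq in_set_conv_nth)
  then show ?thesis by (rule bij_betw_same_card)
qed

lemma loc_trivial_idx:
  assumes "B \<in> idx i" "B \<noteq> B0" "card B0 \<le> i"
  shows "carrier (loc B) = {\<zero>\<^bsub>loc B\<^esub>}"
proof -
  have B: "B \<subseteq> {..<length vs}" using assms by (simp add: idx_iff)
  have "\<not> B \<subseteq> B0"
  proof
    assume "B \<subseteq> B0"
    then have "B = B0" using assms by (intro card_seteq) (auto simp: idx_iff)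
    with assms show False by simp
  qed
  then show ?thesis using loc_trivial[OF B] B by blast
qed

lemma coc_trivial: assumes "card B0 < i" shows "carrier (coc i) = {\<one>\<^bsub>coc i\<^esub>}"
proof -
  have "carrier (loc B) = {\<zero>\<^bsub>loc B\<^esub>}" if "B \<in> idx i" for B
    using that assms by (intro loc_trivial_idx) (auto simp: idx_iff)
  then have "carrier (coc i) = (\<Pi>\<^sub>E B\<in>idx i. {\<zero>\<^bsub>loc B\<^esub>})" unfolding carrier_coc by (rule PiE_cong)
  then show ?thesis unfolding one_coc by (auto simp: PiE_iff extensional_def fun_eq_iff)
qed

lemma local_cohomology_trivial:
  assumes "card B0 < i" shows "trivial_group (local_cohomology sring gens N i)"
proof -
  interpret group "coc i" by (rule group_coc)
  obtain j where i: "i = Suc j" using assms by (cases i) auto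
  have ne: "carrier (coc j) \<noteq> {}" using group.is_monoid[OF group_coc] monoid.one_closed by blast
  have "cech_cocycles sring gens N i = {\<one>\<^bsub>coc i\<^esub>}"
    unfolding cech_cocycles_def kernel_def
    using coc_trivial[OF assms] coc_trivial[of "Suc i"] dif_closed[of _ i] assms by auto
  moreover have "cech_coboundaries sring gens N i = {\<one>\<^bsub>coc i\<^esub>}"
    using coc_trivial[OF assms] dif_closed[of _ j] ne unfolding cech_coboundaries_def i by auto
  ultimately show ?thesis unfolding local_cohomology_def by (rule trivial_Mod)
qed

text \<open>Fractions without a term whose exponents at all the inverted variables are negative; this
  subgroup contains the image of the last differential, but not the fraction 1/(product of the
  inverted variables).\<close>
definition nonneg_part where
  "nonneg_part = {fra B0 f (sig B0 e) | f e. f \<in> C \<and>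
     (\<forall>t\<in>keys f. keys t \<inter> A = {} \<longrightarrow> (\<exists>k\<in>B0. e k \<le> lookup t (vs ! k)))}"

section \<open>Nonvanishing in the top degree\<close>

lemma B0_sub: "B0 \<subseteq> {..<length vs}" by auto

lemma nonneg_partI:
  assumes "f \<in> C" "\<And>t. t \<in> keys f \<Longrightarrow> keys t \<inter> A = {} \<Longrightarrow> \<exists>k\<in>B0. e k \<le> lookup t (vs ! k)"
    "X = fra B0 f (sig B0 e)"
  shows "X \<in> nonneg_part"
  using assms unfolding nonneg_part_def by blast

lemma nonneg_part_add:
  assumes "X \<in> nonneg_part" "Y \<in> nonneg_part" shows "X \<oplus>\<^bsub>loc B0\<^esub> Y \<in> nonneg_part"
proof -
  interpret module_localization sring N "den B0" by (rule module_loc[OF B0_sub])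
  obtain f e where X: "f \<in> C" "X = fra B0 f (sig B0 e)"
    "\<And>t. t \<in> keys f \<Longrightarrow> keys t \<inter> A = {} \<Longrightarrow> \<exists>k\<in>B0. e k \<le> lookup t (vs ! k)"
    using assms(1) unfolding nonneg_part_def by blast
  obtain g e' where Y: "g \<in> C" "Y = fra B0 g (sig B0 e')"
    "\<And>t. t \<in> keys g \<Longrightarrow> keys t \<inter> A = {} \<Longrightarrow> \<exists>k\<in>B0. e' k \<le> lookup t (vs ! k)"
    using assms(2) unfolding nonneg_part_def by blast
  let ?s = "sig B0 e" and ?t = "sig B0 e'"
  have st: "?s \<in> exps" "?t \<in> exps" by (intro sig_exps B0_sub)+
  have "X \<oplus>\<^bsub>loc B0\<^esub> Y = frc ((mon ?t \<odot>\<^bsub>N\<^esub> coset p f) \<oplus>\<^bsub>N\<^esub> (mon ?s \<odot>\<^bsub>N\<^esub> coset p g)) (mon ?s \<otimes>\<^bsub>sring\<^esub> mon ?t)"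
    unfolding X(2) Y(2) cech_loc_def using X(1) Y(1)
    by (intro add_L mon_sig_den B0_sub) (auto simp: QM_simps[OF p_ideal])
  also have "\<dots> = fra B0 (mon ?t * f + mon ?s * g) (sig B0 (\<lambda>k. e k + e' k))"
    using X(1) Y(1) st by (simp add: QM_simps[OF p_ideal] mult_single sig_add)
  finally have eq: "X \<oplus>\<^bsub>loc B0\<^esub> Y = fra B0 (mon ?t * f + mon ?s * g) (sig B0 (\<lambda>k. e k + e' k))" .
  have lk: "lookup ?s (vs ! k) = e k" "lookup ?t (vs ! k) = e' k" if "k \<in> B0" for k
    using lookup_sig[OF B0_sub, of k] that by simp_all
  show ?thesis
  proof (rule nonneg_partI[OF _ _ eq])
    show "mon ?t * f + mon ?s * g \<in> C" using X(1) Y(1) st by simp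
    fix t assume t: "t \<in> keys (mon ?t * f + mon ?s * g)" "keys t \<inter> A = {}"
    \<comment> \<open>Passing to the common denominator shifts the exponents of \<open>f\<close> by
      \<open>e'\<close> and those of \<open>g\<close> by \<open>e\<close>; each term keeps the index
      at which it was nonnegative.\<close>
    have "t \<in> keys (mon ?t * f) \<or> t \<in> keys (mon ?s * g)"
      using subsetD[OF Poly_Mapping.keys_add t(1)] by simp
    then show "\<exists>k\<in>B0. e k + e' k \<le> lookup t (vs ! k)"
    proof
      assume "t \<in> keys (mon ?t * f)"
      then obtain a where a: "t = ?t + a" "a \<in> keys f" by (auto simp: keys_mon_mult)
      moreover have "keys a \<inter> A = {}" using t(2) a(1) by (auto simp: keys_add_nat)
      ultimately obtain k where "k \<in> B0" "e k \<le> lookup a (vs ! k)" using X(3) by blast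
      then show ?thesis using lk(2)[of k] a(1) by (intro bexI[of _ k]) (auto simp: lookup_add)
    next
      assume "t \<in> keys (mon ?s * g)"
      then obtain a where a: "t = ?s + a" "a \<in> keys g" by (auto simp: keys_mon_mult)
      moreover have "keys a \<inter> A = {}" using t(2) a(1) by (auto simp: keys_add_nat)
      ultimately obtain k where "k \<in> B0" "e' k \<le> lookup a (vs ! k)" using Y(3) by blast
      then show ?thesis using lk(1)[of k] a(1) by (intro bexI[of _ k]) (auto simp: lookup_add)
    qed
  qed
qed

lemma nonneg_part_minus:
  assumes "X \<in> nonneg_part" shows "\<ominus>\<^bsub>loc B0\<^esub> X \<in> nonneg_part"
proof -
  interpret module_localization sring N "den B0" by (rule module_loc[OF B0_sub])
  obtain f e where X: "f \<in> C" "X = fra B0 f (sig B0 e)"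
    "\<And>t. t \<in> keys f \<Longrightarrow> keys t \<inter> A = {} \<Longrightarrow> \<exists>k\<in>B0. e k \<le> lookup t (vs ! k)"
    using assms(1) unfolding nonneg_part_def by blast
  have f: "coset p f \<in> carrier N" using X(1) by (simp add: QM_simps(1)[OF p_ideal])
  have "\<ominus>\<^bsub>N\<^esub> coset p f = coset p (- f)"
    using X(1) by (intro M.minus_equality) (auto simp: QM_simps[OF p_ideal])
  then have eq: "\<ominus>\<^bsub>loc B0\<^esub> X = fra B0 (- f) (sig B0 e)"
    unfolding X(2) cech_loc_def using a_inv_frac[OF f mon_sig_den[OF B0_sub]] by simp
  have "keys (- f) = keys f" by (simp add: in_keys_iff set_eq_iff)
  then show ?thesis using X by (intro nonneg_partI[OF _ _ eq]) auto
qed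

lemma nonneg_part_zero: "\<zero>\<^bsub>loc B0\<^esub> \<in> nonneg_part"
proof -
  interpret module_localization sring N "den B0" by (rule module_loc[OF B0_sub])
  have "fra B0 0 (sig B0 (\<lambda>_. 0)) = \<zero>\<^bsub>loc B0\<^esub>"
    using zero_eq_frac[OF mon_sig_den[OF B0_sub]] by (simp add: QM_simps(2)[OF p_ideal] cech_loc_def)
  then show ?thesis by (intro nonneg_partI[of 0 "\<lambda>_. 0"]) auto
qed

lemma nonneg_part_closed: "nonneg_part \<subseteq> carrier (loc B0)"
  using fra_closed[OF B0_sub] unfolding nonneg_part_def by blast

text \<open>A fraction coming from \<open>B0 - {k}\<close> has a denominator with exponent 0 at
  \<open>k\<close>, so \<open>k\<close> serves as the index for all terms.\<close>

lemma res_nonneg_part: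
  assumes k: "k \<in> B0" and X: "X \<in> carrier (loc (B0 - {k}))"
  shows "res B0 X \<in> nonneg_part"
proof -
  have B: "B0 - {k} \<subseteq> B0" "B0 - {k} \<subseteq> {..<length vs}" by auto
  obtain f e where f: "f \<in> C" "X = fra (B0 - {k}) f (sig (B0 - {k}) e)" by (rule loc_cases[OF B(2) X])
  have s: "sig (B0 - {k}) e = sig B0 (\<lambda>j. if j \<in> B0 - {k} then e j else 0)"
    by (rule sig_mono[OF B(1)]) simp
  have "res B0 X = fra B0 f (sig B0 (\<lambda>j. if j \<in> B0 - {k} then e j else 0))"
    using res_fra[OF B(1) B0_sub f(1), of e] by (simp only: f(2) s)
  then show ?thesis using k by (intro nonneg_partI[OF f(1)]) (auto intro!: bexI[of _ k])
qed

lemma coboundaries_nonneg_part: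
  assumes "c \<in> cech_coboundaries sring gens N (card B0)" shows "c B0 \<in> nonneg_part"
proof -
  have B0: "B0 \<in> idx (card B0)" by (auto simp: idx_iff)
  show ?thesis
  proof (cases "card B0")
    \<comment> \<open>When no generator survives, the differential into this degree is replaced by
      the convention that only the zero cochain is a coboundary.\<close>
    case 0
    have "c = \<one>\<^bsub>coc (card B0)\<^esub>" using assms unfolding 0 by (simp add: cech_coboundaries_def)
    then show ?thesis using B0 nonneg_part_zero by (simp only: one_coc restrict_apply')
  next
    case (Suc i)
    obtain b where b: "b \<in> carrier (coc i)" "c = dif i b"
      using assms unfolding Suc by (auto simp: cech_coboundaries_def)
    have B: "B0 \<in> idx (Suc i)" using B0 Suc by simp
    show ?thesis unfolding b(2)
      by (rule dif_mem[OF b(1) B nonneg_part_closed nonneg_part_zero nonneg_part_add nonneg_part_minus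
          res_nonneg_part[OF _ dif_term(1)[OF b(1) B]]])
  qed
qed

text \<open>If the fraction equals f over a monomial with exponents \<open>e k\<close>, clearing
  denominators and comparing one coefficient modulo \<open>p\<close> yields a term of f, free of
  variables in \<open>A\<close>, whose exponent at every index in \<open>B0\<close> is one less than
  \<open>e k\<close>. No index can then witness nonnegativity.\<close>

lemma top_class_not_nonneg: "fra B0 1 (sig B0 (\<lambda>_. 1)) \<notin> nonneg_part"
proof
  interpret module_localization sring N "den B0" by (rule module_loc[OF B0_sub])
  let ?t = "sig B0 (\<lambda>_. 1)"
  assume "fra B0 1 ?t \<in> nonneg_part"
  then obtain f e where f: "f \<in> C" "fra B0 1 ?t = fra B0 f (sig B0 e)"
    "\<And>t. t \<in> keys f \<Longrightarrow> keys t \<inter> A = {} \<Longrightarrow> \<exists>k\<in>B0. e k \<le> lookup t (vs ! k)"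
    unfolding nonneg_part_def by blast
  let ?s = "sig B0 e"
  have "frac_rel (coset p 1) (mon ?t) (coset p f) (mon ?s)"
    using f(1,2) by (subst frac_eq[symmetric]) (auto simp: QM_simps(1)[OF p_ideal] mon_sig_den[OF B0_sub])
  then obtain u where u: "u \<in> den B0" "(u \<otimes>\<^bsub>sring\<^esub> mon ?s) \<odot>\<^bsub>N\<^esub> coset p 1 = (u \<otimes>\<^bsub>sring\<^esub> mon ?t) \<odot>\<^bsub>N\<^esub> coset p f"
    unfolding frac_rel_def by blast
  obtain d where d: "u = mon (sig B0 d)" by (rule denE[OF B0_sub u(1)])
  let ?u = "sig B0 d"
  have E: "?s \<in> exps" "?t \<in> exps" "?u \<in> exps" by (intro sig_exps B0_sub)+
  have "coset p (mon (?u + ?s)) = coset p (mon (?u + ?t) * f)"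
    using u(2) f(1) E by (simp add: d QM_simps[OF p_ideal] mult_single)
  then have diff: "mon (?u + ?s) - mon (?u + ?t) * f \<in> p"
    using coset_eq[OF p_ideal, of "mon (?u + ?s)" "mon (?u + ?t) * f"] f(1) E by simp
  have avoid: "keys (sig B0 h) \<inter> A = {}" for h using keys_sig[OF B0_sub, of h] by auto
  have "keys (?u + ?s) \<inter> A = {}" using avoid[of d] avoid[of e] by (auto simp: keys_add_nat)
  then have "?u + ?s \<notin> keys (mon (?u + ?s) - mon (?u + ?t) * f)"
    using diff unfolding mem_var_ideal by blast
  then have "?u + ?s \<in> keys (mon (?u + ?t) * f)" by (auto simp: in_keys_iff lookup_minus)
  then obtain t where t: "?u + ?s = ?u + ?t + t" "t \<in> keys f" by (auto simp: keys_mon_mult)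
  then have st: "?s = ?t + t" by (simp add: add.assoc)
  then have "keys t \<inter> A = {}" using avoid[of e] by (auto simp: keys_add_nat)
  then obtain k where k: "k \<in> B0" "e k \<le> lookup t (vs ! k)" using f(3)[OF t(2)] by blast
  have "lookup ?s (vs ! k) = e k" "lookup ?t (vs ! k) = 1" using lookup_sig[OF B0_sub, of k] k by simp_all
  then show False using st k(2) by (simp add: lookup_add)
qed

text \<open>If the quotient is trivial, the coset of the cocycle \<open>e\<close> is the set of
  coboundaries itself. Hence for some coboundary \<open>b\<close> the translate of \<open>b\<close>
  by \<open>e\<close> is a coboundary too, and subtracting the \<open>B0\<close> components puts the
  top fraction into \<open>nonneg_part\<close>.\<close>

lemma local_cohomology_nontrivial: "\<not> trivial_group (local_cohomology sring gens N (card B0))"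
proof
  let ?r = "card B0"
  let ?Z = "cech_cocycles sring gens N ?r" and ?D = "cech_coboundaries sring gens N ?r"
  assume triv: "trivial_group (local_cohomology sring gens N ?r)"
  have B0: "B0 \<in> idx ?r" by (auto simp: idx_iff)
  interpret G: abelian_group "loc B0" by (rule loc_group[OF B0_sub])
  let ?x = "fra B0 1 (sig B0 (\<lambda>_. 1))"
  define e where "e = (\<lambda>B\<in>idx ?r. if B = B0 then ?x else \<zero>\<^bsub>loc B\<^esub>)"
  have xL: "?x \<in> carrier (loc B0)" by (rule fra_closed[OF B0_sub one_mem])
  have eC: "e \<in> carrier (coc ?r)"
    unfolding carrier_coc
  proof (rule PiE_I)
    fix B assume B: "B \<in> idx ?r"
    then interpret GB: abelian_group "loc B" by (intro loc_group) (simp add: idx_iff)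
    show "e B \<in> carrier (loc B)" using B xL by (auto simp: e_def)
  qed (simp add: e_def)
  \<comment> \<open>The cocycle condition is automatic, as the next group of cochains is
    trivial.\<close>
  have "dif ?r e = \<one>\<^bsub>coc (Suc ?r)\<^esub>" using dif_closed[OF eC] coc_trivial[of "Suc ?r"] by simp
  then have eZ: "e \<in> ?Z" using eC by (simp add: cech_cocycles_def kernel_def)
  have "?D #>\<^bsub>(coc ?r)\<lparr>carrier := ?Z\<rparr>\<^esub> e \<in> carrier (local_cohomology sring gens N ?r)"
    using eZ by (auto simp: local_cohomology_def FactGroup_def RCOSETS_def)
  also have "carrier (local_cohomology sring gens N ?r) = {?D}"
    using triv by (simp add: trivial_group_def local_cohomology_def FactGroup_def)
  finally have De: "(\<lambda>b. b \<otimes>\<^bsub>coc ?r\<^esub> e) ` ?D = ?D" by (auto simp: r_coset_def)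
  have "carrier (coc i) \<noteq> {}" for i using group.is_monoid[OF group_coc] monoid.one_closed by blast
  then have "cech_coboundaries sring gens N i \<noteq> {}" for i
    by (simp add: cech_coboundaries_def split: nat.split)
  then have "?D \<noteq> {}" .
  then obtain b where b: "b \<in> ?D" by blast
  have be: "b \<otimes>\<^bsub>coc ?r\<^esub> e \<in> ?D" using b De by blast
  have "(b \<otimes>\<^bsub>coc ?r\<^esub> e) B0 = b B0 \<oplus>\<^bsub>loc B0\<^esub> ?x"
    using B0 by (simp add: cech_cochains_def e_def)
  then have H: "b B0 \<in> nonneg_part" "b B0 \<oplus>\<^bsub>loc B0\<^esub> ?x \<in> nonneg_part"
    using coboundaries_nonneg_part[OF b] coboundaries_nonneg_part[OF be] by simp_all
  have bL: "b B0 \<in> carrier (loc B0)" using H(1) nonneg_part_closed by blast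
  have "?x = (\<ominus>\<^bsub>loc B0\<^esub> b B0) \<oplus>\<^bsub>loc B0\<^esub> (b B0 \<oplus>\<^bsub>loc B0\<^esub> ?x)"
    using bL xL by (simp add: G.r_neg1)
  also have "\<dots> \<in> nonneg_part" by (intro nonneg_part_add nonneg_part_minus H)
  finally show False using top_class_not_nonneg by simp
qed

theorem cd_eq: "cd sring gens N = enat (card (set vs - A))"
  unfolding cd_def card_B0[symmetric]
proof (rule antisym)
  show "Sup {enat i |i. \<not> trivial_group (local_cohomology sring gens N i)} \<le> enat (card B0)"
    using local_cohomology_trivial by (intro Sup_least) (auto simp: not_less[symmetric])
  show "enat (card B0) \<le> Sup {enat i |i. \<not> trivial_group (local_cohomology sring gens N i)}"
    using local_cohomology_nontrivial by (intro Sup_upper) blast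
qed

end

section \<open>Grade, height and the main theorem\<close>

context comm_subring
begin

section \<open>Passing to the localization at a prime\<close>

lemma nzd_localize:
  assumes U: "mult_set U" and J: "is_ideal J" and f: "f \<in> C" "nzd {1} J f"
  shows "nzd U J f"
  unfolding nzd_def
proof (intro ballI impI)
  fix z assume z: "z \<in> C" "f * z \<in> sat U J"
  then obtain u where u: "u \<in> U" "u * (f * z) \<in> J" by (rule_tac satE)
  have uC: "u \<in> C" using mult_set_mem[OF U u(1)] .
  have "f * (u * z) \<in> sat {1} J" using u(2) by (simp add: sat_one[OF J] mult.left_commute)
  then have "u * z \<in> J" using nzdD[OF f(2), of "u * z"] uC z(1) by (simp add: sat_one[OF J])
  then show "z \<in> sat U J" by (rule satI[OF u(1) z(1)])
qed

lemma reg_seq_localize: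
  assumes U: "mult_set U" and I: "is_ideal I" and fs: "set fs \<subseteq> C" "reg_seq {1} I fs"
  shows "reg_seq U I fs"
  unfolding reg_seq_def
proof (intro allI impI)
  fix i assume i: "i < length fs"
  have "set (take i fs) \<subseteq> C" using fs(1) set_take_subset[of i fs] by (rule order_trans[rotated])
  then have "is_ideal (adjoins I (take i fs))" by (rule adjoins_ideal[OF I])
  moreover have "fs ! i \<in> C" using fs(1) nth_mem[OF i] by blast
  ultimately show "nzd U (adjoins I (take i fs)) (fs ! i)"
    using fs(2) i by (intro nzd_localize[OF U]) (simp_all add: reg_seq_def)
qed

lemma assoc_primes_localize:
  assumes q: "is_prime q" and I: "is_ideal I" and p: "p \<in> assoc_primes I" "p \<subseteq> q"
  shows "p \<in> assoc_primes (sat (C - q) I)"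
proof -
  have U: "mult_set (C - q)" using q by (rule mult_set_compl)
  obtain z where z: "is_prime p" "z \<in> C" "p = colon I z" using p(1) by (auto simp: assoc_primes_def)
  have "colon I z = colon (sat (C - q) I) z"
  proof (intro equalityI subsetI)
    fix a assume "a \<in> colon I z"
    then show "a \<in> colon (sat (C - q) I) z" using subsetD[OF sat_sup[OF U I]] by (simp add: colon_def)
  next
    fix a assume "a \<in> colon (sat (C - q) I) z"
    then have a: "a \<in> C" "a * z \<in> sat (C - q) I" by (simp_all add: colon_def)
    then obtain u where u: "u \<in> C - q" "u * (a * z) \<in> I" by (rule_tac satE)
    then have "u * a \<in> p" using a(1) unfolding z(3) by (simp add: colon_def mult.assoc)
    then show "a \<in> colon I z" using prime_mult[OF z(1), of u a] u(1) a(1) p(2) z(3) by blast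
  qed
  then show ?thesis using z by (auto simp: assoc_primes_def)
qed

lemma assoc_prime_has_socle:
  assumes J: "is_ideal J" and q: "q \<in> assoc_primes J"
  shows "has_socle q J"
proof -
  obtain z where z: "is_prime q" "z \<in> C" "q = colon J z" using q by (auto simp: assoc_primes_def)
  have "z \<notin> sat (C - q) J"
  proof
    assume "z \<in> sat (C - q) J"
    then obtain u where "u \<in> C - q" "u * z \<in> J" by (rule satE)
    then show False using z(3) by (simp add: colon_def)
  qed
  moreover have "\<forall>a\<in>q. a * z \<in> sat (C - q) J"
  proof
    fix a assume "a \<in> q"
    then have "a * z \<in> J" using z(3) by (simp add: colon_def)
    then show "a * z \<in> sat (C - q) J" using sat_sup[OF mult_set_compl[OF z(1)] J] by blast
  qed
  ultimately show ?thesis using z(2) unfolding has_socle_def by blast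
qed

text \<open>The growth of an associated prime is a local statement, so everything is localized at
  \<open>q\<close> beforehand; this also keeps all members of the chain inside
  \<open>q\<close>.\<close>

lemma assoc_prime_chain:
  assumes acc: "acc_above I" and I: "is_ideal I" and q: "is_prime q" and p: "p \<in> assoc_primes I" "p \<subseteq> q"
    and fs: "set fs \<subseteq> q" "reg_seq {1} I fs"
  shows "\<exists>c. chain (length fs) c \<and> c 0 = p \<and> c (length fs) \<subseteq> q"
proof -
  let ?U = "C - q"
  have U: "mult_set ?U" using q by (rule mult_set_compl)
  have fC: "set fs \<subseteq> C" using fs(1) prime_sub[OF q] by blast
  have reg: "reg_seq ?U I fs" by (rule reg_seq_localize[OF U I fC fs(2)])
  let ?J = "\<lambda>i. adjoins I (take i fs)"
  have J: "is_ideal (?J i)" "I \<subseteq> ?J i" for i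
    using adjoins_ideal[OF I] adjoins_sup fC set_take_subset[of i fs] by (blast, blast)
  have "i \<le> length fs \<Longrightarrow> \<exists>c. chain i c \<and> c 0 = p \<and> c i \<in> assoc_primes (sat ?U (?J i))" for i
  proof (induction i)
    case 0
    have "is_prime p" using p(1) by (simp add: assoc_primes_def)
    then show ?case using assoc_primes_localize[OF q I p] by (intro exI[of _ "\<lambda>_. p"]) (simp add: chain_def)
  next
    case (Suc i)
    then obtain c where c: "chain i c" "c 0 = p" "c i \<in> assoc_primes (sat ?U (?J i))" by auto
    have i: "i < length fs" using Suc by simp
    have x: "fs ! i \<in> q" "nzd ?U (?J i) (fs ! i)" using fs(1) nth_mem[OF i] reg i by (auto simp: reg_seq_def)
    obtain p' where p': "p' \<in> assoc_primes (sat ?U (adjoin (?J i) (fs ! i)))" "c i \<subset> p'"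
      using assoc_primes_nzd[OF acc q J x c(3)] by blast
    have "?J (Suc i) = adjoin (?J i) (fs ! i)" using i by (simp add: take_Suc_conv_app_nth adjoins_snoc)
    moreover have "chain (Suc i) (\<lambda>j. if j \<le> i then c j else p')"
      using c(1) p' by (auto simp: chain_def le_Suc_eq less_Suc_eq assoc_primes_def)
    ultimately show ?case using p'(1) c(2) by (intro exI[of _ "\<lambda>j. if j \<le> i then c j else p'"]) simp
  qed
  from this[of "length fs"] obtain c where c: "chain (length fs) c" "c 0 = p"
    "c (length fs) \<in> assoc_primes (sat ?U (?J (length fs)))" by auto
  have "c (length fs) \<subseteq> q" by (rule assoc_primes_sat_subset[OF q J(1) c(3)])
  then show ?thesis using c by blast
qed

text \<open>If no element of \<open>P\<close> is regular modulo the sequence, \<open>P\<close> lies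
  in the union of finitely many associated primes, hence in one of them, and that prime has a
  socle.\<close>

lemma maximal_reg_seq_socle:
  assumes acc: "acc_above I" and I: "is_ideal I" and P: "is_ideal P"
    and fs: "set fs \<subseteq> P" and max: "\<And>h. h \<in> P \<Longrightarrow> \<not> nzd {1} (adjoins I fs) h"
  shows "\<exists>q. is_prime q \<and> I \<subseteq> q \<and> P \<subseteq> q \<and> has_socle q (adjoins I fs)"
proof -
  let ?J = "adjoins I fs"
  have fC: "set fs \<subseteq> C" using fs ideal_sub[OF P] by blast
  have J: "is_ideal ?J" "I \<subseteq> ?J" using adjoins_ideal[OF I fC] adjoins_sup by auto
  have fin: "finite (assoc_primes ?J)" by (rule finite_assoc_primes[OF acc J])
  have ap: "is_prime p" if "p \<in> assoc_primes ?J" for p using that by (simp add: assoc_primes_def)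
  have "\<not> (\<exists>h\<in>P. \<forall>p\<in>assoc_primes ?J. h \<notin> p)"
  proof
    assume "\<exists>h\<in>P. \<forall>p\<in>assoc_primes ?J. h \<notin> p"
    then obtain h where h: "h \<in> P" "\<forall>p\<in>assoc_primes ?J. h \<notin> p" by (rule bexE)
    have "nzd {1} ?J h"
      unfolding nzd_def sat_one[OF J(1)]
      using assoc_primes_zero_divisor[OF acc J ideal_sub[OF P h(1)]] h(2) by simp
    with max[OF h(1)] show False by simp
  qed
  then obtain q where q: "q \<in> assoc_primes ?J" "P \<subseteq> q"
    using prime_avoidance[OF fin ap P] by (cases "\<exists>q\<in>assoc_primes ?J. P \<subseteq> q") auto
  have "?J \<subseteq> q" using q(1) colon_sup[OF J(1)] by (auto simp: assoc_primes_def)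
  then show ?thesis using q J(2) ap[OF q(1)] assoc_prime_has_socle[OF J(1) q(1)] by blast
qed

end

section \<open>Monomial generators and heights\<close>

context monomial_ring
begin

lemma genideal_monomials:
  assumes "T \<subseteq> exps"
  shows "Idl\<^bsub>sring\<^esub> (mon ` T) = monideal {s + t | s t. s \<in> exps \<and> t \<in> T}"
    "upclosed {s + t | s t. s \<in> exps \<and> t \<in> T}"
proof -
  let ?E = "{s + t | s t. s \<in> exps \<and> t \<in> T}"
  have "s' + (s + t) \<in> ?E" if "s' \<in> exps" "s \<in> exps" "t \<in> T" for s' s t
    using that by (intro CollectI exI[of _ "s' + s"] exI[of _ t]) (simp add: add.assoc)
  then show E: "upclosed ?E" using assms by (auto simp: upclosed_def)
  have TC: "mon ` T \<subseteq> C" using assms by auto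
  have I: "is_ideal (Idl\<^bsub>sring\<^esub> (mon ` T))" by (rule genideal_ideal[OF TC])
  have TE: "t \<in> ?E" if "t \<in> T" for t using that by (intro CollectI exI[of _ 0] exI[of _ t]) simp
  show "Idl\<^bsub>sring\<^esub> (mon ` T) = monideal ?E"
  proof
    show "Idl\<^bsub>sring\<^esub> (mon ` T) \<subseteq> monideal ?E"
      using genideal_subset_iff[OF TC monideal_ideal[OF E]] TE by auto
    show "monideal ?E \<subseteq> Idl\<^bsub>sring\<^esub> (mon ` T)"
    proof
      fix f assume f: "f \<in> monideal ?E"
      show "f \<in> Idl\<^bsub>sring\<^esub> (mon ` T)"
      proof (rule ideal_terms[OF I])
        show "f \<in> C" using ideal_sub[OF monideal_ideal[OF E] f] .
        fix r assume "r \<in> keys f"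
        then obtain s t where "r = s + t" "s \<in> exps" "t \<in> T" using f by (auto simp: monideal_def)
        then show "mon r \<in> Idl\<^bsub>sring\<^esub> (mon ` T)"
          using genideal_sup[OF TC] by (auto intro: ideal_mon_add[OF I])
      qed
    qed
  qed
qed

lemma genideal_vars:
  assumes "B \<subseteq> V"
  shows "Idl\<^bsub>sring\<^esub> ((\<lambda>v. mon (single v 1)) ` B) = var_ideal B"
proof -
  let ?T = "(\<lambda>v. single v 1) ` B"
  have T: "?T \<subseteq> exps" using assms by (auto simp: exps_def)
  have "{s + t | s t. s \<in> exps \<and> t \<in> ?T} = {t \<in> exps. keys t \<inter> B \<noteq> {}}"
  proof (intro equalityI subsetI)
    fix r assume "r \<in> {s + t | s t. s \<in> exps \<and> t \<in> ?T}"
    then obtain s v where r: "r = s + single v 1" "s \<in> exps" "v \<in> B" by auto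
    then show "r \<in> {t \<in> exps. keys t \<inter> B \<noteq> {}}" using T by (auto simp: keys_add_nat)
  next
    fix r assume "r \<in> {t \<in> exps. keys t \<inter> B \<noteq> {}}"
    then obtain v where r: "r \<in> exps" "v \<in> keys r" "v \<in> B" by auto
    then show "r \<in> {s + t | s t. s \<in> exps \<and> t \<in> ?T}"
      using exps_split[OF r(2,1)] mon_split[OF r(2)]
      by (intro CollectI exI[of _ "r - single v 1"] exI[of _ "single v 1"]) (auto simp: add.commute)
  qed
  then show ?thesis using genideal_monomials(1)[OF T] by (simp add: var_ideal_def image_image)
qed

lemma prime_chain_sring: "prime_chain sring l c \<longleftrightarrow> chain l c"
  by (simp add: prime_chain_def chain_def primeideal_iff)

text \<open>Chains ending at the ideal are chains between \<open>var_ideal {}\<close>, the zero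
  ideal, and \<open>var_ideal B\<close>, which bounds its height as a prime. For the lower bound,
  adjoining the variables of \<open>B\<close> one at a time gives a chain below every prime over the
  ideal.\<close>

lemma height_var_ideal:
  assumes B: "B \<subseteq> V" shows "height sring (var_ideal B) = enat (card B)"
proof (rule antisym)
  have "enat l \<le> enat (card B)" if "chain l c" "c l = var_ideal B" for l c
  proof -
    have "0 \<in> c 0" using that(1) by (auto simp: chain_def intro: ideal_zero prime_ideal)
    moreover have "f = 0" if "f \<in> var_ideal {}" for f
      using that unfolding mem_var_ideal keys_eq_empty[symmetric] by blast
    ultimately have "var_ideal {} \<subseteq> c 0" by blast
    from chain_between_le[OF that(1) this _ _ B] that(2) show ?thesis by simp
  qed
  then have "prime_height sring (var_ideal B) \<le> enat (card B)"
    unfolding prime_height_def prime_chain_sring by (intro Sup_least) auto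
  moreover have "height sring (var_ideal B) \<le> prime_height sring (var_ideal B)"
    unfolding height_def by (intro Inf_lower) (use var_ideal_prime primeideal_iff in blast)
  ultimately show "height sring (var_ideal B) \<le> enat (card B)" by (rule order_trans[rotated])
  obtain c where c: "chain (card B) c" "c (card B) = var_ideal B"
    using var_chain_exists[of "{}" B] B by auto
  show "enat (card B) \<le> height sring (var_ideal B)"
    unfolding height_def
  proof (rule Inf_greatest)
    fix x assume "x \<in> {prime_height sring p |p. primeideal p sring \<and> var_ideal B \<subseteq> p}"
    then obtain p where p: "x = prime_height sring p" "is_prime p" "var_ideal B \<subseteq> p" by (auto simp: primeideal_iff)
    have "\<exists>l e. card B \<le> l \<and> chain l e \<and> e l = p"
    proof (cases "p = var_ideal B")
      case True
      then show ?thesis using c by blast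
    next
      case False
      let ?e = "\<lambda>i. if i \<le> card B then c i else p"
      have "chain (Suc (card B)) ?e"
        using c p False by (auto simp: chain_def le_Suc_eq less_Suc_eq)
      then show ?thesis by (intro exI[of _ "Suc (card B)"] exI[of _ ?e]) simp
    qed
    then obtain l e where e: "card B \<le> l" "chain l e" "e l = p" by blast
    have "enat (card B) \<le> enat l" using e(1) by simp
    also have "enat l \<le> x"
      unfolding p(1) prime_height_def prime_chain_sring by (intro Sup_upper) (use e in blast)
    finally show "enat (card B) \<le> x" .
  qed
qed

section \<open>Grade and mgrade for a set of variables\<close>

context
  fixes E :: "('v \<Rightarrow>\<^sub>0 nat) set" and vs :: "'v list"
  assumes E: "upclosed E" and proper: "monideal E \<noteq> C" and vs: "set vs \<subseteq> V" "distinct vs"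
begin

abbreviation "MI \<equiv> monideal E :: ('v, 'k) vpoly set"
abbreviation "MQ \<equiv> quotient_module sring MI"
abbreviation "vars \<equiv> map (\<lambda>v. mon (single v 1)) vs :: ('v, 'k) vpoly list"

definition assoc_vars :: "'v set set" where
  "assoc_vars = {A. A \<subseteq> V \<and> var_ideal A \<in> assoc_primes MI}"

lemma MI_ideal: "is_ideal MI" by (rule monideal_ideal[OF E])

lemma Ass_MQ: "Ass sring MQ = var_ideal ` assoc_vars"
  unfolding Ass_eq[OF MI_ideal] assoc_vars_def using assoc_prime_var_ideal[OF E] by blast

lemma finite_assoc_vars: "finite assoc_vars"
  by (rule finite_subset[of _ "Pow V"]) (auto simp: assoc_vars_def finite_V)

text \<open>A proper monomial ideal has no constant term, so it lies in the prime
  \<open>var_ideal V\<close>, below which an associated prime is found. This gives the maximum in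
  \<open>mgrade_height\<close> an element to be attained at.\<close>

lemma assoc_vars_nonempty: "assoc_vars \<noteq> {}"
proof -
  have "var_ideal V \<noteq> C" using var_ideal_prime[of V] by (simp add: is_prime_def)
  have "0 \<notin> E"
  proof
    assume "0 \<in> E"
    then have "1 \<in> MI" by (simp add: monideal_def)
    then show False using proper ideal_eq_iff_one[OF MI_ideal] by simp
  qed
  then have "keys t \<inter> V \<noteq> {}" if t: "t \<in> E" for t
  proof -
    have "t \<noteq> 0" "keys t \<subseteq> V" using t \<open>0 \<notin> E\<close> E by (auto simp: upclosed_def exps_def)
    then show ?thesis using keys_eq_empty[of t] by blast
  qed
  then have "MI \<subseteq> var_ideal V" using E unfolding var_ideal_def monideal_def upclosed_def by blast
  from exists_assoc_var_ideal[OF E var_ideal_prime this] show ?thesis unfolding assoc_vars_def by blast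
qed

lemma mgrade_eq: "mgrade sring vars MQ = Inf ((\<lambda>A. enat (card (set vs - A))) ` assoc_vars)"
proof -
  have "cd sring vars (quotient_module sring (var_ideal A)) = enat (card (set vs - A))" for A
  proof -
    interpret cech_setup V C A vs by unfold_locales (use vs in auto)
    show ?thesis using cd_eq by (simp only: gens_def)
  qed
  then show ?thesis unfolding mgrade_def Ass_MQ by (simp only: Setcompr_eq_image image_image)
qed

lemma set_vars_inter:
  assumes "A \<subseteq> V"
  shows "set vars \<inter> var_ideal A = (\<lambda>v. mon (single v 1)) ` (set vs \<inter> A)"
proof -
  have "mon (single v 1) \<in> var_ideal A \<longleftrightarrow> v \<in> A" if "v \<in> set vs" for v
    using mon_mem_var_ideal[of "single v 1" A] that vs(1) by (auto simp: exps_def)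
  then show ?thesis by auto
qed

text \<open>The minimum of n - h over the associated primes is n minus the maximum of h. The bound
  on \<open>d\<close> accompanies the formula because subtraction on \<open>enat\<close> is
  truncated.\<close>

theorem mgrade_height:
  defines "d \<equiv> Max {height sring (Idl\<^bsub>sring\<^esub> (set vars \<inter> p)) | p. p \<in> Ass sring MQ}"
  shows "d \<le> enat (length vs)" "mgrade sring vars MQ = enat (length vs) - d"
proof -
  let ?n = "length vs" and ?h = "\<lambda>A. card (set vs \<inter> A)"
  have "height sring (Idl\<^bsub>sring\<^esub> (set vars \<inter> var_ideal A)) = enat (?h A)" if "A \<in> assoc_vars" for A
  proof -
    have A: "A \<subseteq> V" using that by (simp add: assoc_vars_def)
    then have AV: "set vs \<inter> A \<subseteq> V" by blast
    show ?thesis unfolding set_vars_inter[OF A] genideal_vars[OF AV] by (rule height_var_ideal[OF AV])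
  qed
  then have "{height sring (Idl\<^bsub>sring\<^esub> (set vars \<inter> p)) | p. p \<in> Ass sring MQ} = (\<lambda>A. enat (?h A)) ` assoc_vars"
    unfolding Ass_MQ Setcompr_eq_image image_image by (intro image_cong refl) simp
  then have d: "d = Max ((\<lambda>A. enat (?h A)) ` assoc_vars)" by (simp only: d_def)
  have "d \<in> (\<lambda>A. enat (?h A)) ` assoc_vars"
    unfolding d using finite_assoc_vars assoc_vars_nonempty by (intro Max_in) auto
  then obtain A where A: "A \<in> assoc_vars" "d = enat (?h A)" by blast
  have le: "?h B \<le> ?h A" if "B \<in> assoc_vars" for B
  proof -
    have "enat (?h B) \<le> d" unfolding d using finite_assoc_vars that by (intro Max_ge) auto
    then show ?thesis by (simp add: A(2))
  qed
  have card: "card (set vs - B) = ?n - ?h B" for B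
    using card_Diff_subset_Int[of "set vs" B] distinct_card[OF vs(2)] by simp
  show "d \<le> enat ?n"
    using card_mono[of "set vs" "set vs \<inter> A"] distinct_card[OF vs(2)] by (simp add: A(2))
  have "mgrade sring vars MQ = enat (?n - ?h A)"
    unfolding mgrade_eq card
  proof (rule antisym)
    show "Inf ((\<lambda>B. enat (?n - ?h B)) ` assoc_vars) \<le> enat (?n - ?h A)" using A(1) by (intro Inf_lower) blast
    show "enat (?n - ?h A) \<le> Inf ((\<lambda>B. enat (?n - ?h B)) ` assoc_vars)"
    proof (rule Inf_greatest)
      fix x assume "x \<in> (\<lambda>B. enat (?n - ?h B)) ` assoc_vars"
      then obtain B where "B \<in> assoc_vars" "x = enat (?n - ?h B)" by blast
      then show "enat (?n - ?h A) \<le> x" using diff_le_mono2[OF le, of B ?n] by simp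
    qed
  qed
  then show "mgrade sring vars MQ = enat ?n - d" by (simp add: A(2))
qed

text \<open>Formulated for an arbitrary list of distinct variables, so that the ideals generated by
  the x's and by the y's are both instances.\<close>

theorem cohen_macaulay_maximal_depth:
  assumes cm: "cohen_macaulay (sring Quot MI)"
  shows "maximal_depth sring vars MQ"
proof -
  let ?W = "set vs"
  let ?P = "var_ideal ?W"
  have P: "Idl\<^bsub>sring\<^esub> (set vars) = ?P" using genideal_vars[OF vs(1)] by simp
  have acc: "acc_above MI" using cm by (intro noetherian_Quot_acc[OF MI_ideal]) (simp add: cohen_macaulay_def)
  have PC: "?P \<subseteq> C" using ideal_sub[OF var_ideal_ideal] by blast
  have upper: "length fs \<le> card (?W - A)"
    if fs: "set fs \<subseteq> ?P" "regular_sequence MQ fs" and A: "A \<in> assoc_vars" for fs A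
  proof -
    have AV: "A \<subseteq> V" "var_ideal A \<in> assoc_primes MI" using A by (simp_all add: assoc_vars_def)
    let ?q = "var_ideal (A \<union> ?W)"
    have q: "var_ideal A \<subseteq> ?q" "?P \<subseteq> ?q" by (rule var_ideal_mono; blast)+
    have fC: "set fs \<subseteq> C" using fs(1) PC by (rule order_trans)
    have reg: "reg_seq {1} MI fs" using fs(2) regular_sequence_iff[OF MI_ideal fC] by blast
    obtain c where c: "chain (length fs) c" "c 0 = var_ideal A" "c (length fs) \<subseteq> ?q"
      using assoc_prime_chain[OF acc MI_ideal var_ideal_prime AV(2) q(1) order_trans[OF fs(1) q(2)] reg] by blast
    have "length fs \<le> card ((A \<union> ?W) - A)"
      by (rule chain_between_le[OF c(1) _ c(3)]) (use c(2) AV(1) vs(1) in auto)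
    then show ?thesis by (simp add: Un_Diff)
  qed
  \<comment> \<open>Any single associated prime bounds the lengths, so a longest regular sequence
    exists, the empty one being a start.\<close>
  obtain A0 where A0: "A0 \<in> assoc_vars" using assoc_vars_nonempty by blast
  let ?R = "\<lambda>fs. set fs \<subseteq> ?P \<and> regular_sequence MQ fs"
  have Nil: "?R []" using regular_sequence_iff[OF MI_ideal, of "[]"] proper by (simp add: reg_seq_def)
  have "\<exists>fs. ?R fs \<and> (\<forall>gs. ?R gs \<longrightarrow> length gs \<le> length fs)"
    by (rule ex_has_greatest_nat[of ?R, OF Nil, where b = "Suc (card (?W - A0))"])
      (use upper A0 in \<open>auto simp: less_Suc_eq_le\<close>)
  then obtain fs where fs: "set fs \<subseteq> ?P" "regular_sequence MQ fs"
    and max: "\<And>gs. set gs \<subseteq> ?P \<Longrightarrow> regular_sequence MQ gs \<Longrightarrow> length gs \<le> length fs" by metis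
  have fC: "set fs \<subseteq> C" using fs(1) PC by (rule order_trans)
  have reg: "reg_seq {1} MI fs" using fs(2) regular_sequence_iff[OF MI_ideal fC] by blast
  have "\<not> nzd {1} (adjoins MI fs) h" if h: "h \<in> ?P" for h
  proof
    assume n: "nzd {1} (adjoins MI fs) h"
    let ?gs = "fs @ [h]"
    have gP: "set ?gs \<subseteq> ?P" using fs(1) h by simp
    \<comment> \<open>Regularity in the sense of the statement includes a nonzero quotient; the
      extended sequence and the monomial ideal stay inside this proper prime.\<close>
    let ?q = "var_ideal (A0 \<union> ?W)"
    have q: "var_ideal A0 \<subseteq> ?q" "?P \<subseteq> ?q" by (rule var_ideal_mono; blast)+
    have "MI \<subseteq> var_ideal A0"
      using A0 colon_sup[OF MI_ideal] by (auto simp: assoc_vars_def assoc_primes_def)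
    then have "adjoins MI ?gs \<subseteq> ?q"
      using q gP by (intro adjoins_subset var_ideal_ideal) auto
    moreover have "?q \<noteq> C" using var_ideal_prime[of "A0 \<union> ?W"] by (simp add: is_prime_def)
    moreover have "?q \<subseteq> C" using ideal_sub[OF var_ideal_ideal] by blast
    ultimately have "adjoins MI ?gs \<noteq> C" by blast
    moreover have "reg_seq {1} MI ?gs" using reg n by (simp add: reg_seq_snoc)
    moreover have "set ?gs \<subseteq> C" using gP PC by (rule order_trans)
    ultimately have "regular_sequence MQ ?gs" using regular_sequence_iff[OF MI_ideal] by blast
    from max[OF gP this] show False by simp
  qed
  then obtain q where q: "is_prime q" "MI \<subseteq> q" "?P \<subseteq> q" "has_socle q (adjoins MI fs)"
    using maximal_reg_seq_socle[OF acc MI_ideal var_ideal_ideal fs(1)] by blast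
  \<comment> \<open>The associated prime has to lie below \<open>q\<close>: only then does the chain
    from it to \<open>var_ideal (A \<union> ?W)\<close> run inside \<open>q\<close> and count for
    the dimension there.\<close>
  obtain A where A: "A \<subseteq> V" "var_ideal A \<in> assoc_primes MI" "var_ideal A \<subseteq> q"
    using exists_assoc_var_ideal[OF E q(1,2)] by blast
  have AW: "A \<in> assoc_vars" using A by (simp add: assoc_vars_def)
  have "A \<union> ?W \<subseteq> V" using A(1) vs(1) by simp
  then obtain c where c: "chain (card ((A \<union> ?W) - A)) c" "c 0 = var_ideal A"
    "c (card ((A \<union> ?W) - A)) = var_ideal (A \<union> ?W)"
    using var_chain_exists[of A "A \<union> ?W"] by blast
  have "var_ideal (A \<union> ?W) \<subseteq> q"
  proof
    fix f assume f: "f \<in> var_ideal (A \<union> ?W)"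
    show "f \<in> q"
    proof (rule ideal_terms[OF prime_ideal[OF q(1)]])
      show "f \<in> C" using f by (simp add: mem_var_ideal)
      fix t assume t: "t \<in> keys f"
      have te: "t \<in> exps" using f t by (auto simp: mem_var_ideal mem_C)
      have "keys t \<inter> A \<noteq> {} \<or> keys t \<inter> ?W \<noteq> {}" using f t unfolding mem_var_ideal by blast
      then have "mon t \<in> var_ideal A \<or> mon t \<in> ?P" by (simp add: mon_mem_var_ideal[OF te])
      then show "mon t \<in> q" using A(3) q(3) by blast
    qed
  qed
  moreover have "MI \<subseteq> c 0" using A(2) colon_sup[OF MI_ideal] unfolding c(2) by (auto simp: assoc_primes_def)
  ultimately obtain gs where gs: "card ((A \<union> ?W) - A) \<le> length gs" "set gs \<subseteq> q" "reg_seq (C - q) MI gs"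
    using cohen_macaulay_reg_seq[OF MI_ideal q(1,2) cm c(1)] c(3) by auto
  have fq: "set fs \<subseteq> q" using fs(1) q(3) by (rule order_trans)
  \<comment> \<open>\<open>fs\<close> leaves a socle at \<open>q\<close>, so no sequence regular at
    \<open>q\<close> is longer, not even the one that the Cohen-Macaulay property supplies.\<close>
  have "length gs \<le> length fs"
    by (rule reg_seq_length_le[OF acc q(1) MI_ideal order_refl fq _ q(4) gs(2,3)])
      (rule reg_seq_localize[OF mult_set_compl[OF q(1)] MI_ideal fC reg])
  with gs(1) have lower: "card (?W - A) \<le> length fs" by (simp add: Un_Diff)
  \<comment> \<open>One direction uses \<open>upper\<close> for all associated primes; the other
    runs through mgrade \<le> card (W - A) \<le> length fs \<le> grade for the one below
    \<open>q\<close>.\<close>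
  have "grade ?P MQ = mgrade sring vars MQ"
  proof (rule antisym)
    show "grade ?P MQ \<le> mgrade sring vars MQ"
      unfolding grade_def mgrade_eq using upper by (intro Sup_least Inf_greatest) auto
    have "mgrade sring vars MQ \<le> enat (card (?W - A))" unfolding mgrade_eq using AW by (intro Inf_lower) blast
    also have "\<dots> \<le> enat (length fs)" using lower by simp
    also have "\<dots> \<le> grade ?P MQ" unfolding grade_def by (intro Sup_upper) (use fs in blast)
    finally show "mgrade sring vars MQ \<le> grade ?P MQ" .
  qed
  then show ?thesis unfolding maximal_depth_def P .
qed

end

end

theorem proposition3p1:
  fixes m n :: nat and I :: "'k::field mpoly set"
  defines "S \<equiv> poly_ring m n :: 'k mpoly ring"
  assumes "monomial_ideal m n I" and "I \<noteq> carrier S"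
  shows
    "(let d = Max {height S (y_part m n p) | p. p \<in> Ass S (quotient_module S I)}
      in d \<le> enat n \<and> mgrade S (y_vars n) (quotient_module S I) = enat n - d) \<and>
     (cohen_macaulay (S Quot I) \<longrightarrow>
        maximal_depth S (x_vars m) (quotient_module S I) \<and>
        maximal_depth S (y_vars n) (quotient_module S I))"
proof -
  let ?V = "vars_of m n" and ?C = "{f :: 'k mpoly. \<forall>t\<in>keys f. keys t \<subseteq> vars_of m n}"
  interpret monomial_ring ?V ?C by unfold_locales (auto simp: vars_of_def)
  have exps: "exps = monoms_of m n" by (simp add: exps_def monoms_of_def)
  have C: "?C = {f. keys f \<subseteq> monoms_of m n}" by (auto simp: monoms_of_def)
  \<comment> \<open>The ring of the statement is literally the record \<open>sring\<close> of this
    interpretation, so the results transfer by rewriting alone.\<close>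
  have S: "S = sring" unfolding S_def poly_ring_def sring_def by (simp only: C)
  let ?xs = "map VarX [1..<Suc m]" and ?ys = "map VarY [1..<Suc n]"
  have x: "x_vars m = (map (\<lambda>v. mon (single v 1)) ?xs :: 'k mpoly list)"
    and y: "y_vars n = (map (\<lambda>v. mon (single v 1)) ?ys :: 'k mpoly list)"
    by (simp_all add: x_vars_def y_vars_def var_poly_def monom_poly_def)
  have vs: "set ?xs \<subseteq> ?V" "distinct ?xs" "set ?ys \<subseteq> ?V" "distinct ?ys"
    by (auto simp: vars_of_def distinct_map inj_on_def)
  obtain T where T: "T \<subseteq> exps" "I = Idl\<^bsub>sring\<^esub> (mon ` T)"
    using assms(2) unfolding monomial_ideal_def exps S[unfolded S_def] monom_poly_def by blast
  define E where "E = {s + t | s t. s \<in> exps \<and> t \<in> T}"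
  have E: "upclosed E" and I: "I = monideal E"
    using genideal_monomials[OF T(1)] T(2) unfolding E_def by simp_all
  have proper: "monideal E \<noteq> ?C" using assms(3) unfolding S I by simp
  have yp: "y_part m n p = Idl\<^bsub>sring\<^esub> (set (map (\<lambda>v. mon (single v 1)) ?ys) \<inter> p)" for p :: "'k mpoly set"
    unfolding y_part_def S[unfolded S_def] y ..
  have len: "length ?ys = n" by simp
  have "Max {height S (y_part m n p) | p. p \<in> Ass S (quotient_module S I)} \<le> enat n"
    "mgrade S (y_vars n) (quotient_module S I) =
      enat n - Max {height S (y_part m n p) | p. p \<in> Ass S (quotient_module S I)}"
    using mgrade_height[OF E proper vs(3,4)] unfolding S I y yp len by -
  moreover have "maximal_depth S (x_vars m) (quotient_module S I)" "maximal_depth S (y_vars n) (quotient_module S I)"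
    if "cohen_macaulay (S Quot I)"
    using cohen_macaulay_maximal_depth[OF E proper vs(1,2)] cohen_macaulay_maximal_depth[OF E proper vs(3,4)] that
    unfolding S I x y by blast+
  ultimately show ?thesis unfolding Let_def by blast
qed

end
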